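(* Let $n,m\ge1$ be integers. The matrix $Y_-Y_+$ is an invariant differential operator matrix on $\mathbb{H}_{n,m}$, so that each of its $(k,l)$ entries ($1\le k,l\le m$) is an invariant differential operator on $\mathbb{H}_{n,m}$. Moreover, for all integers $j\ge1$ and all $1\le k,l\le m$, the operators $$H^j=\mathrm{Tr}(A^{(j)}),\qquad T^j_{k,l}=\mathrm{Tr}(Y_{-,k}^tY_{+,l}^tA^{(j)}),\qquad U_{k,l}=\mathrm{Tr}(Y_{-,k}^tY_{-,l}X_+),\qquad V_{k,l}=\mathrm{Tr}(Y_{+,k}Y_{+,l}^tX_-)$$ are all invariant differential operators.
   Context: $\mathbb{H}_{n,m}=\mathbb{H}_n\times\mathbb{C}^{(m,n)}$, where $\mathbb{H}_n=\{Z\in M_{n,n}(\mathbb{C}):Z=Z^t,\ \mathrm{Im}(Z)>0\}$ and $\mathbb{C}^{(m,n)}$ is the space of complex $m\times n$ matrices; points are $(Z,W)$, $Y=\mathrm{Im}(Z)$, $V=\mathrm{Im}(W)$. The Jacobi group $G^J$ consists of pairs $g=(\gamma,(\lambda,\mu;\kappa))$ with $\gamma=\begin{pmatrix}A&B\\C&D\end{pmatrix}\in\mathrm{Sp}(n,\mathbb{R})$, $\lambda,\mu\in\mathbb{R}^{(m,n)}$, $\kappa\in\mathbb{R}^{(m,m)}$, $\kappa+\mu\lambda^t$ symmetric, acting by $g(Z,W)=\left((AZ+B)(CZ+D)^{-1},(W+\lambda Z+\mu)(CZ+D)^{-1}\right)$. A differential operator $P$ on $\mathbb{H}_{n,m}$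 is invariant if $P(F\circ g)=(PF)\circ g$ for all smooth $F$ and all $g\in G^J$; a matrix of operators is invariant if every entry is. Derivatives: $\frac{\partial}{\partial W}$ is the $n\times m$ matrix with $(j,i)$ entry $\frac{\partial}{\partial w_{ij}}$; $\frac{\partial}{\partial W_k}$ is its $k$-th column ($W_k$ is the $k$-th row of $W$). $\frac{\partial}{\partial Z}$ is the symmetric $n\times n$ matrix with diagonal entries $\frac{\partial}{\partial z_{ii}}$ and off-diagonal entries $\frac12\frac{\partial}{\partial z_{ij}}$. $\frac{\partial}{\partial\overline W},\frac{\partial}{\partial\overline W_k},\frac{\partial}{\partial\overline Z}$ are defined in the same way with antiholomorphic Wirtinger derivatives. For matrices of differential operators, products of entries are compositions of operators, multiplication by a matrix of functions on the left is multiplication by coefficients, and transposition only permutes the entries. Set $$Y_+=\frac{\partial}{\partial W},\quad Y_{+,k}=\frac{\partial}{\partial W_k},\quad Y_-=\Big(\frac{\partial}{\partial\overline W}\Big)^tY,\quad Y_{-,k}=\Big(\frac{\partial}{\partial\overline W_k}\Big)^tY,$$ $$X_+=2\sqrt{-1}\frac{\partial}{\partial Z}+\sqrt{-1}Y^{-1}V^t\Big(\frac{\partial}{\partial W}\Big)^t+\Big(\sqrt{-1}Y^{-1}V^t\Big(\frac{\partial}{\partial W}\Big)^t\Big)^t,\qquad X_-=Y(Y\overline{X_+})^t,$$ where $\overline{X_+}$ is the complex conjugate operator matrix, and $$K=YX_+,\qquad \Lambda=2\sqrt{-1}\,Y\frac{\partial}{\partial\overline Z}+\sqrt{-1}V^t\Big(\frac{\partial}{\partial\overline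 W}\Big)^t+\sqrt{-1}\,Y\Big(Y^{-1}V^t\Big(\frac{\partial}{\partial\overline W}\Big)^t\Big)^t.$$ Finally define $A^{(1)}=\Lambda K+\frac{n+1}{2}K$ and, for $j\ge2$, $$A^{(j)}=A^{(1)}A^{(j-1)}-\frac{n+1}{2}\Lambda A^{(j-1)}+\frac12\Lambda\,\mathrm{Tr}(A^{(j-1)})+\frac12(Z-\overline Z)\left((Z-\overline Z)^{-1}\big(\Lambda^t(A^{(j-1)})^t\big)^t\right)^t.$$ *)

theory Defs
  imports "HOL-Analysis.Analysis"
begin

section \<open>The Siegel--Jacobi space\<close>

text \<open>
  The sizes $n$ and $m$ are the cardinalities of the index types. An $m \times n$ matrix has
  type \<open>_^'n^'m\<close>, so \<open>W $ i $ j\<close> is the entry in row \<open>i :: 'm\<close> and column \<open>j :: 'n\<close>.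
\<close>

type_synonym ('n, 'm) point = "(complex^'n^'n) \<times> (complex^'n^'m)"

definition Im_mat :: "complex^'b^'a \<Rightarrow> real^'b^'a" where
  "Im_mat A = map_matrix Im A"

abbreviation cmat :: "real^'b^'a \<Rightarrow> complex^'b^'a" where
  "cmat A \<equiv> map_matrix complex_of_real A"

definition pos_def :: "real^'n^'n \<Rightarrow> bool" where
  "pos_def Q \<longleftrightarrow> transpose Q = Q \<and> (\<forall>x. x \<noteq> 0 \<longrightarrow> x \<bullet> (Q *v x) > 0)"

definition siegel :: "(complex^'n^'n) set" where
  "siegel = {Z. transpose Z = Z \<and> pos_def (Im_mat Z)}"

definition siegel_jacobi :: "('n::finite, 'm::finite) point set" where
  "siegel_jacobi = siegel \<times> UNIV"


section \<open>The Jacobi group and its action\<close>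

definition Jmat :: "real^('n::finite + 'n)^('n + 'n)" where
  "Jmat = (\<chi> a b. case (a, b) of
      (Inl i, Inr j) \<Rightarrow> if i = j then 1 else 0
    | (Inr i, Inl j) \<Rightarrow> if i = j then -1 else 0
    | _ \<Rightarrow> 0)"

definition Sp :: "(real^('n::finite + 'n)^('n + 'n)) set" where
  "Sp = {M. transpose M ** Jmat ** M = Jmat}"

definition blockA :: "real^('n::finite + 'n)^('n + 'n) \<Rightarrow> real^'n^'n" where
  "blockA M = (\<chi> i j. M $ Inl i $ Inl j)"
definition blockB :: "real^('n::finite + 'n)^('n + 'n) \<Rightarrow> real^'n^'n" where
  "blockB M = (\<chi> i j. M $ Inl i $ Inr j)"
definition blockC :: "real^('n::finite + 'n)^('n + 'n) \<Rightarrow> real^'n^'n" where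
  "blockC M = (\<chi> i j. M $ Inr i $ Inl j)"
definition blockD :: "real^('n::finite + 'n)^('n + 'n) \<Rightarrow> real^'n^'n" where
  "blockD M = (\<chi> i j. M $ Inr i $ Inr j)"

type_synonym ('n, 'm) jacobi_elt =
  "(real^('n + 'n)^('n + 'n)) \<times> (real^'n^'m) \<times> (real^'n^'m) \<times> (real^'m^'m)"

definition jacobi_group :: "('n::finite, 'm::finite) jacobi_elt set" where
  "jacobi_group = {(M, l, u, k). M \<in> Sp \<and> transpose (k + u ** transpose l) = k + u ** transpose l}"

definition jacobi_act ::
    "('n::finite, 'm::finite) jacobi_elt \<Rightarrow> ('n, 'm) point \<Rightarrow> ('n, 'm) point" where
  "jacobi_act = (\<lambda>(M, l, u, k) (Z, W).
     let R = matrix_inv (cmat (blockC M) ** Z + cmat (blockD M))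
     in ((cmat (blockA M) ** Z + cmat (blockB M)) ** R,
         (W + cmat l ** Z + cmat u) ** R))"


section \<open>Smooth functions and differential operators\<close>

text \<open>
  Functions on the Siegel--Jacobi space are total functions whose values outside of
  \<open>siegel_jacobi\<close> are irrelevant. That set is open in the real vector space of pairs $(S,T)$
  with $S$ symmetric, but not in the whole type \<open>point\<close>; so only directional derivatives along
  \<open>tangent_dirs\<close> are used, and they depend on the values in \<open>siegel_jacobi\<close> only.
\<close>

definition tangent_dirs :: "('n::finite, 'm::finite) point set" where
  "tangent_dirs = {(S, T). transpose S = S}"

definition dir_deriv ::
    "('n::finite, 'm::finite) point \<Rightarrow> (('n, 'm) point \<Rightarrow> complex) \<Rightarrow> ('n, 'm) point \<Rightarrow> complex" where
  "dir_deriv v F p = vector_derivative (\<lambda>t::real. F (p + t *\<^sub>R v)) (at 0)"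

primrec C_k :: "nat \<Rightarrow> (('n::finite, 'm::finite) point \<Rightarrow> complex) \<Rightarrow> bool" where
  "C_k 0 F \<longleftrightarrow> continuous_on siegel_jacobi F"
| "C_k (Suc k) F \<longleftrightarrow> continuous_on siegel_jacobi F \<and>
     (\<forall>v\<in>tangent_dirs.
        (\<forall>p\<in>siegel_jacobi. (\<lambda>t::real. F (p + t *\<^sub>R v)) differentiable (at 0)) \<and>
        C_k k (dir_deriv v F))"

definition smooth :: "(('n::finite, 'm::finite) point \<Rightarrow> complex) \<Rightarrow> bool" where
  "smooth F \<longleftrightarrow> (\<forall>k. C_k k F)"

type_synonym ('n, 'm) operator =
  "(('n, 'm) point \<Rightarrow> complex) \<Rightarrow> (('n, 'm) point \<Rightarrow> complex)"

text \<open>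
  A differential operator is a finite sum of iterated directional derivatives with smooth
  coefficients; the derivative along the list \<open>[v1, \<dots>, vr]\<close> is the composition of the
  derivatives along \<open>v1\<close>, \dots, \<open>vr\<close>.
\<close>

definition diff_operator :: "('n::finite, 'm::finite) operator \<Rightarrow> bool" where
  "diff_operator P \<longleftrightarrow>
     (\<exists>S a. finite S \<and> S \<subseteq> lists tangent_dirs \<and> (\<forall>vs\<in>S. smooth (a vs)) \<and>
        (\<forall>F. smooth F \<longrightarrow>
           (\<forall>p\<in>siegel_jacobi. P F p = (\<Sum>vs\<in>S. a vs p * foldr dir_deriv vs F p))))"

definition invariant_diff_operator :: "('n::finite, 'm::finite) operator \<Rightarrow> bool" where
  "invariant_diff_operator P \<longleftrightarrow> diff_operator P \<and>
     (\<forall>F. smooth F \<longrightarrow> (\<forall>g\<in>jacobi_group. \<forall>p\<in>siegel_jacobi.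
        P (F \<circ> jacobi_act g) p = (P F \<circ> jacobi_act g) p))"


section \<open>Matrices of operators\<close>

definition invariant_opmat :: "('n::finite, 'm::finite) operator^'b^'a \<Rightarrow> bool" where
  "invariant_opmat A \<longleftrightarrow> (\<forall>i j. invariant_diff_operator (A $ i $ j))"

definition op_add :: "('n::finite, 'm::finite) operator^'b^'a \<Rightarrow> ('n, 'm) operator^'b^'a
    \<Rightarrow> ('n, 'm) operator^'b^'a" (infixl "\<oplus>" 65) where
  "A \<oplus> B = (\<chi> i j. (\<lambda>F p. (A $ i $ j) F p + (B $ i $ j) F p))"

definition op_scale :: "complex \<Rightarrow> ('n::finite, 'm::finite) operator^'b^'a
    \<Rightarrow> ('n, 'm) operator^'b^'a" (infixr "\<odot>" 75) where
  "c \<odot> A = (\<chi> i j. (\<lambda>F p. c * (A $ i $ j) F p))"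

definition op_mult :: "('n::finite, 'm::finite) operator^'b^'a \<Rightarrow> ('n, 'm) operator^'c^'b
    \<Rightarrow> ('n, 'm) operator^'c^'a" (infixl "\<otimes>" 70) where
  "A \<otimes> B = (\<chi> i j. (\<lambda>F p. \<Sum>k\<in>UNIV. (A $ i $ k) ((B $ k $ j) F) p))"

text \<open>
  A matrix of functions is identified with the matrix of the corresponding multiplication
  operators; \<open>\<otimes>\<close> with such a matrix on the left multiplies coefficients.
\<close>

definition op_fun :: "(('n::finite, 'm::finite) point \<Rightarrow> complex^'b^'a)
    \<Rightarrow> ('n, 'm) operator^'b^'a" where
  "op_fun M = (\<chi> i j. (\<lambda>F p. M p $ i $ j * F p))"

definition op_trace :: "('n::finite, 'm::finite) operator^'a^'a \<Rightarrow> ('n, 'm) operator" where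
  "op_trace A = (\<lambda>F p. \<Sum>i\<in>UNIV. (A $ i $ i) F p)"

definition op_rmult :: "('n::finite, 'm::finite) operator^'b^'a \<Rightarrow> ('n, 'm) operator
    \<Rightarrow> ('n, 'm) operator^'b^'a" where
  "op_rmult A P = (\<chi> i j. (A $ i $ j) \<circ> P)"

definition op_cnj :: "('n::finite, 'm::finite) operator^'b^'a \<Rightarrow> ('n, 'm) operator^'b^'a" where
  "op_cnj A = (\<chi> i j. (\<lambda>F p. cnj ((A $ i $ j) (\<lambda>q. cnj (F q)) p)))"

definition op_col :: "'b \<Rightarrow> ('n::finite, 'm::finite) operator^'b^'a \<Rightarrow> ('n, 'm) operator^1^'a" where
  "op_col k A = (\<chi> i _. A $ i $ k)"


section \<open>Wirtinger derivatives\<close>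

text \<open>
  \<open>d c\<close> is the direction in which a complex coordinate moves with speed \<open>c\<close> (the others staying
  fixed), so \<open>d 1\<close> and \<open>d \<i>\<close> belong to its real and its imaginary part.
\<close>

definition wirtinger :: "(complex \<Rightarrow> ('n::finite, 'm::finite) point) \<Rightarrow> ('n, 'm) operator" where
  "wirtinger d F p = (dir_deriv (d 1) F p - \<i> * dir_deriv (d \<i>) F p) / 2"

definition wirtinger_bar :: "(complex \<Rightarrow> ('n::finite, 'm::finite) point) \<Rightarrow> ('n, 'm) operator" where
  "wirtinger_bar d F p = (dir_deriv (d 1) F p + \<i> * dir_deriv (d \<i>) F p) / 2"

text \<open>For \<open>i \<noteq> j\<close> the coordinate $z_{ij} = z_{ji}$ occupies two entries of the symmetric matrix.\<close>

definition zdir :: "'n::finite \<Rightarrow> 'n \<Rightarrow> complex \<Rightarrow> ('n, 'm::finite) point" where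
  "zdir i j c = (if i = j then axis i (axis i c)
                 else axis i (axis j c) + axis j (axis i c), 0)"

definition wdir :: "'m \<Rightarrow> 'n \<Rightarrow> complex \<Rightarrow> ('n::finite, 'm::finite) point" where
  "wdir i j c = (0, axis i (axis j c))"

definition dZ :: "('n::finite, 'm::finite) operator^'n^'n" where
  "dZ = (\<chi> i j. if i = j then wirtinger (zdir i i)
                else (\<lambda>F p. (1/2) * wirtinger (zdir i j) F p))"

definition dZbar :: "('n::finite, 'm::finite) operator^'n^'n" where
  "dZbar = (\<chi> i j. if i = j then wirtinger_bar (zdir i i)
                   else (\<lambda>F p. (1/2) * wirtinger_bar (zdir i j) F p))"

definition dW :: "('n::finite, 'm::finite) operator^'m^'n" where
  "dW = (\<chi> j i. wirtinger (wdir i j))"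

definition dWbar :: "('n::finite, 'm::finite) operator^'m^'n" where
  "dWbar = (\<chi> j i. wirtinger_bar (wdir i j))"


section \<open>The operator matrices\<close>

definition Ymat :: "('n::finite, 'm::finite) point \<Rightarrow> complex^'n^'n" where
  "Ymat p = cmat (Im_mat (fst p))"

definition Yinv :: "('n::finite, 'm::finite) point \<Rightarrow> complex^'n^'n" where
  "Yinv p = matrix_inv (Ymat p)"

definition Vtr :: "('n::finite, 'm::finite) point \<Rightarrow> complex^'m^'n" where
  "Vtr p = transpose (cmat (Im_mat (snd p)))"

definition ZmZbar :: "('n::finite, 'm::finite) point \<Rightarrow> complex^'n^'n" where
  "ZmZbar p = fst p - map_matrix cnj (fst p)"

definition ZmZbar_inv :: "('n::finite, 'm::finite) point \<Rightarrow> complex^'n^'n" where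
  "ZmZbar_inv p = matrix_inv (ZmZbar p)"

definition Yplus :: "('n::finite, 'm::finite) operator^'m^'n" where
  "Yplus = dW"

definition Yplus_col :: "'m \<Rightarrow> ('n::finite, 'm::finite) operator^1^'n" where
  "Yplus_col k = op_col k dW"

definition Yminus :: "('n::finite, 'm::finite) operator^'n^'m" where
  "Yminus = transpose dWbar \<otimes> op_fun Ymat"

definition Yminus_row :: "'m \<Rightarrow> ('n::finite, 'm::finite) operator^'n^1" where
  "Yminus_row k = transpose (op_col k dWbar) \<otimes> op_fun Ymat"

definition Xplus :: "('n::finite, 'm::finite) operator^'n^'n" where
  "Xplus = (2 * \<i>) \<odot> dZ
     \<oplus> \<i> \<odot> (op_fun Yinv \<otimes> op_fun Vtr \<otimes> transpose dW)
     \<oplus> transpose (\<i> \<odot> (op_fun Yinv \<otimes> op_fun Vtr \<otimes> transpose dW))"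

definition Xminus :: "('n::finite, 'm::finite) operator^'n^'n" where
  "Xminus = op_fun Ymat \<otimes> transpose (op_fun Ymat \<otimes> op_cnj Xplus)"

definition Kop :: "('n::finite, 'm::finite) operator^'n^'n" where
  "Kop = op_fun Ymat \<otimes> Xplus"

definition Lambda :: "('n::finite, 'm::finite) operator^'n^'n" where
  "Lambda = (2 * \<i>) \<odot> (op_fun Ymat \<otimes> dZbar)
     \<oplus> \<i> \<odot> (op_fun Vtr \<otimes> transpose dWbar)
     \<oplus> \<i> \<odot> (op_fun Ymat \<otimes> transpose (op_fun Yinv \<otimes> op_fun Vtr \<otimes> transpose dWbar))"

definition A_one :: "('n::finite, 'm::finite) operator^'n^'n" where
  "A_one = Lambda \<otimes> Kop \<oplus> ((of_nat CARD('n) + 1) / 2) \<odot> Kop"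

definition A_step ::
    "('n::finite, 'm::finite) operator^'n^'n \<Rightarrow> ('n, 'm) operator^'n^'n" where
  "A_step A = A_one \<otimes> A
     \<oplus> (- ((of_nat CARD('n) + 1) / 2)) \<odot> (Lambda \<otimes> A)
     \<oplus> (1/2) \<odot> op_rmult Lambda (op_trace A)
     \<oplus> (1/2) \<odot> (op_fun ZmZbar \<otimes>
          transpose (op_fun ZmZbar_inv \<otimes> transpose (transpose Lambda \<otimes> transpose A)))"

text \<open>Only the indices \<open>j \<ge> 1\<close> are meaningful; the value at \<open>0\<close> is a dummy.\<close>

fun Aop :: "nat \<Rightarrow> ('n::finite, 'm::finite) operator^'n^'n" where
  "Aop 0 = (\<chi> i k. (\<lambda>F p. 0))"
| "Aop (Suc 0) = A_one"
| "Aop (Suc (Suc j)) = A_step (Aop (Suc j))"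

definition Hop :: "nat \<Rightarrow> ('n::finite, 'm::finite) operator" where
  "Hop j = op_trace (Aop j)"

definition Top :: "nat \<Rightarrow> 'm \<Rightarrow> 'm \<Rightarrow> ('n::finite, 'm::finite) operator" where
  "Top j k l = op_trace (transpose (Yminus_row k) \<otimes> transpose (Yplus_col l) \<otimes> Aop j)"

definition Uop :: "'m \<Rightarrow> 'm \<Rightarrow> ('n::finite, 'm::finite) operator" where
  "Uop k l = op_trace (transpose (Yminus_row k) \<otimes> Yminus_row l \<otimes> Xplus)"

definition Vop :: "'m \<Rightarrow> 'm \<Rightarrow> ('n::finite, 'm::finite) operator" where
  "Vop k l = op_trace (Yplus_col k \<otimes> transpose (Yplus_col l) \<otimes> Xminus)"

end

theory Submission
  imports Defs
begin

text \<open>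
  Put \<open>J = C Z + D\<close>, \<open>R = J\<inverse>\<close>, \<open>\<Theta> = Z - conj Z = 2 \<i> Y\<close> and \<open>P = V Y\<inverse>\<close>, and mark quantities at
  the image point of a group element \<open>g\<close> by a prime. The differential of the action satisfies
  \<open>dZ' = R\<^sup>t dZ R\<close> and \<open>dW' - P' dZ' = (dW - P dZ) R\<close> (\<open>act_has_derivative\<close>, \<open>slope_act\<close>).
  Dually, the derivatives \<open>D\<close> along the frame \<open>(S, P S)\<close>, \<open>S\<close> symmetric, and the fibre
  derivatives transform by \<open>D (F \<circ> g) = R (D' F \<circ> g) R\<^sup>t\<close> and \<open>\<partial>\<^sub>W (F \<circ> g) = R (\<partial>\<^sub>W F \<circ> g)\<close>. Up
  to coefficients all first-order operator matrices are of these two kinds or conjugate to them: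
  \<open>Xplus = 2 \<i> D\<close>, \<open>Kop = \<Theta> D\<close> and \<open>Lambda = \<Theta> conj D\<close>. Fibre derivatives annihilate functions
  of \<open>Z\<close>. So they commute with the factors \<open>J\<close> and \<open>R\<close>, which cancel in \<open>Yminus \<otimes> Yplus\<close>, \<open>Uop\<close>
  and \<open>Vop\<close> by means of \<open>Y R = conj J\<^sup>t Y'\<close> and its conjugate.

  The heart of the matter is the law \<open>A\<^sup>(\<^sup>j\<^sup>) (F \<circ> g) = J\<^sup>t (A\<^sup>(\<^sup>j\<^sup>) F \<circ> g) R\<^sup>t\<close>, which gives
  the invariance of \<open>Hop\<close> and, with the remark on fibre derivatives, of \<open>Top\<close>. Let \<open>Kop\<close> and
  \<open>Lambda\<close> act on matrices of functions as \<open>KK f = \<Theta> div f\<close> and \<open>LL f = \<Theta> divbar f\<close>, where \<open>div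
  f\<close> has the entries \<open>\<Sum>k. D\<^sub>a\<^sub>k f\<^sub>k\<^sub>j\<close>, and let \<open>\<delta> = (n + 1) / 2\<close>, so that \<open>div Z = \<delta>\<close>. The
  Leibniz and chain rules with \<open>\<Theta> C\<^sup>t = J\<^sup>t - conj J\<^sup>t\<close> yield \<open>(KK - \<delta>) (J\<^sup>t (h \<circ> g)) = conj J\<^sup>t
  ((KK - \<delta>) h \<circ> g)\<close> and \<open>(LL + \<delta>) (conj J\<^sup>t (h \<circ> g)) = J\<^sup>t ((LL + \<delta>) h \<circ> g)\<close> (\<open>KK_J\<close>, \<open>LL_J\<close>).
  The initial operator is \<open>(LL + \<delta>) KK\<close>, and the recursion sends \<open>f\<close> to \<open>(LL + \<delta>) (KK - \<delta>) f +
  \<delta>\<^sup>2 f\<close> plus a term with the trace of \<open>f\<close> and one with its transpose. It is applied to \<open>f = J\<^sup>t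
  (M \<circ> g) R\<^sup>t = J\<^sup>t (h \<circ> g)\<close>, where \<open>h = M (A - Z C)\<close> because \<open>R\<^sup>t = A - Z' C\<close>
  (\<open>transpose_R_eq\<close>). The derivative of the right factor leaves \<open>- \<Theta> (M\<^sup>t + tr M) C / 2\<close> in \<open>KK
  h\<close>, and \<open>(LL + \<delta>) (\<Theta> N)\<close> equals \<open>\<Theta> divbar (\<Theta> N)\<close> with the inner \<open>\<Theta>\<close> treated as constant
  (\<open>LL_ZmZbar_mult\<close>). The two terms arising in this way cancel against those that \<open>conj R\<^sup>t =
  R\<^sup>t + \<Theta>' C\<close> produces in the trace and the transpose term (\<open>maass_step_act\<close>).

  The remaining work is analytic. The classes \<open>C_k\<close> are defined by directional derivatives;
  continuous partial derivatives yield a Frechet derivative along the symmetric matrices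
  (\<open>C1_has_derivative\<close>), hence the chain rule for the action, smoothness of the coefficients and
  of \<open>F \<circ> g\<close>, and the closure of the differential operators under sums and compositions.
\<close>

section \<open>Complex matrices\<close>

lemma matrix_mul_componentwise: "(A ** B) $ i $ j = (\<Sum>k\<in>UNIV. A $ i $ k * B $ k $ j)"
  by (simp add: matrix_matrix_mult_def)

lemma transpose_componentwise [simp]: "transpose A $ i $ j = A $ j $ i"
  by (simp add: transpose_def)

lemma transpose_add: "transpose (A + B) = transpose A + transpose B"
  by (simp add: vec_eq_iff)

lemma transpose_diff: "transpose (A - B) = transpose A - transpose B"
  by (simp add: vec_eq_iff)

lemma transpose_zero [simp]: "transpose 0 = 0"
  by (simp add: vec_eq_iff)

lemma matrix_add_rdistrib: "(B + C) ** A = B ** A + C ** (A :: 'a::ring_1^'c^'b)"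
  by (simp add: vec_eq_iff matrix_mul_componentwise algebra_simps sum.distrib)

lemma matrix_diff_ldistrib: "A ** (B - C) = A ** B - A ** (C :: 'a::ring_1^'c^'b)"
  by (simp add: vec_eq_iff matrix_mul_componentwise algebra_simps sum_subtractf)

lemma matrix_diff_rdistrib: "(B - C) ** A = B ** A - C ** (A :: 'a::ring_1^'c^'b)"
  by (simp add: vec_eq_iff matrix_mul_componentwise algebra_simps sum_subtractf)

lemma matrix_minus_left: "(- A) ** B = - (A ** (B :: 'a::ring_1^'c^'b))"
  by (simp add: vec_eq_iff matrix_mul_componentwise sum_negf)

lemma matrix_minus_right: "A ** (- B) = - (A ** (B :: 'a::ring_1^'c^'b))"
  by (simp add: vec_eq_iff matrix_mul_componentwise sum_negf)

text \<open>Multiplication of a complex matrix by a complex scalar.\<close>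

definition mscale :: "complex \<Rightarrow> complex^'b^'a \<Rightarrow> complex^'b^'a" (infixr "*\<^sub>m" 75) where
  "c *\<^sub>m A = map_matrix ((*) c) A"

lemma mscale_componentwise [simp]: "(c *\<^sub>m A) $ i $ j = c * A $ i $ j"
  by (simp add: mscale_def)

lemma mscale_mult_left: "(c *\<^sub>m A) ** B = c *\<^sub>m (A ** B)"
  by (simp add: vec_eq_iff matrix_mul_componentwise sum_distrib_left mult.assoc)

lemma mscale_mult_right: "A ** (c *\<^sub>m B) = c *\<^sub>m (A ** B)"
  by (simp add: vec_eq_iff matrix_mul_componentwise sum_distrib_left mult.left_commute)

lemma mscale_add: "c *\<^sub>m (A + B) = c *\<^sub>m A + c *\<^sub>m B"
  by (simp add: vec_eq_iff algebra_simps)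

lemma mscale_diff: "c *\<^sub>m (A - B) = c *\<^sub>m A - c *\<^sub>m B"
  by (simp add: vec_eq_iff algebra_simps)

lemma mscale_mscale: "c *\<^sub>m d *\<^sub>m A = (c * d) *\<^sub>m A"
  by (simp add: vec_eq_iff algebra_simps)

lemma mscale_1 [simp]: "1 *\<^sub>m A = A"
  by (simp add: vec_eq_iff)

lemma mscale_minus_1: "(-1) *\<^sub>m A = - A"
  by (simp add: vec_eq_iff)

lemma transpose_mscale: "transpose (c *\<^sub>m A) = c *\<^sub>m transpose A"
  by (simp add: vec_eq_iff)

abbreviation conj_mat :: "complex^'b^'a \<Rightarrow> complex^'b^'a" where
  "conj_mat A \<equiv> map_matrix cnj A"

lemma conj_mat_mult: "conj_mat (A ** B) = conj_mat A ** conj_mat B"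
  by (simp add: vec_eq_iff matrix_mul_componentwise)

lemma conj_mat_add: "conj_mat (A + B) = conj_mat A + conj_mat B"
  by (simp add: vec_eq_iff)

lemma conj_mat_diff: "conj_mat (A - B) = conj_mat A - conj_mat B"
  by (simp add: vec_eq_iff)

lemma conj_mat_mscale: "conj_mat (c *\<^sub>m A) = cnj c *\<^sub>m conj_mat A"
  by (simp add: vec_eq_iff)

lemma conj_mat_transpose: "conj_mat (transpose A) = transpose (conj_mat A)"
  by (simp add: vec_eq_iff)

lemma conj_mat_conj_mat [simp]: "conj_mat (conj_mat A) = A"
  by (simp add: vec_eq_iff)

lemma conj_mat_cmat [simp]: "conj_mat (cmat A) = cmat A"
  by (simp add: vec_eq_iff)

lemma conj_mat_mat [simp]: "conj_mat (mat c) = mat (cnj c)"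
  by (simp add: vec_eq_iff mat_def)

lemma cmat_mult: "cmat (A ** B) = cmat A ** cmat B"
  by (simp add: vec_eq_iff matrix_mul_componentwise)

lemma cmat_diff: "cmat (A - B) = cmat A - cmat B"
  by (simp add: vec_eq_iff)

lemma cmat_transpose: "cmat (transpose A) = transpose (cmat A)"
  by (simp add: vec_eq_iff)

lemma cmat_mat: "cmat (mat c) = mat (of_real c)"
  by (simp add: vec_eq_iff mat_def)

lemma matrix_inv_right: "invertible A \<Longrightarrow> A ** matrix_inv A = mat 1"
  unfolding invertible_def matrix_inv_def by (rule someI2_ex) auto

lemma matrix_inv_left: "invertible A \<Longrightarrow> matrix_inv A ** A = mat 1"
  unfolding invertible_def matrix_inv_def by (rule someI2_ex) auto

lemma matrix_inv_unique:
  assumes "B ** A = mat 1" "A ** B = mat 1"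
  shows "matrix_inv A = (B :: 'a::semiring_1^'n^'m)"
proof -
  have "invertible A" using assms by (auto simp: invertible_def)
  from matrix_inv_right[OF this] have "B ** A ** matrix_inv A = B"
    by (simp add: matrix_mul_assoc[symmetric])
  then show ?thesis by (simp add: assms)
qed

lemma invertible_cancel_right:
  assumes "invertible A" "X ** A = Y ** A"
  shows "X = (Y :: 'a::semiring_1^'n^'m)"
  using assms by (metis invertible_def matrix_mul_assoc matrix_mul_rid)

lemma invertible_cancel_left:
  assumes "invertible A" "A ** X = A ** Y"
  shows "X = (Y :: 'a::semiring_1^'n^'m)"
  using assms by (metis invertible_def matrix_mul_assoc matrix_mul_lid)

lemma invertible_transpose: "invertible A \<Longrightarrow> invertible (transpose (A :: 'a::comm_semiring_1^'n^'m))"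
  unfolding invertible_def by (metis matrix_transpose_mul transpose_mat)

lemma transpose_matrix_inv:
  "invertible A \<Longrightarrow> transpose (matrix_inv A) = matrix_inv (transpose (A ::
      'a::comm_semiring_1^'n^'m))"
  by (rule matrix_inv_unique[symmetric])
    (simp_all add: matrix_transpose_mul[symmetric] matrix_inv_left matrix_inv_right)

lemma invertible_mscale:
  assumes "c \<noteq> 0" "invertible A" shows "invertible (c *\<^sub>m A)"
  unfolding invertible_def
  by (rule exI[of _ "inverse c *\<^sub>m matrix_inv A"])
    (use assms in \<open>simp add: mscale_mult_left mscale_mult_right mscale_mscale matrix_inv_left
        matrix_inv_right\<close>)

lemma bounded_bilinear_matrix_mult:
  "bounded_bilinear ((**) :: complex^'b^'a \<Rightarrow> complex^'c^'b \<Rightarrow> complex^'c^'a)"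
  unfolding bilinear_conv_bounded_bilinear[symmetric] bilinear_def linear_iff
  by (simp add: vec_eq_iff matrix_mul_componentwise algebra_simps sum.distrib scaleR_sum_right)

text \<open>
  The resolvent identity \<open>B\<inverse> - A\<inverse> = B\<inverse> (A - B) A\<inverse>\<close> first bounds the inverse near an
  invertible matrix and then, used twice, gives its derivative.
\<close>

lemma has_derivative_matrix_inv:
  fixes A :: "complex^'n^'n"
  assumes A: "invertible A"
  shows "(matrix_inv has_derivative (\<lambda>H. - (matrix_inv A ** H ** matrix_inv A)))
           (at A within {B. invertible B})"
proof -
  define R where "R = matrix_inv A"
  note mm = bounded_bilinear_matrix_mult
  obtain K where K: "K > 0" "\<And>(X :: complex^'n^'n) (Y :: complex^'n^'n). norm (X
      ** Y) \<le> norm X * norm Y * K"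
    using bounded_bilinear.pos_bounded[OF mm] by blast
  have K3: "norm (X ** Y ** Z) \<le> norm X * norm Y * norm Z * (K * K)" for X Y Z :: "complex^'n^'n"
  proof -
    have "norm (X ** Y ** Z) \<le> norm (X ** Y) * norm Z * K" by (rule K)
    also have "\<dots> \<le> (norm X * norm Y * K) * norm Z * K"
      using K by (intro mult_right_mono) auto
    finally show ?thesis by (simp add: mult_ac)
  qed
  have res: "matrix_inv B - R = matrix_inv B ** (A - B) ** R" if "invertible B" for B
  proof -
    have "matrix_inv B ** (A - B) ** R = matrix_inv B ** (A ** R) - (matrix_inv B ** B) ** R"
      by (simp add: matrix_diff_ldistrib matrix_diff_rdistrib matrix_mul_assoc)
    then show ?thesis by (simp add: R_def matrix_inv_right matrix_inv_left A that)
  qed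
  define c where "c = norm R * (K * K)"
  have c: "c \<ge> 0" using K by (simp add: c_def)
  have bnd: "norm (matrix_inv B) \<le> 2 * norm R" if B: "invertible B" "norm (B - A) * c \<le> 1/2" for B
  proof -
    have "norm (matrix_inv B) \<le> norm R + norm (matrix_inv B - R)"
      by (metis add.commute diff_add_cancel norm_triangle_ineq)
    also have "norm (matrix_inv B - R) \<le> norm (matrix_inv B) * norm (A - B) * norm R * (K * K)"
      unfolding res[OF B(1)] by (rule K3)
    also have "\<dots> = norm (matrix_inv B) * (norm (B - A) * c)"
      by (simp add: c_def norm_minus_commute mult_ac)
    also have "\<dots> \<le> norm (matrix_inv B) * (1/2)"
      using B by (intro mult_left_mono) auto
    finally show ?thesis by simp
  qed
  have lin: "bounded_linear (\<lambda>H. - (R ** H ** R))"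
    by (intro bounded_linear_minus bounded_linear_compose[OF
        bounded_bilinear.bounded_linear_left[OF mm] bounded_bilinear.bounded_linear_right[OF mm]])
  have quad: "norm (matrix_inv B - R - - (R ** (B - A) ** R)) \<le> 2 * norm R * c * c * norm (B
      - A) * norm (B - A)"
    if B: "invertible B" "norm (B - A) * c \<le> 1/2" for B
  proof -
    have "(matrix_inv B - R) ** (A - B) ** R = matrix_inv B ** (A - B) ** R - R ** (A - B) ** R"
      by (simp only: matrix_diff_rdistrib)
    also have "\<dots> = (matrix_inv B - R) - R ** (A - B) ** R" by (simp only: res[OF B(1)])
    also have "\<dots> = matrix_inv B - R - - (R ** (B - A) ** R)"
      by (simp add: matrix_diff_ldistrib matrix_diff_rdistrib)
    finally have "matrix_inv B - R - - (R ** (B - A) ** R) = (matrix_inv B - R) ** (A - B) ** R" ..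
    also have "norm \<dots> \<le> norm (matrix_inv B - R) * norm (A - B) * norm R * (K * K)" by (rule K3)
    also have "\<dots> = norm (matrix_inv B - R) * (norm (B - A) * c)"
      by (simp add: c_def norm_minus_commute mult_ac)
    also have "\<dots> \<le> (norm (matrix_inv B) * norm (A - B) * norm R * (K * K)) * (norm (B - A) * c)"
      unfolding res[OF B(1)] using c by (intro mult_right_mono K3) auto
    also have "\<dots> \<le> (2 * norm R * norm (A - B) * norm R * (K * K)) * (norm (B - A) * c)"
      using c K by (intro mult_right_mono bnd B) auto
    finally show ?thesis by (simp add: c_def norm_minus_commute mult_ac)
  qed
  show ?thesis
    unfolding R_def[symmetric] has_derivative_within_alt
  proof (intro conjI allI impI lin)
    fix e :: real assume e: "e > 0"
    define k where "k = 2 * norm R * c * c"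
    have k: "k \<ge> 0" using c by (simp add: k_def)
    define d where "d = min (1 / (2 * (c + 1))) (e / (k + 1))"
    have d: "d > 0" using c e k by (simp add: d_def add_nonneg_pos)
    show "\<exists>d>0. \<forall>y\<in>{B. invertible B}. norm (y - A) < d \<longrightarrow>
        norm (matrix_inv y - R - - (R ** (y - A) ** R)) \<le> e * norm (y - A)"
    proof (intro exI[of _ d] conjI ballI impI d)
      fix B assume B: "B \<in> {B. invertible B}" "norm (B - A) < d"
      have "norm (B - A) * c \<le> (1 / (2 * (c + 1))) * c"
        using B c by (intro mult_right_mono) (auto simp: d_def)
      also have "\<dots> \<le> 1/2" using c by (simp add: field_simps)
      finally have 1: "norm (B - A) * c \<le> 1/2" .
      have "k * norm (B - A) \<le> (k + 1) * (e / (k + 1))"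
        using B k by (intro mult_mono) (auto simp: d_def)
      also have "\<dots> = e" using k by simp
      finally have "k * norm (B - A) * norm (B - A) \<le> e * norm (B - A)"
        by (intro mult_right_mono) auto
      with quad[of B, folded k_def] 1 B show "norm (matrix_inv B - R - - (R ** (B
          - A) ** R)) \<le> e * norm (B - A)"
        by auto
    qed
  qed
qed

section \<open>Positive definite matrices and the Siegel--Jacobi space\<close>

text \<open>
  The hermitian form of a real matrix at \<open>a + \<i> b\<close> has real part \<open>Q(a) + Q(b)\<close>, where \<open>Q\<close>
  denotes the quadratic form.
\<close>

lemma pos_def_complex:
  assumes Q: "pos_def Q" and v: "v \<noteq> 0"
  shows "Re (\<Sum>i\<in>UNIV. \<Sum>j\<in>UNIV. cnj (v $ i) * of_real (Q $ i $ j) * v $ j) > 0"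
proof -
  define a b where "a = (\<chi> i. Re (v $ i))" and "b = (\<chi> i. Im (v $ i))"
  have q: "x \<bullet> (Q *v x) = (\<Sum>i\<in>UNIV. \<Sum>j\<in>UNIV. Q $ i $ j * (x $ i * x $ j))" for x
    by (simp add: inner_vec_def matrix_vector_mult_def sum_distrib_left mult_ac)
  have "Re (\<Sum>i\<in>UNIV. \<Sum>j\<in>UNIV. cnj (v $ i) * of_real (Q $ i $ j) * v $ j)
      = a \<bullet> (Q *v a) + b \<bullet> (Q *v b)"
    unfolding q sum.distrib[symmetric]
    by (simp add: a_def b_def algebra_simps)
  moreover have "a \<noteq> 0 \<or> b \<noteq> 0"
    using v by (auto simp: a_def b_def vec_eq_iff complex_eq_iff)
  moreover have "x \<bullet> (Q *v x) \<ge> 0" for x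
    using Q by (cases "x = 0") (auto simp: pos_def_def less_imp_le)
  moreover have "x \<noteq> 0 \<Longrightarrow> x \<bullet> (Q *v x) > 0" for x
    using Q by (auto simp: pos_def_def)
  ultimately show ?thesis by (metis add_nonneg_pos add_pos_nonneg)
qed

lemma invertible_cmat_pos_def:
  assumes "pos_def Q" shows "invertible (cmat Q)"
proof -
  have "\<forall>x. Q *v x = 0 \<longrightarrow> x = 0"
    using assms by (metis inner_zero_right less_irrefl pos_def_def)
  then obtain B where B: "B ** Q = mat 1" using matrix_left_invertible_ker by blast
  then have "cmat B ** cmat Q = mat 1" by (metis cmat_mult cmat_mat of_real_1)
  then show ?thesis using invertible_left_inverse by blast
qed

text \<open>
  By compactness of the unit sphere the quadratic form of \<open>Q\<close> is bounded below by \<open>m \<bar>x\<bar>\<^sup>2\<close> with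
  \<open>m > 0\<close>; this survives a small perturbation of \<open>Q\<close>.
\<close>

lemma pos_def_open:
  fixes Q :: "real^'n^'n"
  assumes Q: "pos_def Q"
  shows "\<exists>e>0. \<forall>Q'. transpose Q' = Q' \<longrightarrow> norm (Q' - Q) < e \<longrightarrow> pos_def Q'"
proof -
  let ?f = "\<lambda>x. x \<bullet> (Q *v x)"
  have cont: "continuous_on (sphere 0 1) ?f"
    by (intro continuous_intros linear_continuous_on linear_linear[THEN iffD1]
        matrix_vector_mul_linear)
  obtain x0 where x0: "x0 \<in> sphere 0 1" "\<And>x. x \<in> sphere 0 1 \<Longrightarrow> ?f x0 \<le> ?f x"
    using continuous_attains_inf[OF compact_sphere _ cont] by auto
  define m where "m = ?f x0"
  have "x0 \<noteq> 0" using x0 by auto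
  then have m: "m > 0" using Q by (auto simp: m_def pos_def_def)
  have bil: "bounded_bilinear (\<lambda>(A::real^'n^'n) x. A *v x)"
    unfolding bilinear_conv_bounded_bilinear[symmetric] bilinear_def linear_iff
    by (simp add: vec_eq_iff matrix_vector_mult_def algebra_simps sum.distrib scaleR_sum_right
        sum_distrib_left)
  then obtain K where K: "K > 0" "\<And>(A::real^'n^'n) x. norm (A *v x) \<le> norm A * norm x * K"
    using bounded_bilinear.pos_bounded by blast
  have ge: "?f x \<ge> m * (norm x)\<^sup>2" for x
  proof (cases "x = 0")
    case False
    then have "m \<le> ?f (x /\<^sub>R norm x)" unfolding m_def by (intro x0) auto
    also have "\<dots> = ?f x / (norm x)\<^sup>2"
      by (simp add: matrix_vector_mult_scaleR power2_eq_square divide_inverse mult_ac)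
    finally show ?thesis using False by (simp add: field_simps)
  qed auto
  show ?thesis
  proof (intro exI conjI allI impI)
    show "m / K > 0" using m K by simp
    fix Q' :: "real^'n^'n"
    assume s: "transpose Q' = Q'" and n: "norm (Q' - Q) < m / K"
    show "pos_def Q'" unfolding pos_def_def
    proof (intro conjI s allI impI)
      fix x :: "real^'n" assume x: "x \<noteq> 0"
      have "\<bar>x \<bullet> ((Q' - Q) *v x)\<bar> \<le> norm x * (norm (Q' - Q) * norm x * K)"
        by (rule order_trans[OF Cauchy_Schwarz_ineq2 mult_left_mono[OF K(2)]]) auto
      also have "\<dots> = (norm (Q' - Q) * K) * (norm x)\<^sup>2" by (simp add: power2_eq_square)
      also have "\<dots> < m * (norm x)\<^sup>2"
        using n K x by (intro mult_strict_right_mono) (auto simp: field_simps)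
      finally show "x \<bullet> (Q' *v x) > 0"
        using ge[of x] by (simp add: matrix_vector_mult_diff_rdistrib inner_diff_right)
    qed
  qed
qed

lemma tangent_add: "v \<in> tangent_dirs \<Longrightarrow> w \<in> tangent_dirs \<Longrightarrow> v + w \<in> tangent_dirs"
  by (cases v; cases w) (simp add: tangent_dirs_def transpose_add)

lemma tangent_scaleR: "v \<in> tangent_dirs \<Longrightarrow> c *\<^sub>R v \<in> tangent_dirs"
  by (cases v) (simp add: tangent_dirs_def transpose_scalar)

lemma siegel_jacobi_tangent: "p \<in> siegel_jacobi \<Longrightarrow> p \<in> tangent_dirs"
  by (cases p) (simp add: siegel_jacobi_def siegel_def tangent_dirs_def)

lemma siegel_jacobi_relatively_open:
  fixes p :: "('n::finite, 'm::finite) point"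
  assumes p: "p \<in> siegel_jacobi"
  shows "\<exists>e>0. \<forall>q\<in>tangent_dirs. dist q p < e \<longrightarrow> q \<in> siegel_jacobi"
proof -
  have "pos_def (Im_mat (fst p))" using p by (auto simp: siegel_jacobi_def siegel_def)
  then obtain e where e: "e > 0" "\<And>Q'. transpose Q' = Q' \<Longrightarrow> norm (Q' - Im_mat (fst p)) < e \<Longrightarrow>
      pos_def Q'"
    using pos_def_open by blast
  show ?thesis
  proof (intro exI[of _ e] conjI ballI impI e)
    fix q :: "('n, 'm) point" assume q: "q \<in> tangent_dirs" "dist q p < e"
    have tq: "transpose (fst q) = fst q" using q by (auto simp: tangent_dirs_def)
    have "transpose (Im_mat (fst q)) = Im_mat (transpose (fst q))"
      by (simp add: vec_eq_iff Im_mat_def)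
    moreover have "norm (Im_mat (fst q) - Im_mat (fst p)) \<le> norm (fst q - fst p)"
      by (intro norm_le_componentwise_cart) (simp add: Im_mat_def abs_Im_le_cmod flip:
          minus_complex.sel)
    then have "norm (Im_mat (fst q) - Im_mat (fst p)) < e"
      using q dist_fst_le[of q p] by (simp add: dist_norm)
    ultimately show "q \<in> siegel_jacobi"
      using e(2) tq by (cases q) (auto simp: siegel_jacobi_def siegel_def)
  qed
qed

lemma siegel_jacobi_line:
  assumes p: "p \<in> siegel_jacobi" and v: "v \<in> tangent_dirs"
  shows "\<exists>e>0. \<forall>t. \<bar>t\<bar> < e \<longrightarrow> p + t *\<^sub>R v \<in> siegel_jacobi"
proof -
  obtain e where e: "e > 0" "\<And>q. q \<in> tangent_dirs \<Longrightarrow> dist q p < e \<Longrightarrow> q \<in> siegel_jacobi"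
    using siegel_jacobi_relatively_open[OF p] by blast
  show ?thesis
  proof (intro exI conjI allI impI)
    show "e / (norm v + 1) > 0" using e by (simp add: add_nonneg_pos)
    fix t :: real assume t: "\<bar>t\<bar> < e / (norm v + 1)"
    have "\<bar>t\<bar> * norm v \<le> \<bar>t\<bar> * (norm v + 1)" by (intro mult_left_mono) auto
    also have "\<dots> < e" using t by (simp add: pos_less_divide_eq add_nonneg_pos)
    finally show "p + t *\<^sub>R v \<in> siegel_jacobi"
      using tangent_add[OF siegel_jacobi_tangent[OF p] tangent_scaleR[OF v]]
      by (intro e(2)) (simp_all add: dist_norm)
  qed
qed

lemma siegel_jacobi_line_eventually:
  assumes p: "p \<in> siegel_jacobi" and v: "v \<in> tangent_dirs"
  shows "eventually (\<lambda>t. p + t *\<^sub>R v \<in> siegel_jacobi) (nhds (0::real))"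
  using siegel_jacobi_line[OF assms] by (auto simp: eventually_nhds_metric)

section \<open>Derivatives on the Siegel--Jacobi space\<close>

text \<open>
  A Frechet derivative along the Siegel--Jacobi space computes every directional derivative in a
  tangent direction, because the line through a point stays in the space for a short time.
\<close>

lemma has_dir_deriv:
  assumes F: "(F has_derivative F') (at p within siegel_jacobi)"
    and p: "p \<in> siegel_jacobi" and v: "v \<in> tangent_dirs"
  shows "((\<lambda>t. F (p + t *\<^sub>R v)) has_vector_derivative F' v) (at 0)"
proof -
  obtain e where e: "e > 0" "\<And>t. \<bar>t\<bar> < e \<Longrightarrow> p + t *\<^sub>R v \<in> siegel_jacobi"
    using siegel_jacobi_line[OF p v] by blast
  have sub: "(\<lambda>t. p + t *\<^sub>R v) ` ball 0 e \<subseteq> siegel_jacobi" using e by auto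
  have "((\<lambda>t. p + t *\<^sub>R v) has_derivative (\<lambda>t. t *\<^sub>R v)) (at (0::real) within ball 0 e)"
    by (auto intro!: derivative_eq_intros)
  moreover have "(F has_derivative F') (at (p + 0 *\<^sub>R v) within (\<lambda>t. p + t *\<^sub>R v) ` ball 0 e)"
    using has_derivative_subset[OF F sub] by simp
  ultimately have "(F \<circ> (\<lambda>t. p + t *\<^sub>R v) has_derivative F' \<circ> (\<lambda>t. t *\<^sub>R v)) (at 0 within ball 0 e)"
    by (rule diff_chain_within)
  then have "((\<lambda>t. F (p + t *\<^sub>R v)) has_derivative (\<lambda>t. F' (t *\<^sub>R v))) (at 0)"
    using e by (simp add: at_within_open[of 0 "ball 0 e"] o_def)
  then show ?thesis
    by (simp add: has_vector_derivative_def
        linear_scale[OF bounded_linear.linear[OF has_derivative_bounded_linear[OF F]]])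
qed

lemma dir_deriv_eq:
  assumes "(F has_derivative F') (at p within siegel_jacobi)" "p \<in> siegel_jacobi" "v \<in> tangent_dirs"
  shows "dir_deriv v F p = F' v"
  unfolding dir_deriv_def by (rule vector_derivative_at[OF has_dir_deriv[OF assms]])

lemma dir_deriv_cong:
  assumes "\<And>q. q \<in> siegel_jacobi \<Longrightarrow> F q = G q" "p \<in> siegel_jacobi" "v \<in> tangent_dirs"
  shows "dir_deriv v F p = dir_deriv v G p"
  unfolding dir_deriv_def
proof (rule vector_derivative_cong_eq)
  show "eventually (\<lambda>t. t \<in> UNIV \<longrightarrow> F (p + t *\<^sub>R v) = G (p + t *\<^sub>R v)) (nhds 0)"
    using siegel_jacobi_line_eventually[OF assms(2,3)] by eventually_elim (simp add: assms(1))
qed auto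

text \<open>
  A function with continuous partial derivatives is differentiable. The induction over sets \<open>B\<close>
  of basis vectors moves from \<open>q\<close> in the directions of \<open>B\<close> only, where \<open>q\<close> is any point near
  \<open>p\<close>; each further direction costs one application of the mean value inequality.
\<close>

lemma has_derivative_continuous_partials:
  fixes G :: "'a::euclidean_space \<Rightarrow> 'b::real_normed_vector"
  assumes U: "open U" "p \<in> U"
    and der: "\<And>q b. q \<in> U \<Longrightarrow> b \<in> Basis \<Longrightarrow> ((\<lambda>t. G (q + t *\<^sub>R b)) has_vector_derivative G' b q) (at 0)"
    and cont: "\<And>b. b \<in> Basis \<Longrightarrow> continuous_on U (G' b)"
  shows "(G has_derivative (\<lambda>h. \<Sum>b\<in>Basis. (h \<bullet> b) *\<^sub>R G' b p)) (at p)"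
proof -
  have main: "\<forall>e>0. \<exists>d>0. \<forall>q h. norm (q - p) < d \<longrightarrow> norm h < d \<longrightarrow>
      norm (G (q + (\<Sum>b\<in>B. (h \<bullet> b) *\<^sub>R b)) - G q - (\<Sum>b\<in>B. (h \<bullet> b) *\<^sub>R G' b p)) \<le> e * norm h"
    if "finite B" "B \<subseteq> Basis" for B
    using that
  proof (induction B rule: finite_induct)
    case (insert c B)
    show ?case
    proof (intro allI impI)
      fix e :: real assume e: "e > 0"
      obtain d1 where d1: "d1 > 0" "\<And>q h. norm (q - p) < d1 \<Longrightarrow> norm h < d1 \<Longrightarrow>
        norm (G (q + (\<Sum>b\<in>B. (h \<bullet> b) *\<^sub>R b)) - G q - (\<Sum>b\<in>B. (h \<bullet> b) *\<^sub>R G' b p)) \<le> (e/2) * norm h"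
        using insert.IH[rule_format, OF _ half_gt_zero[OF e]] insert.prems by auto
      have c: "c \<in> Basis" using insert by auto
      have "continuous (at p) (G' c)" using cont[OF c] U by (simp add:
          continuous_on_eq_continuous_at)
      then obtain d2 where d2: "d2 > 0" "\<And>q. norm (q - p) < d2 \<Longrightarrow> norm (G' c q - G' c p) < e/2"
        unfolding continuous_at_eps_delta dist_norm using half_gt_zero[OF e] by blast
      obtain d3 where d3: "d3 > 0" "ball p d3 \<subseteq> U" using U openE by blast
      \<comment> \<open>All points met below are within \<open>d * k\<close> of \<open>p\<close>: one \<open>d\<close> each for \<open>q\<close> and \<open>c\<close>,
          and \<open>card B\<close> for \<open>B\<close>.\<close>
      define k where "k = real (card B) + 2"
      have k: "k \<ge> 2" by (simp add: k_def)
      define d where "d = min d1 (min (d2 / k) (d3 / k))"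
      have d: "d > 0" "d \<le> d1" "d * k \<le> d2" "d * k \<le> d3"
        using d1 d2 d3 k by (auto simp: d_def min_def field_simps)
      show "\<exists>d>0. \<forall>q h. norm (q - p) < d \<longrightarrow> norm h < d \<longrightarrow>
          norm (G (q + (\<Sum>b\<in>insert c B. (h \<bullet> b) *\<^sub>R b)) - G q
            - (\<Sum>b\<in>insert c B. (h \<bullet> b) *\<^sub>R G' b p)) \<le> e * norm h"
      proof (intro exI[of _ d] conjI allI impI d)
        fix q h :: 'a assume qh: "norm (q - p) < d" "norm h < d"
        define r where "r = q + (\<Sum>b\<in>B. (h \<bullet> b) *\<^sub>R b)"
        have near: "norm (r + t *\<^sub>R c - p) < d * k" if t: "t \<in> closed_segment 0 (h \<bullet> c)" for t
        proof -
          have "norm (\<Sum>b\<in>B. (h \<bullet> b) *\<^sub>R b) \<le> real (card B) * norm h"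
            using insert.prems by (intro sum_norm_bound) (auto simp: Basis_le_norm)
          moreover have "\<bar>t\<bar> \<le> \<bar>h \<bullet> c\<bar>"
            using t by (auto simp: closed_segment_eq_real_ivl split: if_splits)
          then have "norm (t *\<^sub>R c) \<le> norm h"
            using Basis_le_norm[OF c, of h] c by simp
          moreover have "norm (r + t *\<^sub>R c - p) \<le> norm (q - p) + norm (\<Sum>b\<in>B. (h \<bullet> b) *\<^sub>R b)
              + norm (t *\<^sub>R c)"
            by (metis (no_types, lifting) add.commute add_diff_eq norm_triangle_mono
                norm_triangle_ineq order_refl r_def)
          ultimately have "norm (r + t *\<^sub>R c - p) < d + real (card B) * norm h + norm h"
            using qh by linarith
          also have "\<dots> \<le> d + real (card B) * d + d"
            using qh by (intro add_mono mult_left_mono) auto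
          finally show ?thesis by (simp add: k_def algebra_simps)
        qed
        have "((\<lambda>t. G (r + t *\<^sub>R c)) has_vector_derivative G' c (r + t *\<^sub>R c))
              (at t within closed_segment 0 (h \<bullet> c))" if t: "t \<in> closed_segment 0 (h \<bullet> c)" for t
        proof -
          have "r + t *\<^sub>R c \<in> U"
            using near[OF t] d d3 by (auto simp: dist_norm norm_minus_commute subset_iff)
          from der[OF this c]
          have "((\<lambda>s. G (r + t *\<^sub>R c + s *\<^sub>R c)) has_vector_derivative G' c (r
              + t *\<^sub>R c)) (at ((\<lambda>s. s - t) t))"
            by simp
          moreover have "((\<lambda>s. s - t) has_vector_derivative 1) (at t)"
            by (auto intro!: derivative_eq_intros)
          ultimately have "((\<lambda>s. G (r + t *\<^sub>R c + s *\<^sub>R c)) \<circ> (\<lambda>s. s - t) has_vector_derivative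
              1 *\<^sub>R G' c (r + t *\<^sub>R c)) (at t)"
            by (intro vector_diff_chain_at)
          then show ?thesis
            by - (rule has_vector_derivative_at_within, simp add: o_def scaleR_left_diff_distrib)
        qed
        then have dd: "((\<lambda>t. G (r + t *\<^sub>R c) - t *\<^sub>R G' c p) has_derivative
              (\<lambda>s. s *\<^sub>R (G' c (r + t *\<^sub>R c) - G' c p)))
              (at t within closed_segment 0 (h \<bullet> c))" if t: "t \<in> closed_segment 0 (h \<bullet> c)" for t
          using t by (auto intro!: derivative_eq_intros simp: has_vector_derivative_def
              algebra_simps)
        have "norm ((G (r + (h \<bullet> c) *\<^sub>R c) - (h \<bullet> c) *\<^sub>R G' c p) - (G (r + 0 *\<^sub>R c) - 0 *\<^sub>R G' c p))
            \<le> e/2 * norm (h \<bullet> c - 0)"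
        proof (rule differentiable_bound[OF convex_closed_segment dd])
          fix t assume t: "t \<in> closed_segment 0 (h \<bullet> c)"
          have "norm (G' c (r + t *\<^sub>R c) - G' c p) \<le> e/2"
            using near[OF t] d d2 by (intro less_imp_le d2) auto
          then show "onorm (\<lambda>s. s *\<^sub>R (G' c (r + t *\<^sub>R c) - G' c p)) \<le> e/2"
          proof (intro onorm_bound)
            fix s :: real
            from mult_left_mono[OF \<open>norm (G' c (r + t *\<^sub>R c) - G' c p) \<le> e/2\<close>, of "norm s"]
            show "norm (s *\<^sub>R (G' c (r + t *\<^sub>R c) - G' c p)) \<le> e/2 * norm s"
              by (simp add: mult.commute)
          qed (use e in auto)
        qed auto
        also have "\<dots> \<le> e/2 * norm h"
          using Basis_le_norm[OF c, of h] e by simp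
        finally have 1: "norm (G (r + (h \<bullet> c) *\<^sub>R c) - G r - (h \<bullet> c) *\<^sub>R G' c p) \<le> e/2 * norm h"
          by (simp add: algebra_simps)
        have 2: "norm (G r - G q - (\<Sum>b\<in>B. (h \<bullet> b) *\<^sub>R G' b p)) \<le> e/2 * norm h"
          unfolding r_def using qh d by (intro d1) auto
        have "G (q + (\<Sum>b\<in>insert c B. (h \<bullet> b) *\<^sub>R b)) - G q - (\<Sum>b\<in>insert c B. (h \<bullet> b) *\<^sub>R G' b p)
           = (G (r + (h \<bullet> c) *\<^sub>R c) - G r - (h \<bullet> c) *\<^sub>R G' c p)
             + (G r - G q - (\<Sum>b\<in>B. (h \<bullet> b) *\<^sub>R G' b p))"
          using insert.hyps by (simp add: r_def algebra_simps)
        also have "norm \<dots> \<le> e/2 * norm h + e/2 * norm h"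
          by (rule norm_triangle_mono[OF 1 2])
        finally show "norm (G (q + (\<Sum>b\<in>insert c B. (h \<bullet> b) *\<^sub>R b)) - G q
            - (\<Sum>b\<in>insert c B. (h \<bullet> b) *\<^sub>R G' b p)) \<le> e * norm h"
          by simp
      qed
    qed
  qed (simp add: exI[of _ 1])
  show ?thesis unfolding has_derivative_at_alt
  proof (intro conjI allI impI)
    show "bounded_linear (\<lambda>h. \<Sum>b\<in>Basis. (h \<bullet> b) *\<^sub>R G' b p)"
      by (intro bounded_linear_sum bounded_linear_scaleR_const bounded_linear_inner_left)
    fix e :: real assume "e > 0"
    then obtain d where "d > 0" "\<And>q h. norm (q - p) < d \<Longrightarrow> norm h < d \<Longrightarrow>
      norm (G (q + (\<Sum>b\<in>Basis. (h \<bullet> b) *\<^sub>R b)) - G q - (\<Sum>b\<in>Basis. (h \<bullet> b) *\<^sub>R G' b p)) \<le> e * norm h"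
      using main[OF finite_Basis order_refl] by blast
    note d = this
    show "\<exists>d>0. \<forall>y. norm (y - p) < d \<longrightarrow> norm (G y - G p - (\<Sum>b\<in>Basis. ((y
        - p) \<bullet> b) *\<^sub>R G' b p)) \<le> e * norm (y - p)"
    proof (intro exI[of _ d] conjI allI impI d)
      fix y assume "norm (y - p) < d"
      with d(2)[of p "y - p"] d(1)
      show "norm (G y - G p - (\<Sum>b\<in>Basis. ((y - p) \<bullet> b) *\<^sub>R G' b p)) \<le> e * norm (y - p)"
        by (simp add: euclidean_representation)
    qed
  qed
qed

text \<open>
  The linear projection onto the tangent directions. It extends a function on the Siegel--Jacobi
  space to an open set of the euclidean space of all pairs of matrices.
\<close>

definition symm :: "('n::finite, 'm::finite) point \<Rightarrow> ('n, 'm) point" where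
  "symm p = ((1/2) *\<^sub>R (fst p + transpose (fst p)), snd p)"

lemma symm_tangent [simp]: "symm p \<in> tangent_dirs"
  by (simp add: symm_def tangent_dirs_def vec_eq_iff)

lemma symm_id: "p \<in> tangent_dirs \<Longrightarrow> symm p = p"
  by (cases p) (auto simp: symm_def tangent_dirs_def vec_eq_iff)

lemma linear_symm: "linear symm"
  unfolding linear_iff by (auto simp: symm_def vec_eq_iff prod_eq_iff algebra_simps)

lemma bounded_linear_symm: "bounded_linear symm"
  using linear_symm by (simp add: linear_conv_bounded_linear)

lemma open_symm_vimage: "open (symm -` siegel_jacobi)"
proof (subst open_subopen, intro ballI)
  fix z :: "('n::finite, 'm::finite) point" assume "z \<in> symm -` siegel_jacobi"
  then obtain e where e: "e > 0" "\<And>q. q \<in> tangent_dirs \<Longrightarrow> dist q (symm z) < e \<Longrightarrow> q \<in> siegel_jacobi"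
    using siegel_jacobi_relatively_open[of "symm z"] by auto
  have "open (symm -` ball (symm z) e)"
    by (intro open_vimage open_ball linear_continuous_on bounded_linear_symm)
  moreover have "symm w \<in> siegel_jacobi" if "dist (symm z) (symm w) < e" for w
    using e(2)[of "symm w"] that by (simp add: dist_commute)
  ultimately show "\<exists>T. open T \<and> z \<in> T \<and> T \<subseteq> symm -` siegel_jacobi"
    using e by (intro exI[of _ "symm -` ball (symm z) e"]) (simp add: subset_eq)
qed

lemma C_k_cong:
  assumes "C_k k F" "\<And>q. q \<in> siegel_jacobi \<Longrightarrow> F q = G q"
  shows "C_k k G"
  using assms
proof (induction k arbitrary: F G)
  case 0
  then show ?case using continuous_on_cong by (metis C_k.simps(1))
next
  case (Suc k)
  have "continuous_on siegel_jacobi G"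
    using Suc.prems by (metis C_k.simps(2) continuous_on_cong)
  moreover have "(\<lambda>t::real. G (p + t *\<^sub>R v)) differentiable (at 0)"
    if v: "v \<in> tangent_dirs" and p: "p \<in> siegel_jacobi" for v p
  proof -
    have "(\<lambda>t::real. F (p + t *\<^sub>R v)) differentiable (at 0)"
      using Suc.prems v p by simp
    moreover obtain e where e: "e > 0" "\<And>t. \<bar>t\<bar> < e \<Longrightarrow> p + t *\<^sub>R v \<in> siegel_jacobi"
      using siegel_jacobi_line[OF p v] by blast
    ultimately show ?thesis
      by (elim differentiable_transform_within[where d = e]) (auto simp: Suc.prems(2))
  qed
  moreover have "C_k k (dir_deriv v G)" if v: "v \<in> tangent_dirs" for v
  proof (rule Suc.IH)
    show "C_k k (dir_deriv v F)" using Suc.prems v by simp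
    show "dir_deriv v F q = dir_deriv v G q" if "q \<in> siegel_jacobi" for q
      by (rule dir_deriv_cong) (use Suc.prems that v in auto)
  qed
  ultimately show ?case by simp
qed

lemma C_k_Suc_imp: "C_k (Suc k) F \<Longrightarrow> C_k k F"
  by (induction k arbitrary: F) auto

lemma C_k_imp_continuous_on: "C_k k F \<Longrightarrow> continuous_on siegel_jacobi F"
  by (cases k) auto

text \<open>
  The derivative is written with \<open>symm\<close> so that it is linear on the whole euclidean space; only
  its values in tangent directions, where \<open>symm\<close> is the identity, are meaningful.
\<close>

lemma C1_has_derivative:
  fixes F :: "('n::finite, 'm::finite) point \<Rightarrow> complex"
  assumes F: "C_k (Suc k) F" and p: "p \<in> siegel_jacobi"
  shows "(F has_derivative (\<lambda>h. dir_deriv (symm h) F p)) (at p within siegel_jacobi)"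
proof -
  define U where "U = (symm -` siegel_jacobi :: ('n, 'm) point set)"
  have sp: "symm q = q" if "q \<in> siegel_jacobi" for q :: "('n, 'm) point"
    using that by (intro symm_id siegel_jacobi_tangent)
  define L where "L = (\<lambda>h. \<Sum>b\<in>Basis. (h \<bullet> b) *\<^sub>R dir_deriv (symm b) F (symm p))"
  have "((\<lambda>q. F (symm q)) has_derivative L) (at p)"
    unfolding L_def
  proof (rule has_derivative_continuous_partials[of U])
    show "open U" "p \<in> U" using open_symm_vimage p by (auto simp: U_def sp)
    fix b :: "('n, 'm) point"
    show "((\<lambda>t. F (symm (q + t *\<^sub>R b))) has_vector_derivative dir_deriv (symm b) F (symm q)) (at 0)"
      if "q \<in> U" for q
    proof -
      have "(\<lambda>t::real. F (symm q + t *\<^sub>R symm b)) differentiable (at 0)"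
        using F that by (simp add: U_def)
      then have "((\<lambda>t. F (symm q + t *\<^sub>R symm b)) has_vector_derivative dir_deriv (symm b) F (symm
          q)) (at 0)"
        unfolding dir_deriv_def using vector_derivative_works by blast
      then show ?thesis
        by (simp add: linear_add[OF linear_symm] linear_scale[OF linear_symm])
    qed
    have "continuous_on siegel_jacobi (dir_deriv (symm b) F)"
      using F by (intro C_k_imp_continuous_on[of k]) simp
    then show "continuous_on U (\<lambda>q. dir_deriv (symm b) F (symm q))"
      by (rule continuous_on_compose2)
        (auto simp: U_def intro: linear_continuous_on bounded_linear_symm)
  qed
  then have "((\<lambda>q. F (symm q)) has_derivative L) (at p within siegel_jacobi)"
    by (rule has_derivative_at_withinI)
  then have FL: "(F has_derivative L) (at p within siegel_jacobi)"
    by (rule has_derivative_transform[OF p, rotated]) (simp add: sp)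
  \<comment> \<open>On the Siegel--Jacobi space \<open>F\<close> also equals \<open>F \<circ> symm\<close>, so \<open>L \<circ> symm\<close> is a derivative too.\<close>
  have "((F \<circ> symm) has_derivative (L \<circ> symm)) (at p within siegel_jacobi)"
  proof (rule diff_chain_within)
    show "(symm has_derivative symm) (at p within siegel_jacobi)"
      by (rule bounded_linear_imp_has_derivative[OF bounded_linear_symm])
    have "symm ` siegel_jacobi = (siegel_jacobi :: ('n, 'm) point set)"
      by (auto simp: sp image_iff intro!: bexI[rotated])
    then show "(F has_derivative L) (at (symm p) within symm ` siegel_jacobi)"
      using FL by (simp add: sp p)
  qed
  then have "(F has_derivative (L \<circ> symm)) (at p within siegel_jacobi)"
    by (rule has_derivative_transform[OF p, rotated]) (simp add: sp)
  also have "L \<circ> symm = (\<lambda>h. dir_deriv (symm h) F p)"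
    by (auto simp: dir_deriv_eq[OF FL p])
  finally show ?thesis .
qed

text \<open>
  Together with \<open>C1_has_derivative\<close> this is the tool for all closure properties of the classes
  \<open>C_k\<close>: a derivative is given, and its values in tangent directions are of class \<open>C_k k\<close>.
\<close>

lemma C_k_SucI:
  assumes "\<And>p. p \<in> siegel_jacobi \<Longrightarrow> (F has_derivative F' p) (at p within siegel_jacobi)"
    and "\<And>v. v \<in> tangent_dirs \<Longrightarrow> C_k k (\<lambda>p. F' p v)"
  shows "C_k (Suc k) F"
  unfolding C_k.simps
proof (intro conjI ballI)
  show "continuous_on siegel_jacobi F"
    using assms(1) by (rule has_derivative_continuous_on)
  fix v :: "('a, 'b) point" assume v: "v \<in> tangent_dirs"
  show "(\<lambda>t::real. F (p + t *\<^sub>R v)) differentiable (at 0)" if "p \<in> siegel_jacobi" for p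
    using has_dir_deriv[OF assms(1) that v, OF that] by (rule differentiableI_vector)
  show "C_k k (dir_deriv v F)"
    by (rule C_k_cong[OF assms(2)[OF v]]) (simp add: dir_deriv_eq[OF assms(1) _ v])
qed

lemma C_k_const: "C_k k (\<lambda>_. c)"
proof (induction k arbitrary: c)
  case (Suc k)
  show ?case by (rule C_k_SucI[where F' = "\<lambda>_ _. 0"]) (auto intro: Suc)
qed simp

lemma C_k_bounded_linear:
  assumes f: "bounded_linear f" and F: "C_k k F"
  shows "C_k k (\<lambda>p. f (F p))"
  using F
proof (induction k arbitrary: F)
  case 0
  then show ?case using linear_continuous_on_compose[of siegel_jacobi F f] f
    by (simp add: bounded_linear.linear)
next
  case (Suc k)
  show ?case
  proof (rule C_k_SucI)
    show "((\<lambda>p. f (F p)) has_derivative (\<lambda>h. f (dir_deriv (symm h) F p))) (at p within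
        siegel_jacobi)"
      if "p \<in> siegel_jacobi" for p
      by (rule bounded_linear.has_derivative[OF f C1_has_derivative[OF Suc.prems that]])
    show "C_k k (\<lambda>p. f (dir_deriv (symm v) F p))" for v
      using Suc by simp
  qed
qed

lemma C_k_linear:
  assumes f: "bounded_linear f"
  shows "C_k k f"
proof (cases k)
  case 0
  then show ?thesis using f by (simp add: linear_continuous_on)
next
  case (Suc l)
  then show ?thesis
    by (auto intro!: C_k_SucI[where F' = "\<lambda>_. f"] bounded_linear_imp_has_derivative f C_k_const
        simp del: C_k.simps)
qed

lemma C_k_add: "C_k k F \<Longrightarrow> C_k k G \<Longrightarrow> C_k k (\<lambda>p. F p + G p)"
proof (induction k arbitrary: F G)
  case (Suc k)
  show ?case
  proof (rule C_k_SucI)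
    show "((\<lambda>p. F p + G p) has_derivative (\<lambda>h. dir_deriv (symm h) F p + dir_deriv (symm h) G p))
      (at p within siegel_jacobi)" if "p \<in> siegel_jacobi" for p
      by (intro has_derivative_add C1_has_derivative that) (use Suc.prems in auto)
    show "C_k k (\<lambda>p. dir_deriv (symm v) F p + dir_deriv (symm v) G p)" for v
      using Suc by simp
  qed
qed (simp add: continuous_on_add)

lemma C_k_mult: "C_k k F \<Longrightarrow> C_k k G \<Longrightarrow> C_k k (\<lambda>p. F p * G p)"
proof (induction k arbitrary: F G)
  case (Suc k)
  show ?case
  proof (rule C_k_SucI)
    show "((\<lambda>p. F p * G p) has_derivative (\<lambda>h. F p * dir_deriv (symm h) G p
        + dir_deriv (symm h) F p * G p))
      (at p within siegel_jacobi)" if "p \<in> siegel_jacobi" for p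
      by (intro has_derivative_mult C1_has_derivative that) (use Suc.prems in auto)
    show "C_k k (\<lambda>p. F p * dir_deriv (symm v) G p + dir_deriv (symm v) F p * G p)" for v
      using Suc.prems C_k_Suc_imp[OF Suc.prems(1)] C_k_Suc_imp[OF Suc.prems(2)]
      by (intro C_k_add Suc.IH) auto
  qed
qed (simp add: continuous_on_mult)

lemma C_k_sum: "(\<And>i. i \<in> I \<Longrightarrow> C_k k (F i)) \<Longrightarrow> C_k k (\<lambda>p. \<Sum>i\<in>I. F i p)"
  by (induction I rule: infinite_finite_induct) (auto intro: C_k_const C_k_add)

section \<open>Smooth functions\<close>

lemma smooth_cong: "smooth F \<Longrightarrow> (\<And>q. q \<in> siegel_jacobi \<Longrightarrow> F q = G q) \<Longrightarrow> smooth G"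
  unfolding smooth_def using C_k_cong by blast

lemma smooth_const [intro]: "smooth (\<lambda>_. c)"
  by (simp add: smooth_def C_k_const)

lemma smooth_bounded_linear: "bounded_linear f \<Longrightarrow> smooth F \<Longrightarrow> smooth (\<lambda>p. f (F p))"
  by (simp add: smooth_def C_k_bounded_linear)

lemma smooth_cnj [intro]: "smooth F \<Longrightarrow> smooth (\<lambda>p. cnj (F p))"
  by (rule smooth_bounded_linear[OF bounded_linear_cnj])

lemma smooth_linear: "bounded_linear f \<Longrightarrow> smooth f"
  by (simp add: smooth_def C_k_linear)

lemma smooth_add [intro]: "smooth F \<Longrightarrow> smooth G \<Longrightarrow> smooth (\<lambda>p. F p + G p)"
  by (simp add: smooth_def C_k_add)

lemma smooth_mult [intro]: "smooth F \<Longrightarrow> smooth G \<Longrightarrow> smooth (\<lambda>p. F p * G p)"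
  by (simp add: smooth_def C_k_mult)

lemma smooth_sum [intro]: "(\<And>i. i \<in> I \<Longrightarrow> smooth (F i)) \<Longrightarrow> smooth (\<lambda>p. \<Sum>i\<in>I. F i p)"
  by (simp add: smooth_def C_k_sum)

lemma smooth_minus [intro]: "smooth F \<Longrightarrow> smooth (\<lambda>p. - F p)"
  using smooth_mult[OF smooth_const[of "-1"], of F] by simp

lemma smooth_diff [intro]: "smooth F \<Longrightarrow> smooth G \<Longrightarrow> smooth (\<lambda>p. F p - G p)"
  using smooth_add[of F "\<lambda>p. - G p"] by auto

lemma smooth_dir_deriv: "smooth F \<Longrightarrow> v \<in> tangent_dirs \<Longrightarrow> smooth (dir_deriv v F)"
  unfolding smooth_def using C_k.simps(2) by blast

lemma smooth_has_derivative:
  assumes "smooth F" "p \<in> siegel_jacobi"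
  shows "(F has_derivative (\<lambda>h. dir_deriv (symm h) F p)) (at p within siegel_jacobi)"
  using assms C1_has_derivative[of 0] unfolding smooth_def by blast

lemma dir_deriv_linear:
  assumes "smooth F" "p \<in> siegel_jacobi"
  shows "linear (\<lambda>h. dir_deriv (symm h) F p)"
  using has_derivative_bounded_linear[OF smooth_has_derivative[OF assms]] bounded_linear.linear
      by blast

lemma dir_deriv_direction_add:
  assumes "smooth F" "p \<in> siegel_jacobi" "v \<in> tangent_dirs" "w \<in> tangent_dirs"
  shows "dir_deriv (v + w) F p = dir_deriv v F p + dir_deriv w F p"
  using linear_add[OF dir_deriv_linear[OF assms(1,2)], of v w] assms
  by (simp add: symm_id tangent_add)

lemma dir_deriv_direction_scaleR:
  assumes "smooth F" "p \<in> siegel_jacobi" "v \<in> tangent_dirs"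
  shows "dir_deriv (c *\<^sub>R v) F p = c *\<^sub>R dir_deriv v F p"
  using linear_scale[OF dir_deriv_linear[OF assms(1,2)], of c v] assms
  by (simp add: symm_id tangent_scaleR)

lemma dir_deriv_add:
  assumes "smooth F" "smooth G" "p \<in> siegel_jacobi" "v \<in> tangent_dirs"
  shows "dir_deriv v (\<lambda>q. F q + G q) p = dir_deriv v F p + dir_deriv v G p"
  using dir_deriv_eq[OF has_derivative_add[OF smooth_has_derivative smooth_has_derivative], of F p
      G v] assms
  by (simp add: symm_id)

lemma dir_deriv_mult:
  assumes "smooth F" "smooth G" "p \<in> siegel_jacobi" "v \<in> tangent_dirs"
  shows "dir_deriv v (\<lambda>q. F q * G q) p = F p * dir_deriv v G p + dir_deriv v F p * G p"
  using dir_deriv_eq[OF has_derivative_mult[OF smooth_has_derivative smooth_has_derivative], of F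
      p G v] assms
  by (simp add: symm_id)

lemma dir_deriv_bounded_linear:
  assumes "bounded_linear f" "smooth F" "p \<in> siegel_jacobi" "v \<in> tangent_dirs"
  shows "dir_deriv v (\<lambda>q. f (F q)) p = f (dir_deriv v F p)"
  using dir_deriv_eq[OF bounded_linear.has_derivative[OF assms(1) smooth_has_derivative], of F p
      v] assms
  by (simp add: symm_id)

lemma dir_deriv_of_linear:
  assumes "bounded_linear f" "p \<in> siegel_jacobi" "v \<in> tangent_dirs"
  shows "dir_deriv v f p = f v"
  using dir_deriv_eq[OF bounded_linear_imp_has_derivative[OF assms(1)], of p v] assms by simp

lemma dir_deriv_const: "p \<in> siegel_jacobi \<Longrightarrow> v \<in> tangent_dirs \<Longrightarrow> dir_deriv v (\<lambda>_. c) p = 0"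
  using dir_deriv_eq[OF has_derivative_const] by blast

section \<open>Smooth matrix-valued functions\<close>

text \<open>
  Matrices of smooth functions.
\<close>

definition smooth_mat :: "(('n::finite, 'm::finite) point \<Rightarrow> complex^'b^'a) \<Rightarrow> bool" where
  "smooth_mat M \<longleftrightarrow> (\<forall>i j. smooth (\<lambda>p. M p $ i $ j))"

named_theorems smooth_mat_intros

lemma smooth_mat_const [smooth_mat_intros]: "smooth_mat (\<lambda>_. A)"
  by (simp add: smooth_mat_def smooth_const)

lemma smooth_mat_mult [smooth_mat_intros]:
  "smooth_mat M \<Longrightarrow> smooth_mat N \<Longrightarrow> smooth_mat (\<lambda>p. M p ** N p)"
  unfolding smooth_mat_def matrix_mul_componentwise by (intro allI smooth_sum smooth_mult) auto

lemma smooth_mat_add [smooth_mat_intros]: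
  "smooth_mat M \<Longrightarrow> smooth_mat N \<Longrightarrow> smooth_mat (\<lambda>p. M p + N p)"
  by (auto simp: smooth_mat_def)

lemma smooth_mat_diff [smooth_mat_intros]:
  "smooth_mat M \<Longrightarrow> smooth_mat N \<Longrightarrow> smooth_mat (\<lambda>p. M p - N p)"
  by (auto simp: smooth_mat_def)

lemma smooth_mat_transpose [smooth_mat_intros]:
  "smooth_mat M \<Longrightarrow> smooth_mat (\<lambda>p. transpose (M p))"
  by (auto simp: smooth_mat_def)

lemma smooth_mat_mscale [smooth_mat_intros]:
  "smooth f \<Longrightarrow> smooth_mat M \<Longrightarrow> smooth_mat (\<lambda>p. f p *\<^sub>m M p)"
  by (auto simp: smooth_mat_def)

lemma smooth_mat_conj [smooth_mat_intros]:
  "smooth_mat M \<Longrightarrow> smooth_mat (\<lambda>p. conj_mat (M p))"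
  by (auto simp: smooth_mat_def)

lemma smooth_mat_mat [smooth_mat_intros]: "smooth f \<Longrightarrow> smooth_mat (\<lambda>p. mat (f p))"
  unfolding smooth_mat_def
proof (intro allI)
  show "smooth (\<lambda>p. mat (f p) $ i $ j)" if "smooth f" for i j
    using that by (cases "i = j") (auto simp: mat_def)
qed

lemma smooth_mat_nth: "smooth_mat M \<Longrightarrow> smooth (\<lambda>p. M p $ i $ j)"
  by (simp add: smooth_mat_def)

lemma smooth_trace: "smooth_mat M \<Longrightarrow> smooth (\<lambda>p. trace (M p))"
  by (auto simp: smooth_mat_def trace_def)

lemma has_derivative_matrix:
  fixes M :: "'c::real_normed_vector \<Rightarrow> complex^'b^'a"
  assumes "\<And>i j. ((\<lambda>p. M p $ i $ j) has_derivative (\<lambda>h. M' h $ i $ j)) (at p within S)"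
  shows "(M has_derivative M') (at p within S)"
proof (subst has_derivative_componentwise_within, intro ballI)
  fix b :: "complex^'b^'a" assume "b \<in> Basis"
  then obtain i j u where b: "b = axis i (axis j u)" by (auto simp: Basis_vec_def)
  show "((\<lambda>x. M x \<bullet> b) has_derivative (\<lambda>x. M' x \<bullet> b)) (at p within S)"
    unfolding b inner_axis by (intro has_derivative_inner_left assms)
qed

lemma smooth_mat_has_derivative:
  assumes "smooth_mat M" "p \<in> siegel_jacobi"
  shows "(M has_derivative (\<lambda>h. \<chi> i j. dir_deriv (symm h) (\<lambda>q. M q $ i $ j) p)) (at p within
      siegel_jacobi)"
  by (rule has_derivative_matrix) (use assms in \<open>auto simp: smooth_mat_def intro:
      smooth_has_derivative\<close>)

text \<open>
  All entries of the inverse matrix are treated at once: the derivative \<open>- R M' R\<close> of \<open>R = M\<inverse>\<close>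
  is polynomial in the entries of \<open>R\<close> and \<open>M'\<close>, so the class \<open>C_k k\<close> of \<open>R\<close> gives the class \<open>C_k
  (Suc k)\<close>.
\<close>

lemma smooth_mat_inv:
  fixes M :: "('n::finite, 'm::finite) point \<Rightarrow> complex^'a^'a"
  assumes M: "smooth_mat M" and inv: "\<And>p. p \<in> siegel_jacobi \<Longrightarrow> invertible (M p)"
  shows "smooth_mat (\<lambda>p. matrix_inv (M p))"
proof -
  define R where "R = (\<lambda>p. matrix_inv (M p))"
  define M' where "M' = (\<lambda>p h. \<chi> i j. dir_deriv (symm h) (\<lambda>q. M q $ i $ j) p)"
  have der: "(R has_derivative (\<lambda>h. - (R p ** M' p h ** R p))) (at p within siegel_jacobi)"
    if p: "p \<in> siegel_jacobi" for p
  proof -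
    have "(matrix_inv \<circ> M has_derivative (\<lambda>H. - (matrix_inv (M p) ** H ** matrix_inv (M p))) \<circ> M' p)
        (at p within siegel_jacobi)"
    proof (rule diff_chain_within)
      show "(M has_derivative M' p) (at p within siegel_jacobi)"
        unfolding M'_def by (rule smooth_mat_has_derivative[OF M p])
      show "(matrix_inv has_derivative (\<lambda>H. - (matrix_inv (M p) ** H ** matrix_inv (M p))))
          (at (M p) within M ` siegel_jacobi)"
        by (rule has_derivative_subset[OF has_derivative_matrix_inv[OF inv[OF p]]]) (auto intro:
            inv)
    qed
    then show ?thesis by (simp add: R_def o_def)
  qed
  have der': "((\<lambda>p. R p $ i $ j) has_derivative (\<lambda>h. (- (R p ** M' p h
      ** R p)) $ i $ j)) (at p within siegel_jacobi)"
    if p: "p \<in> siegel_jacobi" for p i j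
    by (intro bounded_linear.has_derivative[OF bounded_linear_vec_nth] der p)
  have "C_k k (\<lambda>p. R p $ i $ j)" for k i j
  proof (induction k arbitrary: i j)
    case 0
    show ?case using has_derivative_continuous_on[OF der'] by simp
  next
    case (Suc k)
    show ?case
    proof (rule C_k_SucI[OF der'])
      fix v :: "('n, 'm) point" assume v: "v \<in> tangent_dirs"
      have M'k: "C_k k (\<lambda>p. M' p v $ a $ b)" for a b
        using smooth_dir_deriv[OF smooth_mat_nth[OF M] symm_tangent]
            by (simp add: M'_def smooth_def)
      have "C_k k (\<lambda>p. -1 * (R p ** M' p v ** R p) $ i $ j)"
        unfolding matrix_mul_componentwise by (intro C_k_mult C_k_sum C_k_const Suc M'k)
      then show "C_k k (\<lambda>p. (- (R p ** M' p v ** R p)) $ i $ j)" by simp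
    qed
  qed
  then show ?thesis by (simp add: smooth_mat_def smooth_def R_def)
qed

lemma smooth_mat_fst [smooth_mat_intros]: "smooth_mat fst"
  unfolding smooth_mat_def
  by (intro allI, rule smooth_linear, rule bounded_linear_compose[OF bounded_linear_vec_nth
      bounded_linear_compose[OF bounded_linear_vec_nth bounded_linear_fst]])

lemma smooth_mat_snd [smooth_mat_intros]: "smooth_mat snd"
  unfolding smooth_mat_def
  by (intro allI, rule smooth_linear, rule bounded_linear_compose[OF bounded_linear_vec_nth
      bounded_linear_compose[OF bounded_linear_vec_nth bounded_linear_snd]])

lemma smooth_mat_Im: "smooth_mat M \<Longrightarrow> smooth_mat (\<lambda>p. cmat (Im_mat (M p)))"
  unfolding smooth_mat_def Im_mat_def nth_map_matrix
  using smooth_bounded_linear[OF bounded_linear_compose[OF bounded_linear_of_real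
      bounded_linear_Im]]
  by blast

lemma smooth_mat_Ymat [smooth_mat_intros]: "smooth_mat Ymat"
  unfolding Ymat_def by (intro smooth_mat_Im smooth_mat_intros)

lemma smooth_mat_Vtr [smooth_mat_intros]: "smooth_mat Vtr"
  unfolding Vtr_def by (intro smooth_mat_Im smooth_mat_intros)

lemma smooth_mat_ZmZbar [smooth_mat_intros]: "smooth_mat ZmZbar"
  unfolding ZmZbar_def by (intro smooth_mat_intros)

lemma invertible_Ymat: "p \<in> siegel_jacobi \<Longrightarrow> invertible (Ymat p)"
  unfolding Ymat_def by (rule invertible_cmat_pos_def) (auto simp: siegel_jacobi_def siegel_def)

lemma ZmZbar_eq: "ZmZbar p = (2 * \<i>) *\<^sub>m Ymat p"
  by (simp add: vec_eq_iff ZmZbar_def Ymat_def Im_mat_def complex_eq_iff)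

lemma invertible_ZmZbar: "p \<in> siegel_jacobi \<Longrightarrow> invertible (ZmZbar p)"
  by (simp add: ZmZbar_eq invertible_mscale invertible_Ymat)

lemma smooth_mat_Yinv [smooth_mat_intros]: "smooth_mat Yinv"
  unfolding Yinv_def by (intro smooth_mat_inv smooth_mat_intros invertible_Ymat)

lemma smooth_mat_ZmZbar_inv [smooth_mat_intros]: "smooth_mat ZmZbar_inv"
  unfolding ZmZbar_inv_def by (intro smooth_mat_inv smooth_mat_intros invertible_ZmZbar)

section \<open>The algebra of differential operators\<close>

lemma smooth_foldr_dir_deriv:
  "smooth F \<Longrightarrow> vs \<in> lists tangent_dirs \<Longrightarrow> smooth (foldr dir_deriv vs F)"
  by (induction vs) (auto intro: smooth_dir_deriv)

lemma diff_operator_cong: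
  assumes "diff_operator P" "\<And>F p. smooth F \<Longrightarrow> p \<in> siegel_jacobi \<Longrightarrow> P F p = Q F p"
  shows "diff_operator Q"
  using assms unfolding diff_operator_def by (elim exE conjE) (intro exI conjI, auto)

lemma diff_operator_term:
  assumes "smooth a" "vs \<in> lists tangent_dirs"
  shows "diff_operator (\<lambda>F p. a p * foldr dir_deriv vs F p)"
  unfolding diff_operator_def using assms
  by (intro exI[of _ "{vs}"] exI[of _ "\<lambda>_. a"]) auto

lemma diff_operator_zero: "diff_operator (\<lambda>F p. 0)"
  unfolding diff_operator_def by (intro exI[of _ "{}"]) auto

lemma diff_operator_add:
  assumes "diff_operator P" "diff_operator Q"
  shows "diff_operator (\<lambda>F p. P F p + Q F p)"
proof -
  obtain S a where S: "finite S" "S \<subseteq> lists tangent_dirs" "\<forall>vs\<in>S. smooth (a vs)"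
    and P: "\<forall>F. smooth F \<longrightarrow> (\<forall>p\<in>siegel_jacobi. P F p = (\<Sum>vs\<in>S. a vs p * foldr dir_deriv vs F p))"
    using assms(1) unfolding diff_operator_def by blast
  obtain T b where T: "finite T" "T \<subseteq> lists tangent_dirs" "\<forall>vs\<in>T. smooth (b vs)"
    and Q: "\<forall>F. smooth F \<longrightarrow> (\<forall>p\<in>siegel_jacobi. Q F p = (\<Sum>vs\<in>T. b vs p * foldr dir_deriv vs F p))"
    using assms(2) unfolding diff_operator_def by blast
  let ?c = "\<lambda>vs p. (if vs \<in> S then a vs p else 0) + (if vs \<in> T then b vs p else 0)"
  show ?thesis unfolding diff_operator_def
  proof (intro exI[of _ "S \<union> T"] exI[of _ ?c] conjI allI impI ballI)
    fix vs assume "vs \<in> S \<union> T"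
    show "smooth (?c vs)" using S T by (cases "vs \<in> S"; cases "vs \<in> T") auto
  next
    fix F :: "('a, 'b) point \<Rightarrow> complex" and p :: "('a, 'b) point" assume F: "smooth F" "p \<in>
        siegel_jacobi"
    have 1: "(\<Sum>vs\<in>S \<union> T. (if vs \<in> S then a vs p else 0) * foldr dir_deriv vs F p) = P F p"
      unfolding P[rule_format, OF F] using S T by (intro sum.mono_neutral_cong_right) auto
    have 2: "(\<Sum>vs\<in>S \<union> T. (if vs \<in> T then b vs p else 0) * foldr dir_deriv vs F p) = Q F p"
      unfolding Q[rule_format, OF F] using S T by (intro sum.mono_neutral_cong_right) auto
    show "P F p + Q F p = (\<Sum>vs\<in>S \<union> T. ?c vs p * foldr dir_deriv vs F p)"
      by (simp only: distrib_right sum.distrib 1 2)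
  qed (use S T in auto)
qed

lemma diff_operator_sum:
  "(\<And>i. i \<in> I \<Longrightarrow> diff_operator (P i)) \<Longrightarrow> diff_operator (\<lambda>F p. \<Sum>i\<in>I. P i F p)"
  by (induction I rule: infinite_finite_induct) (auto intro: diff_operator_zero diff_operator_add)

text \<open>
  By \<open>diff_operator_sum\<close> and \<open>diff_operator_cong\<close> a closure property of the class of differential
  operators can be checked on a single summand.
\<close>

lemma diff_operator_linear_combination:
  assumes P: "diff_operator P"
    and term_op: "\<And>a vs. smooth a \<Longrightarrow> vs \<in> lists tangent_dirs \<Longrightarrow> diff_operator (t a vs)"
    and eq: "\<And>S a F p. finite S \<Longrightarrow> S \<subseteq> lists tangent_dirs \<Longrightarrow> (\<forall>vs\<in>S. smooth (a vs)) \<Longrightarrow>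
       (\<forall>F. smooth F \<longrightarrow> (\<forall>p\<in>siegel_jacobi. P F p = (\<Sum>vs\<in>S. a vs p * foldr dir_deriv vs F p))) \<Longrightarrow>
       smooth F \<Longrightarrow> p \<in> siegel_jacobi \<Longrightarrow> Q F p = (\<Sum>vs\<in>S. t (a vs) vs F p)"
  shows "diff_operator Q"
proof -
  obtain S a where S: "finite S" "S \<subseteq> lists tangent_dirs" "\<forall>vs\<in>S. smooth (a vs)"
    "\<forall>F. smooth F \<longrightarrow> (\<forall>p\<in>siegel_jacobi. P F p = (\<Sum>vs\<in>S. a vs p * foldr dir_deriv vs F p))"
    using P unfolding diff_operator_def by blast
  have "diff_operator (\<lambda>F p. \<Sum>vs\<in>S. t (a vs) vs F p)"
    using S by (intro diff_operator_sum term_op) auto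
  then show ?thesis by (rule diff_operator_cong) (use eq[OF S] in simp)
qed

lemma diff_operator_mult:
  assumes f: "smooth f" and P: "diff_operator P"
  shows "diff_operator (\<lambda>F p. f p * P F p)"
proof (rule diff_operator_linear_combination[OF P])
  show "diff_operator (\<lambda>F p. (f p * a p) * foldr dir_deriv vs F p)"
    if "smooth a" "vs \<in> lists tangent_dirs" for a vs
    using that f by (intro diff_operator_term) auto
qed (simp add: sum_distrib_left mult.assoc)

lemma smooth_diff_operator:
  assumes "diff_operator P" "smooth F"
  shows "smooth (P F)"
proof -
  obtain S a where S: "finite S" "S \<subseteq> lists tangent_dirs" "\<forall>vs\<in>S. smooth (a vs)"
    "\<forall>F. smooth F \<longrightarrow> (\<forall>p\<in>siegel_jacobi. P F p = (\<Sum>vs\<in>S. a vs p * foldr dir_deriv vs F p))"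
    using assms unfolding diff_operator_def by blast
  have "smooth (\<lambda>p. \<Sum>vs\<in>S. a vs p * foldr dir_deriv vs F p)"
    using S assms by (intro smooth_sum smooth_mult smooth_foldr_dir_deriv) auto
  then show ?thesis by (rule smooth_cong) (use S assms in simp)
qed

lemma dir_deriv_sum:
  assumes "\<And>i. i \<in> I \<Longrightarrow> smooth (F i)" "p \<in> siegel_jacobi" "v \<in> tangent_dirs"
  shows "dir_deriv v (\<lambda>q. \<Sum>i\<in>I. F i q) p = (\<Sum>i\<in>I. dir_deriv v (F i) p)"
  using assms
  by (induction I rule: infinite_finite_induct) (auto simp: dir_deriv_const dir_deriv_add
      smooth_sum)

lemma diff_operator_dir_deriv:
  assumes v: "v \<in> tangent_dirs" and P: "diff_operator P"
  shows "diff_operator (\<lambda>F. dir_deriv v (P F))"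
proof (rule diff_operator_linear_combination[OF P])
  show "diff_operator (\<lambda>F p. a p * foldr dir_deriv (v # vs) F p
      + dir_deriv v a p * foldr dir_deriv vs F p)"
    if "smooth a" "vs \<in> lists tangent_dirs" for a vs
    using that v by (intro diff_operator_term diff_operator_add smooth_dir_deriv) auto
next
  fix S a and F :: "('a, 'b) point \<Rightarrow> complex" and p :: "('a, 'b) point"
  assume S: "finite S" "S \<subseteq> lists tangent_dirs" "\<forall>vs\<in>S. smooth (a vs)"
    "\<forall>F. smooth F \<longrightarrow> (\<forall>p\<in>siegel_jacobi. P F p = (\<Sum>vs\<in>S. a vs p * foldr dir_deriv vs F p))"
    "smooth F" "p \<in> siegel_jacobi"
  have sm: "smooth (foldr dir_deriv vs F)" if "vs \<in> S" for vs
    using that S by (intro smooth_foldr_dir_deriv) auto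
  have "dir_deriv v (P F) p = dir_deriv v (\<lambda>p. \<Sum>vs\<in>S. a vs p * foldr dir_deriv vs F p) p"
    by (rule dir_deriv_cong) (use S v in auto)
  also have "\<dots> = (\<Sum>vs\<in>S. dir_deriv v (\<lambda>p. a vs p * foldr dir_deriv vs F p) p)"
    by (rule dir_deriv_sum) (use S v sm in auto)
  also have "\<dots> = (\<Sum>vs\<in>S. a vs p * foldr dir_deriv (v # vs) F p
      + dir_deriv v (a vs) p * foldr dir_deriv vs F p)"
    using S v sm by (intro sum.cong refl) (simp add: dir_deriv_mult)
  finally show "dir_deriv v (P F) p =
      (\<Sum>vs\<in>S. a vs p * foldr dir_deriv (v # vs) F p + dir_deriv v (a vs) p
          * foldr dir_deriv vs F p)" .
qed

lemma diff_operator_comp: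
  assumes P: "diff_operator P" and Q: "diff_operator Q"
  shows "diff_operator (\<lambda>F. P (Q F))"
proof (rule diff_operator_linear_combination[OF P])
  show "diff_operator (\<lambda>F p. a p * foldr dir_deriv vs (Q F) p)"
    if "smooth a" "vs \<in> lists tangent_dirs" for a vs
  proof (intro diff_operator_mult that)
    show "diff_operator (\<lambda>F. foldr dir_deriv vs (Q F))"
      using that(2)
    proof (induction vs)
      case (Cons v vs)
      then have "v \<in> tangent_dirs" "diff_operator (\<lambda>F. foldr dir_deriv vs (Q F))" by auto
      from diff_operator_dir_deriv[OF this] show ?case by simp
    qed (simp add: Q)
  qed
qed (simp add: smooth_diff_operator Q)

lemma diff_operator_direction: "v \<in> tangent_dirs \<Longrightarrow> diff_operator (dir_deriv v)"
  using diff_operator_term[OF smooth_const[of 1], of "[v]"] by simp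

lemma diff_operator_id: "diff_operator (\<lambda>F. F)"
  using diff_operator_term[OF smooth_const[of 1], of "[]"] by simp

lemma foldr_dir_deriv_cnj:
  assumes "smooth F" "vs \<in> lists tangent_dirs" "p \<in> siegel_jacobi"
  shows "foldr dir_deriv vs (\<lambda>q. cnj (F q)) p = cnj (foldr dir_deriv vs F p)"
  using assms(2,3)
proof (induction vs arbitrary: p)
  case (Cons v vs)
  then have v: "v \<in> tangent_dirs" "vs \<in> lists tangent_dirs" by auto
  have "dir_deriv v (foldr dir_deriv vs (\<lambda>q. cnj (F q))) p = dir_deriv v (\<lambda>q. cnj (foldr dir_deriv
      vs F q)) p"
    by (rule dir_deriv_cong) (use Cons v in auto)
  also have "\<dots> = cnj (dir_deriv v (foldr dir_deriv vs F) p)"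
    by (rule dir_deriv_bounded_linear) (use Cons v assms in \<open>auto intro: bounded_linear_cnj
        smooth_foldr_dir_deriv\<close>)
  finally show ?case by simp
qed simp

lemma diff_operator_cnj:
  fixes P :: "('n::finite, 'm::finite) operator"
  assumes P: "diff_operator P"
  shows "diff_operator (\<lambda>F p. cnj (P (\<lambda>q. cnj (F q)) p))"
proof (rule diff_operator_linear_combination[OF P])
  show "diff_operator (\<lambda>F p. cnj (a p) * foldr dir_deriv vs F p)"
    if "smooth a" "vs \<in> lists tangent_dirs" for a and vs :: "('n, 'm) point list"
    using that by (intro diff_operator_term) auto
qed (auto simp: foldr_dir_deriv_cnj[OF _ subsetD] smooth_cnj intro!: sum.cong)

text \<open>
  Matrices all of whose entries are differential operators.
\<close>

definition diff_opmat :: "('n::finite, 'm::finite) operator^'b^'a \<Rightarrow> bool" where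
  "diff_opmat A \<longleftrightarrow> (\<forall>i j. diff_operator (A $ i $ j))"

named_theorems diff_opmat_intros

lemma diff_opmat_add [diff_opmat_intros]: "diff_opmat A \<Longrightarrow> diff_opmat B \<Longrightarrow> diff_opmat (A \<oplus> B)"
  by (simp add: diff_opmat_def op_add_def diff_operator_add)

lemma diff_opmat_scale [diff_opmat_intros]: "diff_opmat A \<Longrightarrow> diff_opmat (c \<odot> A)"
  by (simp add: diff_opmat_def op_scale_def diff_operator_mult smooth_const)

lemma diff_opmat_mult [diff_opmat_intros]: "diff_opmat A \<Longrightarrow> diff_opmat B \<Longrightarrow> diff_opmat (A \<otimes> B)"
  by (simp add: diff_opmat_def op_mult_def diff_operator_sum diff_operator_comp)

lemma diff_opmat_transpose [diff_opmat_intros]: "diff_opmat A \<Longrightarrow> diff_opmat (transpose A)"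
  by (simp add: diff_opmat_def)

lemma diff_opmat_fun [diff_opmat_intros]: "smooth_mat M \<Longrightarrow> diff_opmat (op_fun M)"
  by (simp add: diff_opmat_def op_fun_def smooth_mat_def diff_operator_mult diff_operator_id)

lemma diff_opmat_rmult [diff_opmat_intros]: "diff_opmat A \<Longrightarrow> diff_operator P \<Longrightarrow>
    diff_opmat (op_rmult A P)"
  by (simp add: diff_opmat_def op_rmult_def o_def diff_operator_comp)

lemma diff_opmat_col [diff_opmat_intros]: "diff_opmat A \<Longrightarrow> diff_opmat (op_col k A)"
  by (simp add: diff_opmat_def op_col_def)

lemma diff_opmat_cnj [diff_opmat_intros]: "diff_opmat A \<Longrightarrow> diff_opmat (op_cnj A)"
  by (simp add: diff_opmat_def op_cnj_def diff_operator_cnj)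

lemma diff_operator_trace [diff_opmat_intros]: "diff_opmat A \<Longrightarrow> diff_operator (op_trace A)"
  by (simp add: diff_opmat_def op_trace_def diff_operator_sum)

lemma zdir_tangent: "zdir i j c \<in> tangent_dirs"
  by (auto simp: zdir_def tangent_dirs_def vec_eq_iff axis_def)

lemma wdir_tangent: "wdir i j c \<in> tangent_dirs"
  by (auto simp: wdir_def tangent_dirs_def vec_eq_iff)

lemma diff_operator_wirtinger:
  assumes "\<And>c. d c \<in> tangent_dirs"
  shows "diff_operator (wirtinger d)" "diff_operator (wirtinger_bar d)"
proof -
  have *: "diff_operator (\<lambda>F p. 1/2 * dir_deriv (d 1) F p + c * dir_deriv (d \<i>) F p)" for c
    by (intro diff_operator_add diff_operator_mult diff_operator_direction assms smooth_const)
  show "diff_operator (wirtinger d)"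
    by (rule diff_operator_cong[OF *[of "- \<i> / 2"]]) (simp add: wirtinger_def field_simps)
  show "diff_operator (wirtinger_bar d)"
    by (rule diff_operator_cong[OF *[of "\<i> / 2"]]) (simp add: wirtinger_bar_def field_simps)
qed

lemma diff_operator_half: "diff_operator P \<Longrightarrow> diff_operator (\<lambda>F p. P F p / 2)"
  using diff_operator_mult[OF smooth_const[of "1/2"]] by simp

lemma diff_opmat_wirtinger [diff_opmat_intros]:
  "diff_opmat dZ" "diff_opmat dZbar" "diff_opmat dW" "diff_opmat dWbar"
  by (auto simp: diff_opmat_def dZ_def dZbar_def dW_def dWbar_def
      intro!: diff_operator_wirtinger diff_operator_half zdir_tangent wdir_tangent)

lemma diff_opmat_Xplus [diff_opmat_intros]: "diff_opmat Xplus"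
  unfolding Xplus_def by (intro diff_opmat_intros smooth_mat_intros)

lemma diff_opmat_Xminus [diff_opmat_intros]: "diff_opmat Xminus"
  unfolding Xminus_def by (intro diff_opmat_intros smooth_mat_intros)

lemma diff_opmat_Kop [diff_opmat_intros]: "diff_opmat Kop"
  unfolding Kop_def by (intro diff_opmat_intros smooth_mat_intros)

lemma diff_opmat_Lambda [diff_opmat_intros]: "diff_opmat Lambda"
  unfolding Lambda_def by (intro diff_opmat_intros smooth_mat_intros)

lemma diff_opmat_A_one [diff_opmat_intros]: "diff_opmat A_one"
  unfolding A_one_def by (intro diff_opmat_intros)

lemma diff_opmat_A_step: "diff_opmat A \<Longrightarrow> diff_opmat (A_step A)"
  unfolding A_step_def by (intro diff_opmat_intros smooth_mat_intros)

lemma diff_opmat_Aop [diff_opmat_intros]: "diff_opmat (Aop j)"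
proof (induction j rule: Aop.induct)
  case 1
  then show ?case by (simp add: diff_opmat_def diff_operator_zero)
qed (simp_all add: diff_opmat_A_one diff_opmat_A_step)

lemma diff_opmat_Yplus_Yminus [diff_opmat_intros]:
  "diff_opmat Yplus" "diff_opmat (Yplus_col k)" "diff_opmat Yminus" "diff_opmat (Yminus_row k)"
  unfolding Yplus_def Yplus_col_def Yminus_def Yminus_row_def
  by (intro diff_opmat_intros smooth_mat_intros)+

section \<open>The action of the Jacobi group\<close>

lemma sum_UNIV_sum_type:
  "(\<Sum>a\<in>UNIV. f (a :: 'a::finite + 'b::finite)) = (\<Sum>i\<in>UNIV. f (Inl i)) + (\<Sum>j\<in>UNIV. f (Inr j))"
  by (simp add: UNIV_Plus_UNIV[symmetric] sum.Plus del: UNIV_Plus_UNIV)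

lemma Sp_blocks:
  assumes "M \<in> Sp"
  shows "transpose (blockA M) ** blockC M = transpose (blockC M) ** blockA M"
    and "transpose (blockB M) ** blockD M = transpose (blockD M) ** blockB M"
    and "transpose (blockA M) ** blockD M - transpose (blockC M) ** blockB M = mat 1"
proof -
  have M: "(transpose M ** Jmat ** M) $ x $ y = Jmat $ x $ y" for x y
    using assms by (simp add: Sp_def)
  have *: "(transpose M ** Jmat ** M) $ x $ y
      = (\<Sum>j\<in>UNIV. M $ Inl j $ x * M $ Inr j $ y) - (\<Sum>j\<in>UNIV. M $ Inr j $ x * M $ Inl j $ y)" for x y
  proof -
    have "(transpose M ** Jmat) $ x $ Inl j = - M $ Inr j $ x"
      "(transpose M ** Jmat) $ x $ Inr j = M $ Inl j $ x" for j
      by (simp_all add: matrix_mul_componentwise sum_UNIV_sum_type Jmat_def if_distrib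
          cong: if_cong)
    then show ?thesis
      unfolding matrix_mul_componentwise[of "transpose M ** Jmat"] sum_UNIV_sum_type
      by (simp add: sum_negf)
  qed
  show "transpose (blockA M) ** blockC M = transpose (blockC M) ** blockA M"
    using M[of "Inl _" "Inl _", unfolded *]
    by (simp add: vec_eq_iff matrix_mul_componentwise blockA_def blockC_def Jmat_def)
  show "transpose (blockB M) ** blockD M = transpose (blockD M) ** blockB M"
    using M[of "Inr _" "Inr _", unfolded *]
    by (simp add: vec_eq_iff matrix_mul_componentwise blockB_def blockD_def Jmat_def)
  show "transpose (blockA M) ** blockD M - transpose (blockC M) ** blockB M = mat 1"
    using M[of "Inl _" "Inr _", unfolded *]
    by (simp add: vec_eq_iff matrix_mul_componentwise blockA_def blockB_def blockC_def blockD_def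
        Jmat_def mat_def)
qed

lemma sesquilinear_adjoint:
  "(\<Sum>i\<in>UNIV. cnj ((A *v x) $ i) * w $ i) = (\<Sum>k\<in>UNIV. cnj (x $ k)
      * (transpose (conj_mat A) *v w) $ k)"
proof -
  have "(\<Sum>i\<in>UNIV. cnj ((A *v x) $ i) * w $ i) = (\<Sum>i\<in>UNIV. \<Sum>k\<in>UNIV. cnj (x $ k) * (cnj (A $ i $ k)
      * w $ i))"
    by (simp add: matrix_vector_mult_def sum_distrib_left sum_distrib_right mult_ac)
  also have "\<dots> = (\<Sum>k\<in>UNIV. \<Sum>i\<in>UNIV. cnj (x $ k) * (cnj (A $ i $ k) * w $ i))"
    by (rule sum.swap)
  finally show ?thesis by (simp add: matrix_vector_mult_def sum_distrib_left del:
      transpose_matrix_vector)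
qed

lemma pos_def_hermitian:
  assumes "pos_def Q" "v \<noteq> 0"
  shows "Re (\<Sum>i\<in>UNIV. cnj (v $ i) * (cmat Q *v v) $ i) > 0"
  using pos_def_complex[OF assms]
  by (simp add: matrix_vector_mult_def sum_distrib_left mult.assoc)

lemma siegel_jacobi_iff: "p \<in> siegel_jacobi \<longleftrightarrow> transpose (fst p) = fst p \<and> pos_def (Im_mat (fst p))"
  by (cases p) (simp add: siegel_jacobi_def siegel_def)

lemma siegel_jacobi_symmetric: "p \<in> siegel_jacobi \<Longrightarrow> transpose (fst p) = fst p"
  by (simp add: siegel_jacobi_iff)

lemma transpose_ZmZbar: "p \<in> siegel_jacobi \<Longrightarrow> transpose (ZmZbar p) = ZmZbar p"
  by (simp add: ZmZbar_def transpose_diff conj_mat_transpose[symmetric] siegel_jacobi_symmetric)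

text \<open>
  Every point has the form \<open>(Z, P Z + Q)\<close> with unique real matrices \<open>P\<close> and \<open>Q\<close>, and \<open>P = V Y\<inverse>\<close>.
\<close>

definition slope :: "('n::finite, 'm::finite) point \<Rightarrow> complex^'n^'m" where
  "slope p = transpose (Vtr p) ** Yinv p"

lemma Yinv_real: "p \<in> siegel_jacobi \<Longrightarrow> conj_mat (Yinv p) = Yinv p"
  unfolding Yinv_def
proof (rule matrix_inv_unique[symmetric])
  assume p: "p \<in> siegel_jacobi"
  have c: "conj_mat (Ymat p) = Ymat p" by (simp add: Ymat_def)
  show "conj_mat (matrix_inv (Ymat p)) ** Ymat p = mat 1"
    using matrix_inv_left[OF invertible_Ymat[OF p]] c by (metis conj_mat_mult conj_mat_mat
        complex_cnj_one)
  show "Ymat p ** conj_mat (matrix_inv (Ymat p)) = mat 1"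
    using matrix_inv_right[OF invertible_Ymat[OF p]] c by (metis conj_mat_mult conj_mat_mat
        complex_cnj_one)
qed

lemma slope_real: "p \<in> siegel_jacobi \<Longrightarrow> conj_mat (slope p) = slope p"
  by (simp add: slope_def conj_mat_mult Yinv_real Vtr_def conj_mat_transpose)

lemma slope_mult_ZmZbar:
  assumes "p \<in> siegel_jacobi"
  shows "slope p ** ZmZbar p = snd p - conj_mat (snd p)"
proof -
  have "slope p ** ZmZbar p = (2 * \<i>) *\<^sub>m (transpose (Vtr p) ** (Yinv p ** Ymat p))"
    by (simp add: slope_def ZmZbar_eq mscale_mult_right matrix_mul_assoc)
  also have "\<dots> = (2 * \<i>) *\<^sub>m transpose (Vtr p)"
    by (simp add: Yinv_def matrix_inv_left invertible_Ymat assms)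
  also have "\<dots> = snd p - conj_mat (snd p)"
    by (simp add: vec_eq_iff Vtr_def Im_mat_def complex_eq_iff)
  finally show ?thesis .
qed

text \<open>
  The blocks of the symplectic matrix and the parts \<open>\<lambda>\<close> and \<open>\<mu>\<close>, here \<open>l\<close> and \<open>u\<close>, of an element of
  the Jacobi group, as complex matrices fixed by conjugation. The component \<open>\<kappa>\<close> does not enter the action. In this locale
  \<open>act\<close> is the action on points, \<open>J = C Z + D\<close> is the automorphy factor, \<open>R\<close> is its inverse and
  \<open>N = A Z + B\<close>; they are functions of the point at which the action is taken.
\<close>

locale jacobi_element =
  fixes A B C D :: "complex^'n::finite^'n" and l u :: "complex^'n^'m::finite"
  assumes real: "conj_mat A = A" "conj_mat B = B" "conj_mat C = C" "conj_mat D = D"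
      "conj_mat l = l" "conj_mat u = u"
    and symplectic: "transpose A ** C = transpose C ** A" "transpose B ** D = transpose D ** B"
      "transpose A ** D - transpose C ** B = mat 1"
begin

definition J :: "('n, 'm) point \<Rightarrow> complex^'n^'n" where "J p = C ** fst p + D"
definition N :: "('n, 'm) point \<Rightarrow> complex^'n^'n" where "N p = A ** fst p + B"
definition R :: "('n, 'm) point \<Rightarrow> complex^'n^'n" where "R p = matrix_inv (J p)"
definition act :: "('n, 'm) point \<Rightarrow> ('n, 'm) point" where
  "act p = (N p ** R p, (snd p + l ** fst p + u) ** R p)"

lemma symplectic_transpose: "transpose D ** A - transpose B ** C = mat 1"
  using arg_cong[OF symplectic(3), of transpose]
  by (simp add: transpose_diff matrix_transpose_mul)

text \<open>
  With \<open>X\<close> the conjugate of \<open>Z\<close> this is the hermitian identity that yields the invertibility of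
  \<open>J\<close> and the transformation of the imaginary part; with \<open>X = Z\<close> it yields the symmetry of the
  image.
\<close>

lemma J_N_symmetric:
  assumes X: "transpose X = X" and p: "transpose (fst p) = fst p"
  shows "transpose (C ** X + D) ** N p - transpose (A ** X + B) ** J p = fst p - X"
proof -
  define Z where "Z = fst p"
  have "transpose (C ** X + D) ** N p - transpose (A ** X + B) ** J p
     = X ** (transpose C ** A - transpose A ** C) ** Z
     + X ** (transpose C ** B - transpose A ** D)
     + (transpose D ** A - transpose B ** C) ** Z + (transpose D ** B - transpose B ** D)"
    by (simp add: J_def N_def Z_def transpose_add matrix_transpose_mul X matrix_add_ldistrib
        matrix_add_rdistrib matrix_diff_ldistrib matrix_diff_rdistrib matrix_mul_assoc)
  also have "\<dots> = Z - X"
  proof -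
    have "transpose C ** B - transpose A ** D = - mat 1"
      using symplectic(3) by (metis minus_diff_eq)
    then show ?thesis
      by (simp add: symplectic symplectic_transpose matrix_minus_right)
  qed
  finally show ?thesis by (simp add: Z_def)
qed

lemma conj_J: "conj_mat (J p) = C ** conj_mat (fst p) + D"
  by (simp add: J_def conj_mat_add conj_mat_mult real)

lemma conj_N: "conj_mat (N p) = A ** conj_mat (fst p) + B"
  by (simp add: N_def conj_mat_add conj_mat_mult real)

lemma hermitian_identity:
  assumes p: "p \<in> siegel_jacobi"
  shows "transpose (conj_mat (J p)) ** N p - transpose (conj_mat (N p)) ** J p = ZmZbar p"
  unfolding conj_J conj_N ZmZbar_def
  by (rule J_N_symmetric)
    (simp_all add: siegel_jacobi_symmetric[OF p] conj_mat_transpose[symmetric])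

lemma invertible_J:
  assumes p: "p \<in> siegel_jacobi"
  shows "invertible (J p)"
proof -
  have "v = 0" if v: "J p *v v = 0" for v
  proof (rule ccontr)
    assume "v \<noteq> 0"
    have "ZmZbar p *v v = transpose (conj_mat (J p)) *v (N p *v v)
        - transpose (conj_mat (N p)) *v (J p *v v)"
      by (simp only: hermitian_identity[OF p, symmetric] matrix_vector_mult_diff_rdistrib
          matrix_vector_mul_assoc)
    also have "\<dots> = transpose (conj_mat (J p)) *v (N p *v v)" by (simp only: v) simp
    finally have "(\<Sum>i\<in>UNIV. cnj (v $ i) * (ZmZbar p *v v) $ i)
        = (\<Sum>i\<in>UNIV. cnj ((J p *v v) $ i) * (N p *v v) $ i)"
      by (simp only: sesquilinear_adjoint)
    also have "\<dots> = 0" by (simp add: v)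
    finally have 0: "(\<Sum>i\<in>UNIV. cnj (v $ i) * (ZmZbar p *v v) $ i) = 0" .
    have "(ZmZbar p *v v) $ i = 2 * \<i> * (Ymat p *v v) $ i" for i
      by (simp add: ZmZbar_eq matrix_vector_mult_def sum_distrib_left mult.assoc)
    with 0 have "2 * \<i> * (\<Sum>i\<in>UNIV. cnj (v $ i) * (Ymat p *v v) $ i) = 0"
      by (simp add: sum_distrib_left mult_ac)
    then have "(\<Sum>i\<in>UNIV. cnj (v $ i) * (Ymat p *v v) $ i) = 0" by simp
    moreover have "Re (\<Sum>i\<in>UNIV. cnj (v $ i) * (Ymat p *v v) $ i) > 0"
      unfolding Ymat_def by (rule pos_def_hermitian[OF _ \<open>v \<noteq> 0\<close>]) (use p in \<open>simp add:
          siegel_jacobi_iff\<close>)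
    ultimately show False by (metis less_irrefl zero_complex.sel(1))
  qed
  then show ?thesis
    using matrix_left_invertible_ker[of "J p"] invertible_left_inverse by blast
qed

lemma R_J: "p \<in> siegel_jacobi \<Longrightarrow> R p ** J p = mat 1"
  and J_R: "p \<in> siegel_jacobi \<Longrightarrow> J p ** R p = mat 1"
  by (simp_all add: R_def matrix_inv_left matrix_inv_right invertible_J)

lemma transpose_R_J: "p \<in> siegel_jacobi \<Longrightarrow> transpose (R p) ** transpose (J p) = mat 1"
  and transpose_J_R: "p \<in> siegel_jacobi \<Longrightarrow> transpose (J p) ** transpose (R p) = mat 1"
  by (simp_all add: matrix_transpose_mul[symmetric] R_J J_R)

lemma act_J: "p \<in> siegel_jacobi \<Longrightarrow> fst (act p) ** J p = N p"
  by (simp add: act_def matrix_mul_assoc[symmetric] R_J)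

lemma act_symmetric:
  assumes p: "p \<in> siegel_jacobi"
  shows "transpose (fst (act p)) = fst (act p)"
proof -
  have "transpose (J p) ** N p - transpose (N p) ** J p = 0"
    using J_N_symmetric[of "fst p" p] siegel_jacobi_symmetric[OF p] by (simp add: J_def N_def)
  then have "transpose (J p) ** (transpose (fst (act p)) ** J p)
      = transpose (J p) ** (fst (act p) ** J p)"
    using act_J[OF p, symmetric] by (simp add: matrix_transpose_mul matrix_mul_assoc)
  then show ?thesis
    by - (rule invertible_cancel_right[OF invertible_J[OF p]],
        rule invertible_cancel_left[OF invertible_transpose[OF invertible_J[OF p]]])
qed

text \<open>
  In terms of the image point the inverse automorphy factor is a polynomial; it is the
  automorphy factor of the inverse group element. Hence the right factor \<open>R\<^sup>t\<close> is differentiated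
  as a polynomial below.
\<close>

lemma R_eq:
  assumes p: "p \<in> siegel_jacobi"
  shows "R p = transpose A - transpose C ** fst (act p)"
proof (rule invertible_cancel_right[OF invertible_J[OF p]])
  have "(transpose A - transpose C ** fst (act p)) ** J p = transpose A ** J p - transpose C ** N p"
    by (simp add: matrix_diff_rdistrib act_J[OF p] matrix_mul_assoc[symmetric])
  also have "\<dots> = (transpose A ** C - transpose C ** A) ** fst p
      + (transpose A ** D - transpose C ** B)"
    by (simp add: J_def N_def matrix_add_ldistrib matrix_diff_rdistrib matrix_mul_assoc)
  also have "\<dots> = mat 1" by (simp add: symplectic)
  finally show "R p ** J p = (transpose A - transpose C ** fst (act p)) ** J p" by (simp add: R_J p)
qed

lemma transpose_R_eq:
  "p \<in> siegel_jacobi \<Longrightarrow> transpose (R p) = A - fst (act p) ** C"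
  using R_eq by (simp add: transpose_diff matrix_transpose_mul act_symmetric)

lemma ZmZbar_act:
  assumes p: "p \<in> siegel_jacobi"
  shows "ZmZbar p = transpose (conj_mat (J p)) ** ZmZbar (act p) ** J p"
proof -
  have N: "N p = fst (act p) ** J p" using act_J[OF p] by simp
  have "transpose (conj_mat (N p)) = transpose (conj_mat (J p)) ** conj_mat (fst (act p))"
    unfolding N by (simp add: conj_mat_mult matrix_transpose_mul conj_mat_transpose[symmetric]
        act_symmetric[OF p])
  then show ?thesis
    unfolding hermitian_identity[OF p, symmetric]
    by (simp add: N ZmZbar_def matrix_diff_ldistrib matrix_diff_rdistrib matrix_mul_assoc)
qed

lemma conj_J_R: "p \<in> siegel_jacobi \<Longrightarrow> conj_mat (J p) ** conj_mat (R p) = mat 1"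
  by (simp add: conj_mat_mult[symmetric] J_R)

lemma conj_transpose_R_J: "p \<in> siegel_jacobi \<Longrightarrow> transpose (conj_mat (R p))
    ** transpose (conj_mat (J p)) = mat 1"
  by (simp add: matrix_transpose_mul[symmetric] conj_J_R)

lemma ZmZbar_R:
  assumes p: "p \<in> siegel_jacobi"
  shows "ZmZbar p ** R p = transpose (conj_mat (J p)) ** ZmZbar (act p)"
  unfolding ZmZbar_act[OF p] by (simp add: matrix_mul_assoc[symmetric] J_R p)

lemma act_siegel_jacobi:
  assumes p: "p \<in> siegel_jacobi"
  shows "act p \<in> siegel_jacobi"
proof -
  have "ZmZbar (act p) = transpose (conj_mat (R p)) ** ZmZbar p ** R p"
    by (simp only: ZmZbar_R[OF p] matrix_mul_assoc[symmetric])
      (simp add: matrix_mul_assoc conj_transpose_R_J p)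
  then have Y: "Ymat (act p) = transpose (conj_mat (R p)) ** Ymat p ** R p"
    by (simp add: ZmZbar_eq mscale_mult_left mscale_mult_right vec_eq_iff)
  have "x \<bullet> (Im_mat (fst (act p)) *v x) > 0" if x: "x \<noteq> 0" for x
  proof -
    define z :: "complex^'n" where "z = (\<chi> i. of_real (x $ i))"
    define v where "v = R p *v z"
    have "z \<noteq> 0" using x by (auto simp: z_def vec_eq_iff)
    moreover have "J p *v v = z" by (simp add: v_def matrix_vector_mul_assoc J_R p)
    ultimately have v0: "v \<noteq> 0" by auto
    have "(\<Sum>i\<in>UNIV. cnj (v $ i) * (Ymat p *v v) $ i) = (\<Sum>k\<in>UNIV. cnj (z $ k)
        * (Ymat (act p) *v z) $ k)"
      unfolding v_def Y by (simp only: sesquilinear_adjoint matrix_vector_mul_assoc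
          matrix_mul_assoc)
    also have "\<dots> = of_real (x \<bullet> (Im_mat (fst (act p)) *v x))"
      by (simp add: z_def Ymat_def inner_vec_def matrix_vector_mult_def)
    finally show ?thesis
      using pos_def_hermitian[OF _ v0, of "Im_mat (fst p)"] p
          by (simp add: siegel_jacobi_iff Ymat_def)
  qed
  moreover have "transpose (Im_mat (fst (act p))) = Im_mat (transpose (fst (act p)))"
    by (simp add: vec_eq_iff Im_mat_def)
  then have "transpose (Im_mat (fst (act p))) = Im_mat (fst (act p))"
    by (simp only: act_symmetric[OF p])
  ultimately have "pos_def (Im_mat (fst (act p)))" unfolding pos_def_def by blast
  then show ?thesis unfolding siegel_jacobi_iff using act_symmetric[OF p] by blast
qed

lemma ZmZbar_act_transpose:
  assumes p: "p \<in> siegel_jacobi"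
  shows "ZmZbar p = transpose (J p) ** ZmZbar (act p) ** conj_mat (J p)"
  using arg_cong[OF ZmZbar_act[OF p], of transpose]
  by (simp add: matrix_transpose_mul transpose_ZmZbar p act_siegel_jacobi matrix_mul_assoc)

lemma ZmZbar_conj_R:
  assumes p: "p \<in> siegel_jacobi"
  shows "ZmZbar p ** conj_mat (R p) = transpose (J p) ** ZmZbar (act p)"
  unfolding ZmZbar_act_transpose[OF p] by (simp add: matrix_mul_assoc[symmetric] conj_J_R p)

lemma ZmZbar_C:
  assumes p: "p \<in> siegel_jacobi"
  shows "ZmZbar p ** transpose C = transpose (J p) - transpose (conj_mat (J p))"
  unfolding conj_J
  by (simp add: J_def ZmZbar_def transpose_add matrix_transpose_mul matrix_diff_rdistrib
      siegel_jacobi_symmetric[OF p] conj_mat_transpose[symmetric])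

lemma conj_transpose_R_eq:
  assumes p: "p \<in> siegel_jacobi"
  shows "transpose (conj_mat (R p)) = transpose (R p) + ZmZbar (act p) ** C"
proof -
  have "transpose (conj_mat (R p)) = conj_mat (transpose (R p))" by (simp add: conj_mat_transpose)
  then show ?thesis
    by (simp add: transpose_R_eq[OF p] conj_mat_diff conj_mat_mult real ZmZbar_def
        matrix_diff_rdistrib)
qed

text \<open>
  The transformation law of the real matrix \<open>P\<close>. It says that the forms \<open>dW - P dZ\<close> are
  multiplied by \<open>R\<close> from the right under the action.
\<close>

lemma slope_act:
  assumes p: "p \<in> siegel_jacobi"
  shows "slope (act p) ** transpose (R p) = slope p + l - snd (act p) ** C"
proof -
  define P Q Z W' where "P = slope p + l" and "Q = (snd p - slope p ** fst p) + u"
    and "Z = fst p" and "W' = snd (act p)"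
  have W'J: "W' ** J p = P ** Z + Q"
    by (simp add: W'_def act_def matrix_mul_assoc[symmetric] R_J p P_def Q_def Z_def
        matrix_add_rdistrib)
  have P: "conj_mat P = P" by (simp add: P_def conj_mat_add slope_real p real)
  have Q: "conj_mat Q = Q"
  proof -
    have "slope p ** fst p - slope p ** conj_mat (fst p) = snd p - conj_mat (snd p)"
      using slope_mult_ZmZbar[OF p] by (simp add: ZmZbar_def matrix_diff_ldistrib)
    then have "conj_mat (snd p) - slope p ** conj_mat (fst p) = snd p - slope p ** fst p"
      by (simp add: algebra_simps)
    then show ?thesis
      by (simp add: Q_def conj_mat_add conj_mat_diff conj_mat_mult slope_real p real)
  qed
  have W'J': "conj_mat W' ** conj_mat (J p) = P ** conj_mat Z + Q"
    using arg_cong[OF W'J, of conj_mat] by (simp add: conj_mat_mult conj_mat_add P Q)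
  \<comment> \<open>It suffices to verify \<open>X (Z' - conj Z') = W' - conj W'\<close>, which characterises the slope of the
      image.\<close>
  define X where "X = (P - W' ** C) ** transpose (J p)"
  have "X ** ZmZbar (act p) ** conj_mat (J p) = (P - W' ** C) ** ZmZbar p"
    by (simp add: X_def ZmZbar_act_transpose[OF p] matrix_mul_assoc)
  also have "\<dots> = P ** Z - P ** conj_mat Z - W' ** (C ** Z) + W' ** (C ** conj_mat Z)"
    by (simp add: ZmZbar_def Z_def matrix_diff_ldistrib matrix_diff_rdistrib matrix_mul_assoc)
  also have "W' ** (C ** Z) = W' ** J p - W' ** D"
    by (simp add: J_def Z_def matrix_add_ldistrib)
  also have "W' ** (C ** conj_mat Z) = W' ** conj_mat (J p) - W' ** D"
    by (simp add: conj_J Z_def matrix_add_ldistrib)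
  also have "P ** Z - P ** conj_mat Z - (W' ** J p - W' ** D) + (W' ** conj_mat (J p) - W' ** D)
      = (W' - conj_mat W') ** conj_mat (J p)"
    by (simp add: W'J W'J' matrix_diff_rdistrib)
  also have "W' - conj_mat W' = slope (act p) ** ZmZbar (act p)"
    by (simp add: slope_mult_ZmZbar act_siegel_jacobi p W'_def)
  finally have "X = slope (act p)"
    using invertible_cancel_right invertible_ZmZbar[OF act_siegel_jacobi[OF p]]
    by (metis conj_J_R p matrix_mul_assoc matrix_mul_rid)
  then have "slope (act p) ** transpose (R p) = (P - W' ** C) ** (transpose (J p)
      ** transpose (R p))"
    by (simp add: X_def matrix_mul_assoc)
  then show ?thesis by (simp add: transpose_J_R p P_def W'_def)
qed

lemma smooth_mat_J [smooth_mat_intros]: "smooth_mat J"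
  unfolding J_def by (intro smooth_mat_intros)

lemma smooth_mat_R [smooth_mat_intros]: "smooth_mat R"
  unfolding R_def by (intro smooth_mat_inv smooth_mat_intros invertible_J)

text \<open>
  The differential of the action: \<open>dZ\<close> becomes \<open>R\<^sup>t dZ R\<close>, and \<open>dW\<close> becomes \<open>(dW + (l - W' C)
  dZ) R\<close>, where \<open>W'\<close> belongs to the image point.
\<close>

lemma act_has_derivative:
  assumes p: "p \<in> siegel_jacobi"
  shows "(act has_derivative (\<lambda>h. (transpose (R p) ** fst h ** R p,
      (snd h + (l - snd (act p) ** C) ** fst h) ** R p))) (at p within siegel_jacobi)"
proof -
  note mult = bounded_bilinear.FDERIV[OF bounded_bilinear_matrix_mult]
  have dJ: "(J has_derivative (\<lambda>h. C ** fst h)) (at p within siegel_jacobi)"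
    unfolding J_def by (rule derivative_eq_intros mult refl | simp)+
  have dN: "(N has_derivative (\<lambda>h. A ** fst h)) (at p within siegel_jacobi)"
    unfolding N_def by (rule derivative_eq_intros mult refl | simp)+
  have dW: "((\<lambda>p. snd p + l ** fst p + u) has_derivative (\<lambda>h. snd h
      + l ** fst h)) (at p within siegel_jacobi)"
    by (rule derivative_eq_intros mult refl | simp)+
  have "(matrix_inv \<circ> J has_derivative (\<lambda>H. - (matrix_inv (J p) ** H
      ** matrix_inv (J p))) \<circ> (\<lambda>h. C ** fst h))
      (at p within siegel_jacobi)"
    by (rule diff_chain_within[OF dJ], rule has_derivative_subset[OF has_derivative_matrix_inv])
      (auto intro: invertible_J p)
  then have dR: "(R has_derivative (\<lambda>h. - (R p ** (C ** fst h)
      ** R p))) (at p within siegel_jacobi)"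
    by (simp add: R_def[abs_def] o_def)
  have "(act has_derivative (\<lambda>h. (N p ** - (R p ** (C ** fst h) ** R p) + A ** fst h ** R p,
      (snd p + l ** fst p + u) ** - (R p ** (C ** fst h) ** R p) + (snd h + l ** fst h) ** R p)))
      (at p within siegel_jacobi)"
    unfolding act_def by (intro has_derivative_Pair mult dN dW dR)
  also have "(\<lambda>h. (N p ** - (R p ** (C ** fst h) ** R p) + A ** fst h ** R p,
      (snd p + l ** fst p + u) ** - (R p ** (C ** fst h) ** R p) + (snd h + l ** fst h) ** R p))
     = (\<lambda>h. (transpose (R p) ** fst h ** R p, (snd h + (l - snd (act p) ** C) ** fst h) ** R p))"
    by (auto simp: fun_eq_iff transpose_R_eq[OF p] act_def matrix_minus_right matrix_diff_rdistrib
        matrix_add_rdistrib matrix_mul_assoc)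
  finally show ?thesis .
qed

lemma smooth_mat_act:
  "smooth_mat (\<lambda>p. fst (act p))" "smooth_mat (\<lambda>p. snd (act p))"
  unfolding act_def N_def fst_conv snd_conv by (intro smooth_mat_intros)+

text \<open>Components of the differential of the action along a fixed direction are smooth.\<close>

lemma smooth_act_derivative:
  assumes b: "b \<in> Basis"
  shows "smooth (\<lambda>p. of_real ((transpose (R p) ** fst v ** R p,
      (snd v + (l - snd (act p) ** C) ** fst v) ** R p) \<bullet> b))"
proof -
  have *: "smooth (\<lambda>p. of_real (M p \<bullet> axis i (axis j c)))"
    if "smooth_mat M" for M :: "('n, 'm) point \<Rightarrow> complex^'b^'a" and i j c
    unfolding inner_axis
    using smooth_bounded_linear[OF bounded_linear_compose[OF bounded_linear_of_real
        bounded_linear_inner_left]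
        smooth_mat_nth[OF that]] .
  have 1: "smooth_mat (\<lambda>p. transpose (R p) ** fst v ** R p)"
    by (intro smooth_mat_intros)
  have 2: "smooth_mat (\<lambda>p. (snd v + (l - snd (act p) ** C) ** fst v) ** R p)"
    by (intro smooth_mat_intros smooth_mat_act)
  from b show ?thesis
    by (auto simp: Basis_prod_def Basis_vec_def intro!: *[OF 1] *[OF 2])
qed

lemma C_k_compose_act: "C_k k F \<Longrightarrow> C_k k (\<lambda>p. F (act p))"
proof (induction k arbitrary: F)
  case 0
  have "continuous_on siegel_jacobi act"
    using has_derivative_continuous_on[OF act_has_derivative] .
  with 0 show ?case
    using continuous_on_compose2[of siegel_jacobi F siegel_jacobi act]
    by (simp add: image_subsetI act_siegel_jacobi)
next
  case (Suc k)
  let ?d = "\<lambda>p h. (transpose (R p) ** fst h ** R p, (snd h + (l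
      - snd (act p) ** C) ** fst h) ** R p)"
  have FD: "((\<lambda>p. F (act p)) has_derivative (\<lambda>h. dir_deriv (symm (?d p h)) F (act p))) (at p
      within siegel_jacobi)"
    if p: "p \<in> siegel_jacobi" for p
  proof -
    have "(F has_derivative (\<lambda>h. dir_deriv (symm h) F (act p))) (at (act p) within act `
        siegel_jacobi)"
      by (rule has_derivative_subset[OF C1_has_derivative[OF Suc.prems]])
        (auto intro: act_siegel_jacobi p)
    from diff_chain_within[OF act_has_derivative[OF p] this] show ?thesis by (simp add: o_def)
  qed
  show ?case
  proof (rule C_k_SucI[OF FD])
    fix v :: "('n, 'm) point" assume v: "v \<in> tangent_dirs"
    have "C_k k (\<lambda>p. \<Sum>b\<in>Basis. of_real (?d p v \<bullet> b) * dir_deriv (symm b) F (act p))"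
      using smooth_act_derivative Suc unfolding smooth_def
      by (intro C_k_sum C_k_mult Suc.IH) auto
    then show "C_k k (\<lambda>p. dir_deriv (symm (?d p v)) F (act p))"
    proof (rule C_k_cong)
      fix q :: "('n, 'm) point" assume q: "q \<in> siegel_jacobi"
      have lin: "linear (\<lambda>h. dir_deriv (symm h) F (act q))"
        using has_derivative_bounded_linear[OF C1_has_derivative[OF Suc.prems act_siegel_jacobi[OF
            q]]]
          bounded_linear.linear by blast
      have "dir_deriv (symm (\<Sum>b\<in>Basis. (?d q v \<bullet> b) *\<^sub>R b)) F (act q)
          = (\<Sum>b\<in>Basis. (?d q v \<bullet> b) *\<^sub>R dir_deriv (symm b) F (act q))"
        unfolding linear_sum[OF lin] linear_scale[OF lin] ..
      then show "(\<Sum>b\<in>Basis. of_real (?d q v \<bullet> b) * dir_deriv (symm b) F (act q))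
          = dir_deriv (symm (?d q v)) F (act q)"
        unfolding euclidean_representation by (simp add: scaleR_conv_of_real)
    qed
  qed
qed

lemma smooth_compose_act: "smooth F \<Longrightarrow> smooth (\<lambda>p. F (act p))"
  by (simp add: smooth_def C_k_compose_act)

lemma smooth_mat_compose_act: "smooth_mat M \<Longrightarrow> smooth_mat (\<lambda>p. M (act p))"
  unfolding smooth_mat_def
  by (intro allI, rule smooth_compose_act[of "\<lambda>p. M p $ i $ j" for i j]) simp

lemma dir_deriv_compose_act:
  assumes F: "smooth F" and p: "p \<in> siegel_jacobi" and v: "v \<in> tangent_dirs"
  shows "dir_deriv v (\<lambda>p. F (act p)) p = dir_deriv (transpose (R p) ** fst v ** R p,
      (snd v + (l - snd (act p) ** C) ** fst v) ** R p) F (act p)"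
proof -
  have "(F has_derivative (\<lambda>h. dir_deriv (symm h) F (act p))) (at (act p) within act `
      siegel_jacobi)"
    by (rule has_derivative_subset[OF smooth_has_derivative[OF F]]) (auto intro: act_siegel_jacobi
        p)
  from diff_chain_within[OF act_has_derivative[OF p] this]
  have "dir_deriv v (\<lambda>p. F (act p)) p = dir_deriv (symm (transpose (R p) ** fst v ** R p,
      (snd v + (l - snd (act p) ** C) ** fst v) ** R p)) F (act p)"
    using dir_deriv_eq[OF _ p v] by (fastforce simp: o_def)
  moreover have "(transpose (R p) ** fst v ** R p, (snd v + (l
      - snd (act p) ** C) ** fst v) ** R p) \<in> tangent_dirs"
    using v by (auto simp: tangent_dirs_def matrix_transpose_mul matrix_mul_assoc)
  ultimately show ?thesis by (simp add: symm_id)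
qed

end

lemma jacobi_act_element:
  assumes g: "(M, l, u, k) \<in> jacobi_group"
  shows "jacobi_element (cmat (blockA M)) (cmat (blockB M)) (cmat (blockC M)) (cmat (blockD M))
      (cmat l) (cmat u)"
    and "jacobi_act (M, l, u, k) = jacobi_element.act (cmat (blockA M)) (cmat (blockB M)) (cmat
        (blockC M)) (cmat (blockD M)) (cmat l) (cmat u)"
proof -
  have M: "M \<in> Sp" using g by (simp add: jacobi_group_def)
  show *: "jacobi_element (cmat (blockA M)) (cmat (blockB M)) (cmat (blockC M)) (cmat (blockD M))
      (cmat l) (cmat u)"
  proof
    show "transpose (cmat (blockA M)) ** cmat (blockC M) = transpose (cmat (blockC M))
        ** cmat (blockA M)"
      using arg_cong[OF Sp_blocks(1)[OF M], of cmat] by (simp only: cmat_mult cmat_transpose)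
    show "transpose (cmat (blockB M)) ** cmat (blockD M) = transpose (cmat (blockD M))
        ** cmat (blockB M)"
      using arg_cong[OF Sp_blocks(2)[OF M], of cmat] by (simp only: cmat_mult cmat_transpose)
    show "transpose (cmat (blockA M)) ** cmat (blockD M) - transpose (cmat (blockC M))
        ** cmat (blockB M) = mat 1"
      using arg_cong[OF Sp_blocks(3)[OF M], of cmat]
      by (simp only: cmat_mult cmat_transpose cmat_diff cmat_mat of_real_1)
  qed simp_all
  then interpret jacobi_element "cmat (blockA M)" "cmat (blockB M)" "cmat (blockC M)" "cmat
      (blockD M)" "cmat l" "cmat u" .
  show "jacobi_act (M, l, u, k) = act"
    by (auto simp: fun_eq_iff jacobi_act_def act_def N_def R_def J_def Let_def)
qed

section \<open>Wirtinger calculus in an adapted frame\<close>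

text \<open>
  Multiplication of a complexified tangent vector by a complex scalar.
\<close>

definition cpoint :: "complex \<Rightarrow> ('n::finite, 'm::finite) point \<Rightarrow> ('n, 'm) point" where
  "cpoint c v = (c *\<^sub>m fst v, c *\<^sub>m snd v)"

lemma cpoint_tangent: "v \<in> tangent_dirs \<Longrightarrow> cpoint c v \<in> tangent_dirs"
  by (cases v) (simp add: cpoint_def tangent_dirs_def transpose_mscale)

lemma cpoint_cpoint: "cpoint c (cpoint d v) = cpoint (c * d) v"
  by (simp add: cpoint_def mscale_mscale)

lemma cpoint_add: "cpoint c (v + w) = cpoint c v + cpoint c w"
  by (simp add: cpoint_def mscale_add)

lemma cpoint_real_imag: "cpoint c v = Re c *\<^sub>R v + Im c *\<^sub>R cpoint \<i> v"
  by (simp add: cpoint_def prod_eq_iff vec_eq_iff complex_eq_iff)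

text \<open>
  The holomorphic Wirtinger derivative in an arbitrary direction; it is complex linear in the
  direction.
\<close>

definition cder :: "('n::finite, 'm::finite) point \<Rightarrow> ('n, 'm) operator" where
  "cder v F p = (dir_deriv v F p - \<i> * dir_deriv (cpoint \<i> v) F p) / 2"

lemma cder_direction_add:
  assumes "smooth F" "p \<in> siegel_jacobi" "v \<in> tangent_dirs" "w \<in> tangent_dirs"
  shows "cder (v + w) F p = cder v F p + cder w F p"
  using assms
  by (simp add: cder_def cpoint_add dir_deriv_direction_add cpoint_tangent field_simps)

lemma cder_direction_cpoint:
  assumes "smooth F" "p \<in> siegel_jacobi" "v \<in> tangent_dirs"
  shows "cder (cpoint c v) F p = c * cder v F p"
proof -
  have lin: "dir_deriv (cpoint d v) F p = of_real (Re d) * dir_deriv v F p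
      + of_real (Im d) * dir_deriv (cpoint \<i> v) F p" for d
    using assms unfolding cpoint_real_imag[of d v]
    by (simp add: dir_deriv_direction_add dir_deriv_direction_scaleR tangent_scaleR cpoint_tangent
        scaleR_conv_of_real)
  have c: "c = of_real (Re c) + \<i> * of_real (Im c)" by (simp add: complex_eq_iff)
  have "cder (cpoint c v) F p = (of_real (Re c) + \<i> * of_real (Im c)) * cder v F p"
    unfolding cder_def cpoint_cpoint lin[of c] lin[of "\<i> * c"]
    by (simp add: algebra_simps)
  then show ?thesis unfolding c[symmetric] .
qed

lemma tangent_zero: "0 \<in> tangent_dirs"
  by (simp add: tangent_dirs_def zero_prod_def)

lemma tangent_sum: "(\<And>i. i \<in> I \<Longrightarrow> v i \<in> tangent_dirs) \<Longrightarrow> (\<Sum>i\<in>I. v i) \<in> tangent_dirs"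
  by (induction I rule: infinite_finite_induct) (auto simp: tangent_zero intro: tangent_add)

lemma cder_direction_sum:
  assumes F: "smooth F" "p \<in> siegel_jacobi" and v: "\<And>i. i \<in> I \<Longrightarrow> v i \<in> tangent_dirs"
  shows "cder (\<Sum>i\<in>I. cpoint (c i) (v i)) F p = (\<Sum>i\<in>I. c i * cder (v i) F p)"
  using v
proof (induction I rule: infinite_finite_induct)
  case (insert i I)
  then have "(\<Sum>i\<in>I. cpoint (c i) (v i)) \<in> tangent_dirs"
    by (intro tangent_sum cpoint_tangent) auto
  with insert show ?case
    by (simp add: cder_direction_add[OF F] cder_direction_cpoint[OF F] cpoint_tangent)
next
  have "cder 0 F p = 0"
    using cder_direction_cpoint[OF F tangent_zero, of 0]
    by (simp add: cpoint_def mscale_def map_matrix_def zero_prod_def vec_eq_iff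
      cong: if_cong) (simp add: zero_vec_def)
  then show "cder (\<Sum>i\<in>{}. cpoint (c i) (v i)) F p = (\<Sum>i\<in>{}. c i * cder (v i) F p)"
    and "infinite A \<Longrightarrow> cder (\<Sum>i\<in>A. cpoint (c i) (v i)) F p = (\<Sum>i\<in>A. c i * cder (v i) F p)" for A
    by auto
qed

lemma cder_add:
  assumes "smooth F" "smooth G" "p \<in> siegel_jacobi" "v \<in> tangent_dirs"
  shows "cder v (\<lambda>q. F q + G q) p = cder v F p + cder v G p"
  using assms by (simp add: cder_def dir_deriv_add cpoint_tangent field_simps)

lemma cder_mult:
  assumes "smooth F" "smooth G" "p \<in> siegel_jacobi" "v \<in> tangent_dirs"
  shows "cder v (\<lambda>q. F q * G q) p = cder v F p * G p + F p * cder v G p"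
  using assms by (simp add: cder_def dir_deriv_mult cpoint_tangent field_simps)

lemma cder_const:
  assumes "p \<in> siegel_jacobi" "v \<in> tangent_dirs"
  shows "cder v (\<lambda>q. c) p = 0"
  using assms by (simp add: cder_def dir_deriv_const cpoint_tangent)

lemma cder_cmult:
  assumes "smooth F" "p \<in> siegel_jacobi" "v \<in> tangent_dirs"
  shows "cder v (\<lambda>q. c * F q) p = c * cder v F p"
  using cder_mult[OF smooth_const assms(1-3), of c] assms by (simp add: cder_const)

lemma cder_sum:
  assumes "\<And>i. i \<in> I \<Longrightarrow> smooth (F i)" "p \<in> siegel_jacobi" "v \<in> tangent_dirs"
  shows "cder v (\<lambda>q. \<Sum>i\<in>I. F i q) p = (\<Sum>i\<in>I. cder v (F i) p)"
  using assms
  by (simp add: cder_def dir_deriv_sum cpoint_tangent sum_subtractf sum_distrib_left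
      sum_divide_distrib
      diff_divide_distrib)

lemma cder_cong:
  assumes "\<And>q. q \<in> siegel_jacobi \<Longrightarrow> F q = G q" "p \<in> siegel_jacobi" "v \<in> tangent_dirs"
  shows "cder v F p = cder v G p"
  using dir_deriv_cong[of F G, OF assms] dir_deriv_cong[of F G, OF assms(1,2) cpoint_tangent[OF
      assms(3)]]
  by (simp add: cder_def)

lemma cder_fst:
  fixes p :: "('n::finite, 'm::finite) point"
  assumes "p \<in> siegel_jacobi" "v \<in> tangent_dirs"
  shows "cder v (\<lambda>q. fst q $ i $ j) p = fst v $ i $ j"
    and "cder v (\<lambda>q. cnj (fst q $ i $ j)) p = 0"
proof -
  have bl: "bounded_linear (\<lambda>q :: ('n, 'm) point. fst q $ i $ j)"
    by (rule bounded_linear_compose[OF bounded_linear_vec_nth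
      bounded_linear_compose[OF bounded_linear_vec_nth bounded_linear_fst]])
  have bl': "bounded_linear (\<lambda>q :: ('n, 'm) point. cnj (fst q $ i $ j))"
    by (rule bounded_linear_compose[OF bounded_linear_cnj bl])
  show "cder v (\<lambda>q. fst q $ i $ j) p = fst v $ i $ j"
    using assms by (simp add: cder_def dir_deriv_of_linear[OF bl] cpoint_tangent) (simp add:
        cpoint_def)
  show "cder v (\<lambda>q. cnj (fst q $ i $ j)) p = 0"
    using assms by (simp add: cder_def dir_deriv_of_linear[OF bl'] cpoint_tangent) (simp add:
        cpoint_def)
qed

text \<open>
  The symmetrised matrix units. The direction \<open>Esym i j\<close> belongs to the \<open>(i, j)\<close> entry of the
  symmetric operator matrix \<open>dZ\<close>, on and off the diagonal.
\<close>

definition Esym :: "'n::finite \<Rightarrow> 'n \<Rightarrow> complex^'n^'n" where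
  "Esym i j = (\<chi> a b. ((if a = i \<and> b = j then 1 else 0) + (if a = j \<and> b = i then 1 else 0)) / 2)"

text \<open>
  The frame adapted to the action: its directions \<open>(S, P S)\<close> with symmetric \<open>S\<close> span the kernel
  of \<open>dW - P dZ\<close>. The derivatives \<open>DZ i j\<close> along it are, up to the factor \<open>2 \<i>\<close>, the entries of
  \<open>Xplus\<close>; \<open>DW k j\<close> is the derivative with respect to the entry \<open>(k, j)\<close> of \<open>W\<close>.
\<close>

definition frame :: "'n \<Rightarrow> 'n \<Rightarrow> ('n::finite, 'm::finite) point \<Rightarrow> ('n, 'm) point" where
  "frame i j p = (Esym i j, slope p ** Esym i j)"

definition DZ :: "'n \<Rightarrow> 'n \<Rightarrow> ('n::finite, 'm::finite) operator" where
  "DZ i j F p = cder (frame i j p) F p"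

definition DW :: "'m \<Rightarrow> 'n \<Rightarrow> ('n::finite, 'm::finite) operator" where
  "DW k j F p = cder (wdir k j 1) F p"

lemma Esym_commute: "Esym i j = Esym j i"
  by (simp add: Esym_def add.commute)

lemma transpose_Esym: "transpose (Esym i j) = Esym i j"
  by (simp add: Esym_def vec_eq_iff add.commute conj_commute)

lemma DZ_commute: "DZ i j F p = DZ j i F p"
  by (simp add: DZ_def frame_def Esym_commute[of i j])

lemma frame_tangent: "frame i j p \<in> tangent_dirs"
  by (simp add: frame_def tangent_dirs_def transpose_Esym)

lemma Esym_mult:
  "Esym i j $ a $ b * x = (if a = i \<and> b = j then x / 2 else 0) + (if a = j \<and> b
      = i then x / 2 else 0)"
proof -
  have "((if P then 1 else 0) + (if Q then 1 else 0)) / 2 * x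
      = (if P then x / 2 else 0) + (if Q then x / 2 else 0)"
    for P Q by simp
  then show ?thesis by (simp only: Esym_def vec_lambda_beta)
qed

lemma sum_if_conj:
  fixes f :: "'a::finite \<Rightarrow> 'b::finite \<Rightarrow> 'c::comm_monoid_add"
  shows "(\<Sum>i\<in>UNIV. \<Sum>j\<in>UNIV. if i = a \<and> j = b then f i j else 0) = f a b"
    and "(\<Sum>i\<in>UNIV. \<Sum>j\<in>UNIV. if a = i \<and> b = j then f i j else 0) = f a b"
    and "(\<Sum>i\<in>UNIV. \<Sum>j\<in>UNIV. if i = a \<and> b = j then f i j else 0) = f a b"
proof -
  have "(\<Sum>j\<in>UNIV. if i = a \<and> j = b then f i j else 0) = (if i = a then f i b else 0)" for i
    by (cases "i = a") simp_all
  then show 1: "(\<Sum>i\<in>UNIV. \<Sum>j\<in>UNIV. if i = a \<and> j = b then f i j else 0) = f a b" by simp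
  show "(\<Sum>i\<in>UNIV. \<Sum>j\<in>UNIV. if a = i \<and> b = j then f i j else 0) = f a b"
    using 1 by (simp only: eq_commute[of a] eq_commute[of b])
  show "(\<Sum>i\<in>UNIV. \<Sum>j\<in>UNIV. if i = a \<and> b = j then f i j else 0) = f a b"
    using 1 by (simp only: eq_commute[of b])
qed

lemma sum_Esym:
  assumes "transpose S = (S :: complex^'n::finite^'n)"
  shows "(\<Sum>i\<in>UNIV. \<Sum>j\<in>UNIV. S $ i $ j *\<^sub>m Esym i j) = S"
proof -
  have S: "S $ b $ a = S $ a $ b" for a b using arg_cong[OF assms, of "\<lambda>M. M $ a $ b"] by simp
  have "(\<Sum>i\<in>UNIV. \<Sum>j\<in>UNIV. S $ i $ j *\<^sub>m Esym i j) $ a $ b = S $ a $ b" for a b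
  proof -
    have "(\<Sum>i\<in>UNIV. \<Sum>j\<in>UNIV. S $ i $ j *\<^sub>m Esym i j) $ a $ b
       = (\<Sum>i\<in>UNIV. \<Sum>j\<in>UNIV. Esym i j $ a $ b * S $ i $ j)"
      unfolding sum_component mscale_componentwise by (simp only: mult.commute)
    also have "\<dots> = (\<Sum>i\<in>UNIV. \<Sum>j\<in>UNIV. (if a = i \<and> b = j then S $ i $ j / 2 else 0))
        + (\<Sum>i\<in>UNIV. \<Sum>j\<in>UNIV. (if b = i \<and> a = j then S $ i $ j / 2 else 0))"
      unfolding Esym_mult sum.distrib by (simp only: conj_commute)
    also have "\<dots> = S $ a $ b / 2 + S $ b $ a / 2" unfolding sum_if_conj ..
    finally show ?thesis by (simp add: S[of a b])
  qed
  then show ?thesis by (simp add: vec_eq_iff)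
qed

lemma mscale_sum_left: "(\<Sum>i\<in>I. X ** (f i)) = X ** (\<Sum>i\<in>I. f i :: complex^'c^'b)"
  by (induction I rule: infinite_finite_induct) (simp_all add: matrix_add_ldistrib)

text \<open>
  The symmetric matrix \<open>S\<close> need not be real; the direction is expanded in the frame at \<open>p\<close>.
\<close>

lemma cder_slope_direction:
  assumes F: "smooth F" and p: "p \<in> siegel_jacobi" and S: "transpose S = S"
  shows "cder (S, slope p ** S) F p = (\<Sum>i\<in>UNIV. \<Sum>j\<in>UNIV. S $ i $ j * DZ i j F p)"
proof -
  let ?s = "\<lambda>(i, j). S $ i $ j" and ?f = "\<lambda>(i, j). frame i j p"
  have "(\<Sum>x\<in>UNIV \<times> UNIV. cpoint (?s x) (?f x))
      = (\<Sum>i\<in>UNIV. \<Sum>j\<in>UNIV. (S $ i $ j *\<^sub>m Esym i j, slope p ** (S $ i $ j *\<^sub>m Esym i j)))"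
    by (simp add: sum.cartesian_product cpoint_def frame_def mscale_mult_right split_def)
  also have "\<dots> = (S, slope p ** S)"
    by (simp add: prod_eq_iff fst_sum snd_sum mscale_sum_left sum_Esym[OF S])
  finally have "cder (S, slope p ** S) F p = (\<Sum>x\<in>UNIV \<times> UNIV. ?s x * cder (?f x) F p)"
    using cder_direction_sum[OF F p, of "UNIV \<times> UNIV" ?f ?s] by (auto simp: frame_tangent)
  also have "\<dots> = (\<Sum>i\<in>UNIV. \<Sum>j\<in>UNIV. S $ i $ j * DZ i j F p)"
    by (simp add: sum.cartesian_product DZ_def split_def)
  finally show ?thesis .
qed

text \<open>
  For a function, \<open>grad\<close> is the symmetric matrix of its derivatives along the frame. For a
  matrix of functions, \<open>divZ\<close> is the product of the operator matrix \<open>DZ\<close> with it, and \<open>divZbar\<close>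
  is the same with antiholomorphic derivatives, obtained by conjugation.
\<close>

definition grad :: "(('n::finite, 'm::finite) point \<Rightarrow> complex) \<Rightarrow> ('n, 'm) point \<Rightarrow> complex^'n^'n"
    where
  "grad F p = (\<chi> i j. DZ i j F p)"

definition divZ :: "(('n::finite, 'm::finite) point \<Rightarrow> complex^'b^'n) \<Rightarrow> ('n, 'm) point \<Rightarrow>
    complex^'b^'n" where
  "divZ f p = (\<chi> a j. \<Sum>k\<in>UNIV. DZ a k (\<lambda>q. f q $ k $ j) p)"

definition divZbar :: "(('n::finite, 'm::finite) point \<Rightarrow> complex^'b^'n) \<Rightarrow> ('n, 'm) point \<Rightarrow>
    complex^'b^'n" where
  "divZbar f p = conj_mat (divZ (\<lambda>q. conj_mat (f q)) p)"

lemma divZ_cong: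
  assumes "\<And>q. q \<in> siegel_jacobi \<Longrightarrow> f q = g q" "p \<in> siegel_jacobi"
  shows "divZ f p = divZ g p"
  unfolding divZ_def DZ_def
  by (simp add: vec_eq_iff) (intro allI sum.cong refl cder_cong, use assms in \<open>auto simp:
      frame_tangent\<close>)

lemma divZbar_cong:
  assumes "\<And>q. q \<in> siegel_jacobi \<Longrightarrow> f q = g q" "p \<in> siegel_jacobi"
  shows "divZbar f p = divZbar g p"
  unfolding divZbar_def by (subst divZ_cong[of _ "\<lambda>q. conj_mat (g q)"]) (use assms in auto)

text \<open>
  The Leibniz rule; in the second summand the left factor is frozen at \<open>p\<close>.
\<close>

lemma divZ_mult:
  assumes f: "smooth_mat f" and h: "smooth_mat h" and p: "p \<in> siegel_jacobi"
  shows "divZ (\<lambda>q. f q ** h q) p = divZ f p ** h p + divZ (\<lambda>q. f p ** h q) p"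
proof -
  note sm = smooth_mat_nth[OF f] smooth_mat_nth[OF h]
  have 1: "DZ a k (\<lambda>q. (f q ** h q) $ k $ j) p
     = (\<Sum>b\<in>UNIV. DZ a k (\<lambda>q. f q $ k $ b) p * h p $ b $ j) + (\<Sum>b\<in>UNIV. f p $ k $ b
         * DZ a k (\<lambda>q. h q $ b $ j) p)" for a k j
    unfolding matrix_mul_componentwise DZ_def
    by (simp add: cder_sum cder_mult sm smooth_mult p frame_tangent sum.distrib)
  have 2: "DZ a k (\<lambda>q. (f p ** h q) $ k $ j) p = (\<Sum>b\<in>UNIV. f p $ k $ b
      * DZ a k (\<lambda>q. h q $ b $ j) p)" for a k j
    unfolding matrix_mul_componentwise DZ_def
    by (simp add: cder_sum cder_cmult sm smooth_mult smooth_const p frame_tangent)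
  have "(\<Sum>k\<in>UNIV. \<Sum>b\<in>UNIV. DZ a k (\<lambda>q. f q $ k $ b) p * h p $ b $ j)
      = (\<Sum>b\<in>UNIV. (\<Sum>k\<in>UNIV. DZ a k (\<lambda>q. f q $ k $ b) p) * h p $ b $ j)" for a j
    unfolding sum_distrib_right by (rule sum.swap)
  then show ?thesis
    unfolding vec_eq_iff vector_add_component matrix_mul_componentwise[of "divZ f p"]
    by (simp add: divZ_def 1 2 sum.distrib)
qed

lemma divZ_add:
  assumes f: "smooth_mat f" and h: "smooth_mat h" and p: "p \<in> siegel_jacobi"
  shows "divZ (\<lambda>q. f q + h q) p = divZ f p + divZ h p"
  using smooth_mat_nth[OF f] smooth_mat_nth[OF h]
  by (simp add: vec_eq_iff divZ_def DZ_def cder_add p frame_tangent sum.distrib)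

lemma divZ_mscale:
  assumes f: "smooth_mat f" and p: "p \<in> siegel_jacobi"
  shows "divZ (\<lambda>q. c *\<^sub>m f q) p = c *\<^sub>m divZ f p"
  using smooth_mat_nth[OF f]
  by (simp add: vec_eq_iff divZ_def DZ_def cder_cmult p frame_tangent sum_distrib_left)

lemma divZ_const: "p \<in> siegel_jacobi \<Longrightarrow> divZ (\<lambda>q. c) p = 0"
  by (simp add: vec_eq_iff divZ_def DZ_def cder_const frame_tangent)

lemma divZ_mult_const:
  assumes "smooth_mat f" "p \<in> siegel_jacobi"
  shows "divZ (\<lambda>q. f q ** c) p = divZ f p ** c"
  using divZ_mult[OF assms(1) smooth_mat_const assms(2), of c] by (simp add: divZ_const assms)

lemma divZ_const_mult_componentwise:
  assumes N: "smooth_mat N" and p: "p \<in> siegel_jacobi"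
  shows "divZ (\<lambda>q. c ** N q) p $ a $ j = (\<Sum>e\<in>UNIV. (grad (\<lambda>q. N q $ e $ j) p ** c) $ a $ e)"
proof -
  have "divZ (\<lambda>q. c ** N q) p $ a $ j = (\<Sum>k\<in>UNIV. \<Sum>e\<in>UNIV. c $ k $ e * DZ a k (\<lambda>q. N q $ e $ j) p)"
    using smooth_mat_nth[OF N]
    by (simp add: divZ_def DZ_def matrix_mul_componentwise cder_sum cder_cmult smooth_mult
        smooth_const p frame_tangent)
  also have "\<dots> = (\<Sum>e\<in>UNIV. \<Sum>k\<in>UNIV. c $ k $ e * DZ a k (\<lambda>q. N q $ e $ j) p)"
    by (rule sum.swap)
  finally show ?thesis by (simp add: matrix_mul_componentwise grad_def mult.commute)
qed

lemma divZ_fst: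
  assumes p: "p \<in> siegel_jacobi"
  shows "divZ (\<lambda>q. c ** fst q) p = (1/2) *\<^sub>m (transpose c + mat (trace c))"
proof -
  have DZ: "DZ a k (\<lambda>q. fst q $ e $ j) p = Esym a k $ e $ j" for a k e j
    unfolding DZ_def cder_fst(1)[OF p frame_tangent] by (simp add: frame_def)
  have "(divZ (\<lambda>q. c ** fst q) p) $ a $ j = ((1/2) *\<^sub>m (transpose c
      + mat (trace c))) $ a $ j" for a j
  proof -
    have "(divZ (\<lambda>q. c ** fst q) p) $ a $ j = (\<Sum>e\<in>UNIV. \<Sum>k\<in>UNIV. Esym a k $ e $ j * c $ k $ e)"
      by (simp add: divZ_const_mult_componentwise smooth_mat_fst p matrix_mul_componentwise
          grad_def DZ)
    also have "\<dots> = (\<Sum>e\<in>UNIV. \<Sum>k\<in>UNIV. (if e = a \<and> j = k then c $ k $ e / 2 else 0))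
        + (\<Sum>e\<in>UNIV. \<Sum>k\<in>UNIV. (if e = k \<and> j = a then c $ k $ e / 2 else 0))"
      unfolding Esym_mult sum.distrib ..
    also have "(\<Sum>e\<in>UNIV. \<Sum>k\<in>UNIV. (if e = k \<and> j = a then c $ k $ e / 2 else 0))
        = mat (trace c) $ a $ j / 2"
      by (cases "j = a") (simp_all add: mat_def trace_def sum_divide_distrib)
    also have "(\<Sum>e\<in>UNIV. \<Sum>k\<in>UNIV. (if e = a \<and> j = k then c $ k $ e / 2 else 0))
        + mat (trace c) $ a $ j / 2
        = ((1/2) *\<^sub>m (transpose c + mat (trace c))) $ a $ j"
      unfolding sum_if_conj by (simp add: add_divide_distrib)
    finally show ?thesis .
  qed
  then show ?thesis by (simp add: vec_eq_iff)
qed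

lemma divZ_conj_fst:
  assumes p: "p \<in> siegel_jacobi"
  shows "divZ (\<lambda>q. c ** conj_mat (fst q)) p = 0"
proof -
  have sm: "smooth_mat (\<lambda>q. conj_mat (fst q))" by (intro smooth_mat_intros)
  show ?thesis
    by (simp add: vec_eq_iff divZ_const_mult_componentwise[OF sm p] matrix_mul_componentwise
        grad_def DZ_def
        cder_fst p frame_tangent)
qed

lemma divZbar_mult:
  assumes "smooth_mat f" "smooth_mat h" "p \<in> siegel_jacobi"
  shows "divZbar (\<lambda>q. f q ** h q) p = divZbar f p ** h p + divZbar (\<lambda>q. f p ** h q) p"
  using divZ_mult[OF smooth_mat_conj[OF assms(1)] smooth_mat_conj[OF assms(2)] assms(3)]
  by (simp add: divZbar_def conj_mat_mult conj_mat_add)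

lemma divZbar_add:
  assumes "smooth_mat f" "smooth_mat h" "p \<in> siegel_jacobi"
  shows "divZbar (\<lambda>q. f q + h q) p = divZbar f p + divZbar h p"
  using divZ_add[OF smooth_mat_conj[OF assms(1)] smooth_mat_conj[OF assms(2)] assms(3)]
  by (simp add: divZbar_def conj_mat_add)

lemma divZbar_mscale:
  assumes "smooth_mat f" "p \<in> siegel_jacobi"
  shows "divZbar (\<lambda>q. c *\<^sub>m f q) p = c *\<^sub>m divZbar f p"
  using divZ_mscale[OF smooth_mat_conj[OF assms(1)] assms(2)]
  by (simp add: divZbar_def conj_mat_mscale)

lemma divZbar_const: "p \<in> siegel_jacobi \<Longrightarrow> divZbar (\<lambda>q. c) p = 0"
  by (simp add: divZbar_def divZ_const vec_eq_iff)

lemma divZbar_mult_const: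
  assumes "smooth_mat f" "p \<in> siegel_jacobi"
  shows "divZbar (\<lambda>q. f q ** c) p = divZbar f p ** c"
  using divZbar_mult[OF assms(1) smooth_mat_const assms(2), of c] by (simp add: divZbar_const assms)

lemma divZbar_fst: "p \<in> siegel_jacobi \<Longrightarrow> divZbar (\<lambda>q. c ** fst q) p = 0"
  using divZ_conj_fst[of p "conj_mat c"] by (simp add: divZbar_def conj_mat_mult vec_eq_iff)

lemma conj_trace: "cnj (trace A) = trace (conj_mat A)"
  by (simp add: trace_def)

lemma divZbar_conj_fst:
  assumes "p \<in> siegel_jacobi"
  shows "divZbar (\<lambda>q. c ** conj_mat (fst q)) p = (1/2) *\<^sub>m (transpose c + mat (trace c))"
  using divZ_fst[OF assms, of "conj_mat c"]
  by (simp add: divZbar_def conj_mat_mult conj_mat_mscale conj_mat_add conj_mat_transpose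
      conj_trace)

context jacobi_element
begin

text \<open>
  The frame is equivariant: the differential of the action maps the frame vector \<open>(S, P S)\<close> at
  \<open>p\<close> to the vector \<open>(S', P' S')\<close> with \<open>S' = R\<^sup>t S R\<close> at the image point.
\<close>

lemma DZ_compose_act:
  assumes F: "smooth F" and p: "p \<in> siegel_jacobi"
  shows "DZ i j (\<lambda>q. F (act q)) p = (\<Sum>a\<in>UNIV. \<Sum>b\<in>UNIV. R p $ i $ a * R p $ j $ b
      * DZ a b F (act p))"
proof -
  let ?d = "\<lambda>h :: ('n, 'm) point. (transpose (R p) ** fst h ** R p, (snd h
      + (l - snd (act p) ** C) ** fst h) ** R p)"
  define S where "S = transpose (R p) ** Esym i j ** R p"
  have "?d (cpoint \<i> v) = cpoint \<i> (?d v)" for v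
    by (simp add: cpoint_def mscale_mult_left mscale_mult_right flip: mscale_add)
  then have 1: "DZ i j (\<lambda>q. F (act q)) p = cder (?d (frame i j p)) F (act p)"
    unfolding DZ_def cder_def
    by (simp only: dir_deriv_compose_act[OF F p frame_tangent] dir_deriv_compose_act[OF F p
        cpoint_tangent[OF frame_tangent]])
  have "snd (?d (frame i j p)) = (slope p + l - snd (act p) ** C) ** Esym i j ** R p"
    by (simp add: frame_def matrix_add_rdistrib matrix_diff_rdistrib)
  also have "\<dots> = slope (act p) ** S"
    unfolding slope_act[OF p, symmetric] S_def by (simp add: matrix_mul_assoc)
  finally have 2: "?d (frame i j p) = (S, slope (act p) ** S)"
    by (simp add: frame_def S_def)
  have S: "transpose S = S" by (simp add: S_def matrix_transpose_mul transpose_Esym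
      matrix_mul_assoc)
  have S': "S $ a $ b = (R p $ i $ a * R p $ j $ b + R p $ j $ a * R p $ i $ b) / 2" for a b
  proof -
    have "S $ a $ b = (\<Sum>x\<in>UNIV. \<Sum>y\<in>UNIV. Esym i j $ x $ y * (R p $ x $ a * R p $ y $ b))"
      by (simp add: S_def matrix_mul_assoc[symmetric] matrix_mul_componentwise sum_distrib_left
          mult_ac)
    also have "\<dots> = R p $ i $ a * R p $ j $ b / 2 + R p $ j $ a * R p $ i $ b / 2"
      unfolding Esym_mult sum.distrib sum_if_conj ..
    finally show ?thesis by (simp only: add_divide_distrib)
  qed
  define D1 where "D1 = (\<Sum>a\<in>UNIV. \<Sum>b\<in>UNIV. R p $ i $ a * R p $ j $ b * DZ a b F (act p))"
  define D2 where "D2 = (\<Sum>a\<in>UNIV. \<Sum>b\<in>UNIV. R p $ j $ a * R p $ i $ b * DZ a b F (act p))"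
  have "D2 = (\<Sum>b\<in>UNIV. \<Sum>a\<in>UNIV. R p $ j $ a * R p $ i $ b * DZ b a F (act p))"
    unfolding D2_def by (subst sum.swap) (simp only: DZ_commute[of _ _ F "act p"])
  then have D: "D2 = D1"
    by (simp only: D1_def mult.commute mult.left_commute)
  have "DZ i j (\<lambda>q. F (act q)) p = (\<Sum>a\<in>UNIV. \<Sum>b\<in>UNIV. S $ a $ b * DZ a b F (act p))"
    unfolding 1 2 by (rule cder_slope_direction[OF F act_siegel_jacobi[OF p] S])
  also have "\<dots> = D1 / 2 + D2 / 2"
    by (simp add: S' D1_def D2_def sum_divide_distrib add_divide_distrib distrib_right sum.distrib)
  also have "\<dots> = D1" by (simp add: D)
  finally show ?thesis by (simp add: D1_def)
qed

lemma grad_compose_act: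
  assumes F: "smooth F" and p: "p \<in> siegel_jacobi"
  shows "grad (\<lambda>q. F (act q)) p = R p ** grad F (act p) ** transpose (R p)"
proof -
  have "grad (\<lambda>q. F (act q)) p $ i $ j = (\<Sum>b\<in>UNIV. \<Sum>a\<in>UNIV. R p $ i $ a * DZ a b F (act p)
      * R p $ j $ b)" for i j
    unfolding grad_def by (simp add: DZ_compose_act[OF F p], subst sum.swap) (simp add: mult_ac)
  then show ?thesis
    by (simp add: vec_eq_iff matrix_mul_componentwise sum_distrib_right grad_def)
qed

lemma divZ_compose_act:
  assumes N: "smooth_mat f" and p: "p \<in> siegel_jacobi"
  shows "divZ (\<lambda>q. c ** f (act q)) p = R p ** divZ (\<lambda>q. transpose (R p) ** c ** f q) (act p)"
proof -
  let ?G = "\<lambda>e j. grad (\<lambda>q. f q $ e $ j) (act p)"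
  have "divZ (\<lambda>q. c ** f (act q)) p $ a $ j = (\<Sum>e\<in>UNIV. (R p ** (?G e j ** (transpose (R p)
      ** c))) $ a $ e)" for a j
    by (simp add: divZ_const_mult_componentwise[OF smooth_mat_compose_act[OF N] p]
        grad_compose_act[OF smooth_mat_nth[OF N] p] matrix_mul_assoc)
  moreover have "(R p ** divZ (\<lambda>q. transpose (R p) ** c ** f q) (act p)) $ a $ j
      = (\<Sum>e\<in>UNIV. (R p ** (?G e j ** (transpose (R p) ** c))) $ a $ e)" for a j
    unfolding matrix_mul_componentwise[of "R p"] divZ_const_mult_componentwise[OF N
        act_siegel_jacobi[OF p]] sum_distrib_left
    by (rule sum.swap)
  ultimately show ?thesis by (simp add: vec_eq_iff)
qed

lemma divZbar_compose_act:
  assumes f: "smooth_mat f" and p: "p \<in> siegel_jacobi"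
  shows "divZbar (\<lambda>q. c ** f (act q)) p
      = conj_mat (R p) ** divZbar (\<lambda>q. transpose (conj_mat (R p)) ** c ** f q) (act p)"
  using divZ_compose_act[OF smooth_mat_conj[OF f] p, of "conj_mat c"]
  by (simp add: divZbar_def conj_mat_mult conj_mat_transpose)

end

section \<open>Evaluation of the operator matrices\<close>

text \<open>The matrix of functions obtained by applying all entries of an operator matrix to one function.\<close>

definition op_eval :: "('n::finite, 'm::finite) operator^'b^'a \<Rightarrow> (('n, 'm) point \<Rightarrow> complex)
    \<Rightarrow> ('n, 'm) point \<Rightarrow> complex^'b^'a" where
  "op_eval A F p = (\<chi> i j. (A $ i $ j) F p)"

lemma op_eval_componentwise [simp]: "op_eval A F p $ i $ j = (A $ i $ j) F p"
  by (simp add: op_eval_def)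

lemma op_eval_add: "op_eval (A \<oplus> B) F p = op_eval A F p + op_eval B F p"
  by (simp add: vec_eq_iff op_add_def)

lemma op_eval_scale: "op_eval (c \<odot> A) F p = c *\<^sub>m op_eval A F p"
  by (simp add: vec_eq_iff op_scale_def)

lemma op_eval_transpose: "op_eval (transpose A) F p = transpose (op_eval A F p)"
  by (simp add: vec_eq_iff)

lemma op_eval_fun_mult: "op_eval (op_fun M \<otimes> A) F p = M p ** op_eval A F p"
  by (simp add: vec_eq_iff op_mult_def op_fun_def matrix_mul_componentwise)

lemma op_eval_fun_fun_mult: "op_eval (op_fun M \<otimes> op_fun N \<otimes> A) F p = (M p ** N p) ** op_eval A F p"
  by (simp add: vec_eq_iff op_mult_def op_fun_def matrix_mul_componentwise mult.assoc
      sum_distrib_right)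

lemma op_eval_mult: "op_eval (A \<otimes> B) F p $ i $ j = (\<Sum>k\<in>UNIV. (A $ i $ k) (\<lambda>q. op_eval B F q $ k $
    j) p)"
  by (simp add: op_mult_def)

lemma diff_opmat_nth: "diff_opmat A \<Longrightarrow> diff_operator (A $ i $ j)"
  by (simp add: diff_opmat_def)

lemma smooth_mat_op_eval: "diff_opmat A \<Longrightarrow> smooth F \<Longrightarrow> smooth_mat (op_eval A F)"
  by (simp add: smooth_mat_def diff_opmat_def smooth_diff_operator)

lemma foldr_dir_deriv_sum:
  assumes "\<And>i. i \<in> I \<Longrightarrow> smooth (F i)" "vs \<in> lists tangent_dirs" "p \<in> siegel_jacobi"
  shows "foldr dir_deriv vs (\<lambda>q. \<Sum>i\<in>I. F i q) p = (\<Sum>i\<in>I. foldr dir_deriv vs (F i) p)"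
  using assms(2,3)
proof (induction vs arbitrary: p)
  case (Cons v vs)
  then have v: "v \<in> tangent_dirs" "vs \<in> lists tangent_dirs" and p: "p \<in> siegel_jacobi" by auto
  have "dir_deriv v (foldr dir_deriv vs (\<lambda>q. \<Sum>i\<in>I. F i q)) p
      = dir_deriv v (\<lambda>q. \<Sum>i\<in>I. foldr dir_deriv vs (F i) q) p"
    by (rule dir_deriv_cong) (use Cons v in auto)
  also have "\<dots> = (\<Sum>i\<in>I. dir_deriv v (foldr dir_deriv vs (F i)) p)"
    by (rule dir_deriv_sum[OF smooth_foldr_dir_deriv[OF assms(1) v(2)] p v(1)])
  finally show ?case by simp
qed simp

lemma diff_operator_apply_sum:
  assumes P: "diff_operator P" and F: "\<And>i. i \<in> I \<Longrightarrow> smooth (F i)" and p: "p \<in> siegel_jacobi"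
  shows "P (\<lambda>q. \<Sum>i\<in>I. F i q) p = (\<Sum>i\<in>I. P (F i) p)"
proof -
  obtain S a where S: "finite S" "S \<subseteq> lists tangent_dirs" "\<forall>vs\<in>S. smooth (a vs)"
    "\<forall>F. smooth F \<longrightarrow> (\<forall>p\<in>siegel_jacobi. P F p = (\<Sum>vs\<in>S. a vs p * foldr dir_deriv vs F p))"
    using P unfolding diff_operator_def by blast
  have "P (\<lambda>q. \<Sum>i\<in>I. F i q) p = (\<Sum>vs\<in>S. a vs p * foldr dir_deriv vs (\<lambda>q. \<Sum>i\<in>I. F i q) p)"
    using S(4) smooth_sum[of I F] F p by blast
  also have "\<dots> = (\<Sum>vs\<in>S. \<Sum>i\<in>I. a vs p * foldr dir_deriv vs (F i) p)"
    using S(2) F p by (intro sum.cong refl) (simp add: foldr_dir_deriv_sum subsetD sum_distrib_left)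
  also have "\<dots> = (\<Sum>i\<in>I. \<Sum>vs\<in>S. a vs p * foldr dir_deriv vs (F i) p)"
    by (rule sum.swap)
  also have "\<dots> = (\<Sum>i\<in>I. P (F i) p)"
    using S(4) F p by (intro sum.cong refl) simp
  finally show ?thesis .
qed

lemma diff_operator_apply_cong:
  assumes P: "diff_operator P" and F: "smooth F" and eq: "\<And>q. q \<in> siegel_jacobi \<Longrightarrow> F q = G q"
    and p: "p \<in> siegel_jacobi"
  shows "P F p = P G p"
proof -
  obtain S a where S: "finite S" "S \<subseteq> lists tangent_dirs" "\<forall>vs\<in>S. smooth (a vs)"
    "\<forall>F. smooth F \<longrightarrow> (\<forall>p\<in>siegel_jacobi. P F p = (\<Sum>vs\<in>S. a vs p * foldr dir_deriv vs F p))"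
    using P unfolding diff_operator_def by blast
  have "foldr dir_deriv vs F q = foldr dir_deriv vs G q"
    if "vs \<in> lists tangent_dirs" "q \<in> siegel_jacobi" for vs q
    using that
  proof (induction vs arbitrary: q)
    case (Cons v vs)
    then show ?case using dir_deriv_cong[of "foldr dir_deriv vs F" "foldr dir_deriv vs G" q v]
        by simp
  qed (simp add: eq)
  moreover have "smooth G" by (rule smooth_cong[OF F eq])
  ultimately show ?thesis using S F p by (simp add: subsetD)
qed

text \<open>
  The product of operator matrices is associative because differential operators are additive;
  the associated products occur in the recursion and in the traces.
\<close>

lemma op_eval_mult_assoc:
  assumes A: "diff_opmat A" and B: "diff_opmat B" and C: "diff_opmat C" and F: "smooth F"
      and p: "p \<in> siegel_jacobi"
  shows "op_eval (A \<otimes> B \<otimes> C) F p = op_eval (A \<otimes> (B \<otimes> C)) F p"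
proof -
  have "op_eval (A \<otimes> B \<otimes> C) F p $ i $ j = op_eval (A \<otimes> (B \<otimes> C)) F p $ i $ j" for i j
  proof -
    have "op_eval (A \<otimes> B \<otimes> C) F p $ i $ j = (\<Sum>k\<in>UNIV. \<Sum>r\<in>UNIV. (A $ i $ r) ((B $ r $ k) ((C $ k $
        j) F)) p)"
      by (simp add: op_mult_def)
    also have "\<dots> = (\<Sum>r\<in>UNIV. \<Sum>k\<in>UNIV. (A $ i $ r) ((B $ r $ k) ((C $ k $ j) F)) p)"
      by (rule sum.swap)
    also have "\<dots> = (\<Sum>r\<in>UNIV. (A $ i $ r) (\<lambda>q. \<Sum>k\<in>UNIV. (B $ r $ k) ((C $ k $ j) F) q) p)"
      by (intro sum.cong refl, rule diff_operator_apply_sum[symmetric])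
        (use A B C F p in \<open>simp_all add: diff_opmat_def smooth_diff_operator\<close>)
    finally show ?thesis by (simp add: op_mult_def)
  qed
  then show ?thesis by (simp add: vec_eq_iff)
qed

lemma transpose_Ymat: "p \<in> siegel_jacobi \<Longrightarrow> transpose (Ymat p) = Ymat p"
  unfolding Ymat_def cmat_transpose[symmetric] by (simp add: siegel_jacobi_iff pos_def_def)

lemma transpose_slope: "p \<in> siegel_jacobi \<Longrightarrow> transpose (slope p) = Yinv p ** Vtr p"
  by (simp add: slope_def matrix_transpose_mul Yinv_def transpose_matrix_inv invertible_Ymat
      transpose_Ymat)

lemma transpose_ZmZbar_inv: "p \<in> siegel_jacobi \<Longrightarrow> transpose (ZmZbar_inv p) = ZmZbar_inv p"
  by (simp add: ZmZbar_inv_def transpose_matrix_inv invertible_ZmZbar transpose_ZmZbar)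

lemma wirtinger_bar_cnj:
  assumes "smooth F" "p \<in> siegel_jacobi" "\<And>c. d c \<in> tangent_dirs"
  shows "wirtinger_bar d F p = cnj (wirtinger d (\<lambda>q. cnj (F q)) p)"
  using assms by (simp add: wirtinger_bar_def wirtinger_def dir_deriv_bounded_linear[OF
      bounded_linear_cnj])

lemma cpoint_wdir: "cpoint c (wdir i j 1) = wdir i j c"
  by (simp add: cpoint_def wdir_def vec_eq_iff axis_def)

lemma op_eval_dW: "op_eval dW F p = (\<chi> j k. DW k j F p)"
  by (simp add: vec_eq_iff dW_def DW_def wirtinger_def cder_def cpoint_wdir)

lemma op_eval_dZ:
  fixes F :: "('n::finite, 'm::finite) point \<Rightarrow> complex"
  assumes F: "smooth F" and p: "p \<in> siegel_jacobi"
  shows "op_eval dZ F p = (\<chi> i j. cder (Esym i j, 0) F p)"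
proof -
  have c: "cpoint c (zdir i j 1 :: ('n, 'm) point) = zdir i j c" for i j c
    by (simp add: cpoint_def zdir_def vec_eq_iff axis_def)
  have "(dZ $ i $ j) F p = cder (Esym i j, 0) F p" for i j
  proof (cases "i = j")
    case True
    have E: "(zdir i i 1 :: ('n, 'm) point) = (Esym i i, 0)"
      by (simp add: zdir_def Esym_def vec_eq_iff axis_def)
    have "(dZ $ i $ i) F p = cder (zdir i i 1) F p"
      by (simp add: dZ_def cder_def c wirtinger_def)
    with E True show ?thesis by simp
  next
    case False
    have "axis i (axis j (1::complex)) $ a $ b + axis j (axis i 1) $ a $ b
        = 2 * Esym i j $ a $ b" for a b
    proof -
      have ax: "axis i (axis j (1::complex)) $ a $ b = (if a = i \<and> b = j then 1 else 0)" for i j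
        by (cases "a = i") (simp_all add: axis_def)
      have half: "x = 2 * (x / 2)" for x :: complex by simp
      show ?thesis unfolding Esym_def vec_lambda_beta ax by (rule half)
    qed
    then have E: "(zdir i j 1 :: ('n, 'm) point) = cpoint 2 (Esym i j, 0)"
      using False by (simp add: zdir_def cpoint_def vec_eq_iff)
    have "(dZ $ i $ j) F p = 1/2 * cder (zdir i j 1) F p"
      using False by (simp add: dZ_def cder_def c wirtinger_def)
    also have "\<dots> = cder (Esym i j, 0) F p"
      unfolding E by (subst cder_direction_cpoint[OF F p]) (simp_all add: tangent_dirs_def
          transpose_Esym)
    finally show ?thesis .
  qed
  then show ?thesis by (simp add: vec_eq_iff)
qed

lemma op_eval_dWbar:
  assumes "smooth F" "p \<in> siegel_jacobi"
  shows "op_eval dWbar F p = conj_mat (op_eval dW (\<lambda>q. cnj (F q)) p)"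
  using assms by (simp add: vec_eq_iff dWbar_def dW_def wirtinger_bar_cnj wdir_tangent)

lemma op_eval_dZbar:
  assumes "smooth F" "p \<in> siegel_jacobi"
  shows "op_eval dZbar F p = conj_mat (op_eval dZ (\<lambda>q. cnj (F q)) p)"
  using assms by (simp add: vec_eq_iff dZbar_def dZ_def wirtinger_bar_cnj zdir_tangent)

lemma frame_eq:
  fixes p :: "('n::finite, 'm::finite) point"
  shows "frame i j p = (Esym i j, 0) + (\<Sum>k\<in>UNIV. cpoint (slope p $ k $ i / 2) (wdir k j 1))
      + (\<Sum>k\<in>UNIV. cpoint (slope p $ k $ j / 2) (wdir k i 1))"
proof -
  have w: "(\<Sum>k\<in>UNIV. cpoint (c k) (wdir k j 1)) = (0, \<chi> k b. if b = j then c k else (0 :: complex))"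
    for c :: "'m \<Rightarrow> complex" and j :: 'n
  proof -
    have "snd (\<Sum>k\<in>(UNIV :: 'm set). cpoint (c k) (wdir k j 1)) $ k' $ b = (if b
        = j then c k' else 0 :: complex)" for k' b
    proof -
      have "snd (\<Sum>k\<in>(UNIV :: 'm set). cpoint (c k) (wdir k j 1)) $ k' $ b
        = (\<Sum>k\<in>(UNIV :: 'm set). if k' = k then (if b = j then c k else 0) else 0)"
        unfolding cpoint_wdir snd_sum sum_component
        by (intro sum.cong refl) (simp add: wdir_def axis_def)
      then show ?thesis by simp
    qed
    moreover have "fst (\<Sum>k\<in>(UNIV :: 'm set). cpoint (c k) (wdir k j 1)) = (0 :: complex^'n^'n)"
      unfolding cpoint_wdir fst_sum by (simp add: wdir_def)
    ultimately show ?thesis by (simp add: prod_eq_iff vec_eq_iff)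
  qed
  have "(slope p ** Esym i j) $ k $ b = (if b = j then slope p $ k $ i / 2 else 0) + (if b
      = i then slope p $ k $ j / 2 else 0)" for k b
  proof -
    have "(slope p ** Esym i j) $ k $ b = (\<Sum>a\<in>UNIV. Esym i j $ a $ b * slope p $ k $ a)"
      by (simp add: matrix_mul_componentwise mult.commute)
    also have "\<dots> = (\<Sum>a\<in>UNIV. if a = i \<and> b = j then slope p $ k $ a / 2 else 0)
        + (\<Sum>a\<in>UNIV. if a = j \<and> b = i then slope p $ k $ a / 2 else 0)"
      unfolding Esym_mult sum.distrib ..
    also have "(\<Sum>a\<in>UNIV. if a = i \<and> b = j then slope p $ k $ a / 2 else 0) = (if b
        = j then slope p $ k $ i / 2 else 0)" for i j
      by (cases "b = j") simp_all
    also have "(\<Sum>a\<in>UNIV. if a = j \<and> b = i then slope p $ k $ a / 2 else 0) = (if b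
        = i then slope p $ k $ j / 2 else 0)" for i j
      by (cases "b = i") simp_all
    finally show ?thesis .
  qed
  then show ?thesis unfolding w by (simp add: frame_def vec_eq_iff)
qed

text \<open>
  Along the frame the fibre derivatives enter through \<open>P\<^sup>t = Y\<inverse> V\<^sup>t\<close>, symmetrised.
\<close>

lemma grad_eq:
  fixes F :: "('n::finite, 'm::finite) point \<Rightarrow> complex"
  assumes F: "smooth F" and p: "p \<in> siegel_jacobi"
  shows "grad F p = op_eval dZ F p + (1/2) *\<^sub>m (transpose (slope p) ** transpose (op_eval dW F p)
      + transpose (transpose (slope p) ** transpose (op_eval dW F p)))"
proof -
  have w: "(\<Sum>k\<in>UNIV. cpoint (c k) (wdir k j 1)) \<in> tangent_dirs"
    "cder (\<Sum>k\<in>UNIV. cpoint (c k) (wdir k j 1)) F p = (\<Sum>k\<in>UNIV. c k * DW k j F p)" for c j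
    using cder_direction_sum[OF F p, of UNIV "\<lambda>k. wdir k j 1" c]
    by (auto simp: wdir_tangent DW_def intro!: tangent_sum cpoint_tangent)
  have E: "((Esym i j, 0) :: ('n, 'm) point) \<in> tangent_dirs" for i j
      by (simp add: tangent_dirs_def transpose_Esym)
  have "DZ i j F p = cder (Esym i j, 0) F p + (\<Sum>k\<in>UNIV. slope p $ k $ i / 2 * DW k j F p)
      + (\<Sum>k\<in>UNIV. slope p $ k $ j / 2 * DW k i F p)" for i j
    unfolding DZ_def frame_eq
    by (simp add: cder_direction_add[OF F p] w E tangent_add)
  then show ?thesis
    by (simp add: vec_eq_iff grad_def op_eval_dZ[OF F p] op_eval_dW matrix_mul_componentwise
        sum_divide_distrib
        add_divide_distrib)
qed

text \<open>
  The antiholomorphic counterpart of \<open>grad\<close>.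
\<close>

definition gradbar :: "(('n::finite, 'm::finite) point \<Rightarrow> complex) \<Rightarrow> ('n, 'm) point \<Rightarrow>
    complex^'n^'n" where
  "gradbar F p = conj_mat (grad (\<lambda>q. cnj (F q)) p)"

lemma transpose_grad: "transpose (grad F p) = grad F p"
  by (simp add: vec_eq_iff grad_def DZ_commute[of _ _ F])

lemma transpose_gradbar: "transpose (gradbar F p) = gradbar F p"
  by (simp add: gradbar_def transpose_grad conj_mat_transpose[symmetric])

lemma op_eval_Xplus:
  assumes F: "smooth F" and p: "p \<in> siegel_jacobi"
  shows "op_eval Xplus F p = (2 * \<i>) *\<^sub>m grad F p"
  by (simp add: Xplus_def op_eval_add op_eval_scale op_eval_transpose op_eval_fun_fun_mult
      grad_eq[OF F p]
      transpose_slope[OF p] mscale_add mscale_mscale transpose_mscale add.assoc)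

lemma op_eval_cnj_Xplus:
  assumes F: "smooth F" and p: "p \<in> siegel_jacobi"
  shows "op_eval (op_cnj Xplus) F p = (- 2 * \<i>) *\<^sub>m gradbar F p"
proof -
  have "op_eval (op_cnj Xplus) F p = conj_mat (op_eval Xplus (\<lambda>q. cnj (F q)) p)"
    by (simp add: vec_eq_iff op_cnj_def)
  then show ?thesis
    by (simp add: op_eval_Xplus smooth_cnj F p conj_mat_mscale gradbar_def)
qed

lemma op_eval_Xminus:
  assumes F: "smooth F" and p: "p \<in> siegel_jacobi"
  shows "op_eval Xminus F p = (- 2 * \<i>) *\<^sub>m (Ymat p ** gradbar F p ** Ymat p)"
  by (simp add: Xminus_def op_eval_fun_mult op_eval_transpose op_eval_cnj_Xplus[OF F p]
      matrix_transpose_mul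
      transpose_mscale transpose_gradbar transpose_Ymat[OF p] mscale_mult_left mscale_mult_right
          matrix_mul_assoc)

lemma op_eval_Kop:
  assumes F: "smooth F" and p: "p \<in> siegel_jacobi"
  shows "op_eval Kop F p = ZmZbar p ** grad F p"
  by (simp add: Kop_def op_eval_fun_mult op_eval_Xplus[OF F p] ZmZbar_eq mscale_mult_left
      mscale_mult_right)

lemma op_eval_Lambda:
  assumes F: "smooth F" and p: "p \<in> siegel_jacobi"
  shows "op_eval Lambda F p = ZmZbar p ** gradbar F p"
proof -
  define X where "X = transpose (slope p) ** transpose (op_eval dWbar F p)"
  have "conj_mat (transpose (slope p)) = transpose (slope p)"
    by (simp add: conj_mat_transpose slope_real[OF p])
  then have "gradbar F p = op_eval dZbar F p + (1/2) *\<^sub>m (X + transpose X)"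
    by (simp add: gradbar_def grad_eq[OF smooth_cnj[OF F] p] op_eval_dZbar[OF F p]
        op_eval_dWbar[OF F p] X_def
        conj_mat_add conj_mat_mscale conj_mat_mult conj_mat_transpose)
  moreover have "Ymat p ** X = Vtr p ** transpose (op_eval dWbar F p)"
    by (simp add: X_def transpose_slope[OF p] matrix_mul_assoc Yinv_def matrix_inv_right
        invertible_Ymat[OF p])
  ultimately show ?thesis
    by (simp add: Lambda_def op_eval_add op_eval_scale op_eval_fun_mult op_eval_transpose
        op_eval_fun_fun_mult
        ZmZbar_eq X_def transpose_slope[OF p] matrix_add_ldistrib mscale_mult_left
            mscale_mult_right mscale_add
        mscale_mscale add.assoc)
qed

lemma smooth_DZ:
  assumes "smooth F"
  shows "smooth (DZ i j F)"
proof (rule smooth_cong)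
  show "smooth (\<lambda>p. 1 / (2 * \<i>) * (Xplus $ i $ j) F p)"
    by (rule smooth_mult[OF smooth_const smooth_diff_operator[OF diff_opmat_nth[OF
        diff_opmat_Xplus] assms]])
  show "1 / (2 * \<i>) * (Xplus $ i $ j) F q = DZ i j F q" if "q \<in> siegel_jacobi" for q
    using arg_cong[OF op_eval_Xplus[OF assms that], of "\<lambda>M. M $ i $ j"] by (simp add: grad_def)
qed

lemma smooth_mat_divZ [smooth_mat_intros]:
  assumes "smooth_mat f" shows "smooth_mat (divZ f)"
  unfolding smooth_mat_def divZ_def vec_lambda_beta
  by (intro allI smooth_sum smooth_DZ smooth_mat_nth assms)

lemma smooth_mat_divZbar [smooth_mat_intros]:
  assumes "smooth_mat f" shows "smooth_mat (divZbar f)"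
  unfolding divZbar_def[abs_def] by (intro smooth_mat_intros assms)

lemma divZ_mat:
  assumes "p \<in> siegel_jacobi" 
  shows "divZ (\<lambda>q. mat (F q)) p = grad F p"
proof -
  have "(\<Sum>k\<in>UNIV. DZ a k (\<lambda>q. mat (F q) $ k $ j) p) = (\<Sum>k\<in>UNIV. if k
      = j then DZ a k F p else 0)" for a j
    using assms by (intro sum.cong refl) (simp add: mat_def DZ_def cder_const frame_tangent)
  then show ?thesis by (simp add: divZ_def grad_def vec_eq_iff)
qed

lemma divZbar_mat:
  assumes "p \<in> siegel_jacobi" 
  shows "divZbar (\<lambda>q. mat (F q)) p = gradbar F p"
  using divZ_mat[OF assms, of "\<lambda>q. cnj (F q)"] by (simp add: divZbar_def gradbar_def)

lemma divZbar_componentwise: "divZbar f p $ a $ j = (\<Sum>k\<in>UNIV. gradbar (\<lambda>q. f q $ k $ j) p $ a $ k)"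
  by (simp add: divZbar_def divZ_def gradbar_def grad_def)

text \<open>
  The operators \<open>Kop\<close> and \<open>Lambda\<close>, extended to act on matrices of functions.
\<close>

definition KK :: "(('n::finite, 'm::finite) point \<Rightarrow> complex^'b^'n) \<Rightarrow> ('n, 'm) point \<Rightarrow>
    complex^'b^'n" where
  "KK f p = ZmZbar p ** divZ f p"

definition LL :: "(('n::finite, 'm::finite) point \<Rightarrow> complex^'b^'n) \<Rightarrow> ('n, 'm) point \<Rightarrow>
    complex^'b^'n" where
  "LL f p = ZmZbar p ** divZbar f p"

lemma smooth_mat_KK [smooth_mat_intros]: "smooth_mat f \<Longrightarrow> smooth_mat (KK f)"
  unfolding KK_def[abs_def] by (intro smooth_mat_intros)

lemma smooth_mat_LL [smooth_mat_intros]: "smooth_mat f \<Longrightarrow> smooth_mat (LL f)"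
  unfolding LL_def[abs_def] by (intro smooth_mat_intros)

lemma op_eval_Kop_mult:
  assumes B: "diff_opmat B" and F: "smooth F" and p: "p \<in> siegel_jacobi"
  shows "op_eval (Kop \<otimes> B) F p = KK (op_eval B F) p"
proof -
  have K: "(Kop $ i $ k) (\<lambda>q. op_eval B F q $ k $ j) p = (\<Sum>a\<in>UNIV. ZmZbar p $ i $ a
      * DZ a k (\<lambda>q. op_eval B F q $ k $ j) p)" for i j k
    using arg_cong[OF op_eval_Kop[OF smooth_mat_nth[OF smooth_mat_op_eval[OF B F]] p], of "\<lambda>M. M $
        i $ k"]
    by (simp add: matrix_mul_componentwise grad_def)
  have "op_eval (Kop \<otimes> B) F p $ i $ j = KK (op_eval B F) p $ i $ j" for i j
    unfolding op_eval_mult K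
    by (subst sum.swap) (simp add: KK_def matrix_mul_componentwise divZ_def sum_distrib_left)
  then show ?thesis by (simp only: vec_eq_iff simp_thms)
qed

lemma op_eval_Lambda_mult:
  assumes B: "diff_opmat B" and F: "smooth F" and p: "p \<in> siegel_jacobi"
  shows "op_eval (Lambda \<otimes> B) F p = LL (op_eval B F) p"
proof -
  have K: "(Lambda $ i $ k) (\<lambda>q. op_eval B F q $ k $ j) p
      = (\<Sum>a\<in>UNIV. ZmZbar p $ i $ a * gradbar (\<lambda>q. op_eval B F q $ k $ j) p $ a $ k)" for i j k
    using arg_cong[OF op_eval_Lambda[OF smooth_mat_nth[OF smooth_mat_op_eval[OF B F]] p], of "\<lambda>M.
        M $ i $ k"]
    by (simp add: matrix_mul_componentwise)
  have "op_eval (Lambda \<otimes> B) F p $ i $ j = LL (op_eval B F) p $ i $ j" for i j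
    unfolding op_eval_mult K
    by (subst sum.swap) (simp add: LL_def matrix_mul_componentwise divZbar_componentwise
        sum_distrib_left)
  then show ?thesis by (simp only: vec_eq_iff simp_thms)
qed

lemma LL_cong:
  "(\<And>q. q \<in> siegel_jacobi \<Longrightarrow> f q = g q) \<Longrightarrow> p \<in> siegel_jacobi \<Longrightarrow> LL f p = LL g p"
  unfolding LL_def by (simp add: divZbar_cong[of f g])

lemma KK_cong:
  "(\<And>q. q \<in> siegel_jacobi \<Longrightarrow> f q = g q) \<Longrightarrow> p \<in> siegel_jacobi \<Longrightarrow> KK f p = KK g p"
  unfolding KK_def by (simp add: divZ_cong[of f g])

text \<open>
  The constant \<open>(n + 1) / 2\<close> of the recursion.
\<close>

definition maass_const :: "'n::finite itself \<Rightarrow> complex" where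
  "maass_const _ = (of_nat CARD('n) + 1) / 2"

lemma op_eval_A_one:
  fixes F :: "('n::finite, 'm::finite) point \<Rightarrow> complex"
  assumes F: "smooth F" and p: "p \<in> siegel_jacobi"
  shows "op_eval A_one F p = LL (KK (\<lambda>q. mat (F q))) p + maass_const TYPE('n) *\<^sub>m KK (\<lambda>q. mat (F
      q)) p"
proof -
  have K: "op_eval Kop F q = KK (\<lambda>q. mat (F q)) q" if "q \<in> siegel_jacobi" for q
    using that by (simp add: op_eval_Kop[OF F] KK_def divZ_mat)
  show ?thesis
    by (simp add: A_one_def op_eval_add op_eval_scale op_eval_Lambda_mult[OF diff_opmat_Kop F p] K
        p maass_const_def
        LL_cong[OF K])
qed

lemma op_eval_mult_add: "op_eval ((A \<oplus> B) \<otimes> C) F p = op_eval (A \<otimes> C) F p + op_eval (B \<otimes> C) F p"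
  by (simp add: vec_eq_iff op_mult_def op_add_def sum.distrib)

lemma op_eval_mult_scale: "op_eval ((c \<odot> A) \<otimes> B) F p = c *\<^sub>m op_eval (A \<otimes> B) F p"
  by (simp add: vec_eq_iff op_mult_def op_scale_def sum_distrib_left)

lemma op_eval_A_one_mult:
  fixes B :: "('n::finite, 'm::finite) operator^'b^'n"
  assumes B: "diff_opmat B" and F: "smooth F" and p: "p \<in> siegel_jacobi"
  shows "op_eval (A_one \<otimes> B) F p
    = LL (KK (op_eval B F)) p + maass_const TYPE('n) *\<^sub>m KK (op_eval B F) p"
proof -
  have "op_eval (Lambda \<otimes> Kop \<otimes> B) F p = LL (op_eval (Kop \<otimes> B) F) p"
    by (simp add: op_eval_mult_assoc op_eval_Lambda_mult diff_opmat_intros B F p)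
  also have "\<dots> = LL (KK (op_eval B F)) p"
    by (rule LL_cong) (simp_all add: op_eval_Kop_mult B F p)
  finally show ?thesis
    by (simp add: A_one_def op_eval_mult_add op_eval_mult_scale op_eval_Kop_mult[OF B F p]
        maass_const_def)
qed

text \<open>
  One step of the recursion as a map on matrices of functions. In the last summand the operator
  \<open>Lambda\<close> acts on the rows of \<open>f\<close>; since its coefficients are not differentiated, this is a
  divergence of \<open>(Z - conj Z) f\<^sup>t\<close> in which the first factor is frozen at \<open>p\<close>.
\<close>

definition maass_step :: "(('n::finite, 'm::finite) point \<Rightarrow> complex^'n^'n) \<Rightarrow> ('n, 'm) point \<Rightarrow>
    complex^'n^'n" where
  "maass_step f p = LL (KK f) p + maass_const TYPE('n) *\<^sub>m KK f p - maass_const TYPE('n) *\<^sub>m LL f p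
     + (1/2) *\<^sub>m LL (\<lambda>q. mat (trace (f q))) p
     + (1/2) *\<^sub>m (ZmZbar p ** divZbar (\<lambda>q. ZmZbar p ** transpose (f q)) p ** ZmZbar_inv p)"

lemma op_eval_A_step:
  fixes A :: "('n::finite, 'm::finite) operator^'n^'n"
  assumes A: "diff_opmat A" and F: "smooth F" and p: "p \<in> siegel_jacobi"
  shows "op_eval (A_step A) F p = maass_step (op_eval A F) p"
proof -
  define f where "f = op_eval A F"
  have f: "smooth_mat f" unfolding f_def by (rule smooth_mat_op_eval[OF A F])
  have tr: "op_trace A F = (\<lambda>q. trace (f q))"
    by (simp add: fun_eq_iff op_trace_def trace_def f_def)
  have "op_eval (op_rmult Lambda (op_trace A)) F p = op_eval Lambda (op_trace A F) p"
    by (simp add: vec_eq_iff op_rmult_def)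
  also have "\<dots> = LL (\<lambda>q. mat (trace (f q))) p"
    unfolding tr by (simp add: op_eval_Lambda smooth_trace f p LL_def divZbar_mat)
  finally have 1: "op_eval (op_rmult Lambda (op_trace A)) F p = LL (\<lambda>q. mat (trace (f q))) p" .
  have "op_eval (transpose Lambda \<otimes> transpose A) F p $ i $ j
      = divZbar (\<lambda>q. ZmZbar p ** transpose (f q)) p $ i $ j" for i j
  proof -
    have L: "(Lambda $ k $ i) (\<lambda>q. f q $ j $ k) p = (\<Sum>a\<in>UNIV. ZmZbar p $ k $ a
        * gradbar (\<lambda>q. f q $ j $ k) p $ a $ i)" for k
      using arg_cong[OF op_eval_Lambda[OF smooth_mat_nth[OF f] p], of "\<lambda>M. M $ k $ i"]
      by (simp add: matrix_mul_componentwise)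
    have Zs: "ZmZbar p $ k $ a = ZmZbar p $ a $ k" for a k
      using arg_cong[OF transpose_ZmZbar[OF p], of "\<lambda>M. M $ a $ k"] by simp
    have gs: "gradbar G p $ a $ i = gradbar G p $ i $ a" for G a
      using arg_cong[OF transpose_gradbar[of G p], of "\<lambda>M. M $ i $ a"] by simp
    have "divZbar (\<lambda>q. ZmZbar p ** transpose (f q)) p $ i $ j
        = cnj (\<Sum>e\<in>UNIV. (grad (\<lambda>q. cnj (f q $ j $ e)) p ** conj_mat (ZmZbar p)) $ i $ e)"
      using divZ_const_mult_componentwise[OF smooth_mat_conj[OF smooth_mat_transpose[OF f]] p, of
          "conj_mat (ZmZbar p)" i j]
      by (simp add: divZbar_def conj_mat_mult)
    also have "\<dots> = (\<Sum>e\<in>UNIV. \<Sum>a\<in>UNIV. ZmZbar p $ a $ e * gradbar (\<lambda>q. f q $ j $ e) p $ i $ a)"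
      by (simp add: matrix_mul_componentwise gradbar_def mult.commute)
    also have "\<dots> = (\<Sum>e\<in>UNIV. \<Sum>a\<in>UNIV. ZmZbar p $ e $ a * gradbar (\<lambda>q. f q $ j $ e) p $ a $ i)"
      by (intro sum.cong refl) (simp only: Zs[of _ e for e] gs)
    also have "\<dots> = op_eval (transpose Lambda \<otimes> transpose A) F p $ i $ j"
      by (simp add: op_mult_def L[unfolded f_def op_eval_componentwise, symmetric] f_def)
    finally show ?thesis ..
  qed
  then have 2: "op_eval (transpose Lambda \<otimes> transpose A) F p
      = divZbar (\<lambda>q. ZmZbar p ** transpose (f q)) p"
    by (simp only: vec_eq_iff simp_thms)
  show ?thesis
    by (simp add: A_step_def maass_step_def op_eval_add op_eval_scale op_eval_A_one_mult[OF A F p]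
        op_eval_Lambda_mult[OF A F p] 1 op_eval_fun_mult op_eval_transpose 2 matrix_transpose_mul
        transpose_ZmZbar_inv[OF p] f_def[symmetric] matrix_mul_assoc)
      (simp add: maass_const_def vec_eq_iff)
qed

section \<open>Equivariance of the recursion\<close>

lemma trace_mat_1: "trace (mat 1 :: complex^'n^'n) = of_nat CARD('n)"
  by (simp add: trace_def mat_def)

lemma half_mat_1: "(1/2) *\<^sub>m (transpose (mat 1) + mat (trace (mat 1 :: complex^'n^'n)))
    = maass_const TYPE('n) *\<^sub>m (mat 1 :: complex^'n::finite^'n)"
  unfolding trace_mat_1 transpose_mat by (simp add: maass_const_def vec_eq_iff mat_def)

lemma divZ_Z: "p \<in> siegel_jacobi \<Longrightarrow> divZ fst (p :: ('n::finite, 'm::finite) point)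
    = maass_const TYPE('n) *\<^sub>m mat 1"
  using divZ_fst[of p "mat 1"] by (simp add: half_mat_1[simplified])

lemma divZbar_conj_Z:
  "p \<in> siegel_jacobi \<Longrightarrow> divZbar (\<lambda>q. conj_mat (fst q)) (p :: ('n::finite, 'm::finite) point)
      = maass_const TYPE('n) *\<^sub>m mat 1"
  using divZbar_conj_fst[of p "mat 1"] by (simp add: half_mat_1[simplified])

lemma divZbar_diff:
  assumes "smooth_mat f" "smooth_mat h" "p \<in> siegel_jacobi"
  shows "divZbar (\<lambda>q. f q - h q) p = divZbar f p - divZbar h p"
  using divZbar_add[OF assms(1) smooth_mat_mscale[OF smooth_const[of "-1"] assms(2)] assms(3)]
    divZbar_mscale[OF assms(2,3), of "-1"]
  by (simp add: mscale_minus_1)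

lemma divZ_diff:
  assumes "smooth_mat f" "smooth_mat h" "p \<in> siegel_jacobi"
  shows "divZ (\<lambda>q. f q - h q) p = divZ f p - divZ h p"
  using divZ_add[OF assms(1) smooth_mat_mscale[OF smooth_const[of "-1"] assms(2)] assms(3)]
    divZ_mscale[OF assms(2,3), of "-1"]
  by (simp add: mscale_minus_1)

lemma divZbar_ZmZbar:
  "p \<in> siegel_jacobi \<Longrightarrow> divZbar ZmZbar (p :: ('n::finite, 'm::finite) point)
      = - (maass_const TYPE('n) *\<^sub>m mat 1)"
  using divZbar_diff[OF smooth_mat_fst smooth_mat_conj[OF smooth_mat_fst], of p] divZbar_fst[of p
      "mat 1"]
  by (simp add: ZmZbar_def[abs_def] divZbar_conj_Z)

lemma LL_add:
  assumes "smooth_mat f" "smooth_mat h" "p \<in> siegel_jacobi"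
  shows "LL (\<lambda>q. f q + h q) p = LL f p + LL h p"
  using assms by (simp add: LL_def divZbar_add matrix_add_ldistrib)

lemma LL_diff:
  assumes "smooth_mat f" "smooth_mat h" "p \<in> siegel_jacobi"
  shows "LL (\<lambda>q. f q - h q) p = LL f p - LL h p"
  using assms by (simp add: LL_def divZbar_diff matrix_diff_ldistrib)

lemma LL_mscale:
  assumes "smooth_mat f" "p \<in> siegel_jacobi"
  shows "LL (\<lambda>q. c *\<^sub>m f q) p = c *\<^sub>m LL f p"
  using assms by (simp add: LL_def divZbar_mscale mscale_mult_right)

text \<open>The derivative of the left factor \<open>Z - conj Z\<close> of the argument cancels the constant term.\<close>

lemma LL_ZmZbar_mult:
  fixes f :: "('n::finite, 'm::finite) point \<Rightarrow> complex^'b^'n"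
  assumes f: "smooth_mat f" and p: "p \<in> siegel_jacobi"
  shows "LL (\<lambda>q. ZmZbar q ** f q) p + maass_const TYPE('n) *\<^sub>m (ZmZbar p ** f p)
    = ZmZbar p ** divZbar (\<lambda>q. ZmZbar p ** f q) p"
  by (simp add: LL_def divZbar_mult[OF smooth_mat_ZmZbar f p] divZbar_ZmZbar[OF p]
      matrix_add_ldistrib
      matrix_diff_ldistrib matrix_minus_left matrix_minus_right mscale_mult_left mscale_mult_right)

text \<open>
  Multiplication from the right by \<open>A - Z C\<close>, which is the factor \<open>(C Z + D)\<^sup>-\<^sup>t\<close> expressed
  in the new variable.
\<close>

lemma KK_mult_affine:
  fixes f :: "('n::finite, 'm::finite) point \<Rightarrow> complex^'n^'n"
  assumes f: "smooth_mat f" and p: "p \<in> siegel_jacobi"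
  shows "KK (\<lambda>q. f q ** (A - fst q ** C)) p = KK f p ** (A - fst p ** C)
    - (1/2) *\<^sub>m (ZmZbar p ** ((transpose (f p) + mat (trace (f p))) ** C))"
proof -
  have sm: "smooth_mat (\<lambda>q. f p ** fst q)" "smooth_mat (\<lambda>q. A - fst q ** C)"
    "smooth_mat (\<lambda>q. f p ** fst q ** C)"
    by (intro smooth_mat_intros)+
  have "divZ (\<lambda>q. f p ** (A - fst q ** C)) p = divZ (\<lambda>q. f p ** A) p
      - divZ (\<lambda>q. f p ** fst q ** C) p"
    using divZ_diff[OF smooth_mat_const sm(3) p, of "f p ** A"]
    by (simp add: matrix_diff_ldistrib matrix_mul_assoc)
  also have "\<dots> = - ((1/2) *\<^sub>m (transpose (f p) + mat (trace (f p)))) ** C"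
    by (simp add: divZ_const p divZ_mult_const[OF sm(1)] divZ_fst matrix_minus_left)
  finally have e: "divZ (\<lambda>q. f p ** (A - fst q ** C)) p = - ((1/2) *\<^sub>m (transpose (f p)
      + mat (trace (f p)))) ** C" .
  show ?thesis
    unfolding KK_def divZ_mult[OF f sm(2) p] e
    by (simp add: matrix_diff_ldistrib matrix_minus_left matrix_minus_right
        mscale_mult_left mscale_mult_right matrix_mul_assoc)
qed

lemma divZbar_mult_affine:
  fixes f :: "('n::finite, 'm::finite) point \<Rightarrow> complex^'n^'b"
  assumes p: "p \<in> siegel_jacobi"
  shows "divZbar (\<lambda>q. c ** (A - fst q ** C)) p = 0"
proof -
  have sm: "smooth_mat (\<lambda>q. c ** fst q)" "smooth_mat (\<lambda>q. c ** fst q ** C)"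
      by (intro smooth_mat_intros)+
  have "divZbar (\<lambda>q. c ** (A - fst q ** C)) p = divZbar (\<lambda>q. c ** A) p
      - divZbar (\<lambda>q. c ** fst q ** C) p"
    using divZbar_diff[OF smooth_mat_const sm(2) p, of "c ** A"]
    by (simp add: matrix_diff_ldistrib matrix_mul_assoc)
  then show ?thesis
    by (simp add: divZbar_const p divZbar_mult_const[OF sm(1)] divZbar_fst)
qed

lemma LL_mult_affine:
  fixes f :: "('n::finite, 'm::finite) point \<Rightarrow> complex^'n^'n"
  assumes f: "smooth_mat f" and p: "p \<in> siegel_jacobi"
  shows "LL (\<lambda>q. f q ** (A - fst q ** C)) p = LL f p ** (A - fst p ** C)"
proof -
  have sm: "smooth_mat (\<lambda>q. A - fst q ** C)" by (intro smooth_mat_intros)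
  show ?thesis
    by (simp add: LL_def divZbar_mult[OF f sm p] divZbar_mult_affine[OF p] matrix_mul_assoc)
qed

lemma mat_scalar_commute: "X ** mat c = mat c ** (X :: complex^'n^'m)"
  by (simp add: vec_eq_iff matrix_mul_componentwise mat_def if_distrib if_distribR mult.commute
      cong: if_cong)

context jacobi_element
begin

text \<open>
  With \<open>\<delta> = (n + 1) / 2\<close>: \<open>KK - \<delta>\<close> turns the factor \<open>J\<^sup>t\<close> into its conjugate, and \<open>LL + \<delta>\<close> turns
  it back. In both cases \<open>\<delta>\<close> is the divergence of \<open>Z\<close>, and the two derivative terms combine by
  \<open>(Z - conj Z) C\<^sup>t = J\<^sup>t - conj J\<^sup>t\<close>.
\<close>

lemma KK_J:
  fixes h :: "('n, 'm) point \<Rightarrow> complex^'b^'n"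
  assumes h: "smooth_mat h" and p: "p \<in> siegel_jacobi"
  shows "KK (\<lambda>q. transpose (J q) ** h (act q)) p = maass_const TYPE('n) *\<^sub>m (transpose (J p)
      ** h (act p))
    + transpose (conj_mat (J p)) ** (KK h (act p) - maass_const TYPE('n) *\<^sub>m h (act p))"
proof -
  have J: "transpose (J q) = fst q ** transpose C + transpose D" if "q \<in> siegel_jacobi" for q
    using that by (simp add: J_def transpose_add matrix_transpose_mul siegel_jacobi_symmetric)
  have sm: "smooth_mat (\<lambda>q. transpose (J q))" "smooth_mat (\<lambda>q :: ('n, 'm) point. fst q
      ** transpose C)"
    by (intro smooth_mat_intros)+
  have "divZ (\<lambda>q. transpose (J q)) p = divZ (\<lambda>q. fst q ** transpose C + transpose D) p"
    by (rule divZ_cong[OF J p])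
  also have "\<dots> = maass_const TYPE('n) *\<^sub>m transpose C"
    by (simp add: divZ_add[OF sm(2) smooth_mat_const p] divZ_const p divZ_mult_const[OF
        smooth_mat_fst]
        divZ_Z mscale_mult_left)
  finally have 1: "divZ (\<lambda>q. transpose (J q)) p = maass_const TYPE('n) *\<^sub>m transpose C" .
  have 2: "divZ (\<lambda>q. transpose (J p) ** h (act q)) p = R p ** divZ h (act p)"
    by (simp add: divZ_compose_act[OF h p] transpose_R_J p)
  show ?thesis
    unfolding KK_def divZ_mult[OF sm(1) smooth_mat_compose_act[OF h] p] 1 2
    by (simp add: matrix_add_ldistrib matrix_diff_ldistrib mscale_mult_left mscale_mult_right
        matrix_mul_assoc
        ZmZbar_R[OF p] ZmZbar_C[OF p] matrix_diff_rdistrib mscale_diff)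
qed

lemma LL_J:
  fixes h :: "('n, 'm) point \<Rightarrow> complex^'b^'n"
  assumes h: "smooth_mat h" and p: "p \<in> siegel_jacobi"
  shows "LL (\<lambda>q. transpose (conj_mat (J q)) ** h (act q)) p
      + maass_const TYPE('n) *\<^sub>m (transpose (conj_mat (J p)) ** h (act p))
    = transpose (J p) ** (LL h (act p) + maass_const TYPE('n) *\<^sub>m h (act p))"
proof -
  have J: "transpose (conj_mat (J q)) = conj_mat (fst q) ** transpose C
      + transpose D" if "q \<in> siegel_jacobi" for q
    using that by (simp add: conj_J transpose_add matrix_transpose_mul
        conj_mat_transpose[symmetric] siegel_jacobi_symmetric)
  have sm: "smooth_mat (\<lambda>q. transpose (conj_mat (J q)))" "smooth_mat (\<lambda>q :: ('n, 'm) point.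
      conj_mat (fst q))"
    "smooth_mat (\<lambda>q :: ('n, 'm) point. conj_mat (fst q) ** transpose C)"
    by (intro smooth_mat_intros)+
  have "divZbar (\<lambda>q. transpose (conj_mat (J q))) p = divZbar (\<lambda>q. conj_mat (fst q) ** transpose C
      + transpose D) p"
    by (rule divZbar_cong[OF J p])
  also have "\<dots> = maass_const TYPE('n) *\<^sub>m transpose C"
    by (simp add: divZbar_add[OF sm(3) smooth_mat_const p] divZbar_const p divZbar_mult_const[OF
        sm(2)]
        divZbar_conj_Z mscale_mult_left)
  finally have 1: "divZbar (\<lambda>q. transpose (conj_mat (J q))) p
      = maass_const TYPE('n) *\<^sub>m transpose C" .
  have 2: "divZbar (\<lambda>q. transpose (conj_mat (J p)) ** h (act q)) p
      = conj_mat (R p) ** divZbar h (act p)"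
    by (simp add: divZbar_compose_act[OF h p] conj_transpose_R_J p)
  show ?thesis
    unfolding LL_def divZbar_mult[OF sm(1) smooth_mat_compose_act[OF h] p] 1 2
    by (simp add: matrix_add_ldistrib matrix_diff_ldistrib mscale_mult_left mscale_mult_right
        matrix_mul_assoc
        ZmZbar_conj_R[OF p] ZmZbar_C[OF p] matrix_diff_rdistrib mscale_diff)
qed

text \<open>
  The recursion preserves the transformation law. The derivative of the right factor \<open>R\<^sup>t\<close>,
  which is \<open>rho = A - Z C\<close> at the image point, leaves two terms with the factor \<open>C\<close>, one with
  the trace and one with the transpose of \<open>M\<close>; they are cancelled by the last two summands of
  the recursion, in which conjugation of \<open>R\<^sup>t\<close> contributes \<open>(Z' - conj Z') C\<close>.
\<close>

lemma maass_step_act: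
  assumes M: "smooth_mat M" and f: "smooth_mat f"
    and fM: "\<And>q. q \<in> siegel_jacobi \<Longrightarrow> f q = transpose (J q) ** M (act q) ** transpose (R q)"
    and p: "p \<in> siegel_jacobi"
  shows "maass_step f p = transpose (J p) ** maass_step M (act p) ** transpose (R p)"
proof -
  let ?d = "maass_const TYPE('n)"
  define p' where "p' = act p"
  have p': "p' \<in> siegel_jacobi" unfolding p'_def by (rule act_siegel_jacobi[OF p])
  define rho where "rho = (\<lambda>q :: ('n, 'm) point. A - fst q ** C)"
  define h where "h = (\<lambda>q. M q ** rho q)"
  define H where "H = (\<lambda>q. KK h q - ?d *\<^sub>m h q)"
  define HM where "HM = (\<lambda>q. KK M q - ?d *\<^sub>m M q)"
  define S where "S = (\<lambda>q. transpose (M q) + mat (trace (M q)))"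
  define Jt Jb Rt T T' where "Jt = transpose (J p)" and "Jb = transpose (conj_mat (J p))"
    and "Rt = transpose (R p)" and "T = ZmZbar p" and "T' = ZmZbar p'"
  have smrho: "smooth_mat rho" unfolding rho_def by (intro smooth_mat_intros)
  have smh: "smooth_mat h" unfolding h_def by (intro smooth_mat_intros M smrho)
  have smH: "smooth_mat H" unfolding H_def by (intro smooth_mat_intros smh smooth_const)
  have smHM: "smooth_mat HM" unfolding HM_def by (intro smooth_mat_intros M smooth_const)
  have smtr: "smooth_mat (\<lambda>q. mat (trace (M q)))" by (intro smooth_mat_intros smooth_trace M)
  have smS: "smooth_mat S" unfolding S_def by (intro smooth_mat_intros smtr M)
  have rho: "rho (act q) = transpose (R q)" if "q \<in> siegel_jacobi" for q
    using transpose_R_eq[OF that] by (simp add: rho_def)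
  \<comment> \<open>The right factor is absorbed: \<open>f\<close> is \<open>J\<^sup>t\<close> times the pullback of \<open>h = M rho\<close>.\<close>
  have fh: "f q = transpose (J q) ** h (act q)" if "q \<in> siegel_jacobi" for q
    using fM[OF that] rho[OF that] by (simp add: h_def matrix_mul_assoc)
  have Kf: "KK f q = ?d *\<^sub>m f q + transpose (conj_mat (J q)) ** H (act q)"
      if q: "q \<in> siegel_jacobi" for q
    using KK_cong[OF fh q] KK_J[OF smh q] fh[OF q] by (simp add: H_def)
  have smJH: "smooth_mat (\<lambda>q. transpose (conj_mat (J q)) ** H (act q))"
    by (intro smooth_mat_intros smooth_mat_compose_act smH)
  have smdf: "smooth_mat (\<lambda>q. ?d *\<^sub>m f q)" by (intro smooth_mat_intros f smooth_const)
  have LKf: "LL (KK f) p + ?d *\<^sub>m KK f p - ?d *\<^sub>m LL f p = Jt ** (LL H p' + ?d *\<^sub>m H p')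
      + (?d * ?d) *\<^sub>m f p"
  proof -
    have "LL (KK f) p = LL (\<lambda>q. ?d *\<^sub>m f q + transpose (conj_mat (J q)) ** H (act q)) p"
      by (rule LL_cong[OF Kf p])
    also have "\<dots> = ?d *\<^sub>m LL f p + LL (\<lambda>q. transpose (conj_mat (J q)) ** H (act q)) p"
      by (simp only: LL_add[OF smdf smJH p] LL_mscale[OF f p])
    finally show ?thesis
      using LL_J[OF smH p] by (simp add: Kf[OF p] mscale_add mscale_mscale Jt_def p'_def)
  qed
  \<comment> \<open>From here on everything is computed at the image point.\<close>
  have H: "H q = HM q ** rho q - (1/2) *\<^sub>m (ZmZbar q ** (S q ** C))" if q: "q \<in> siegel_jacobi" for q
    using KK_mult_affine[OF M q, of A C]
    by (simp add: H_def h_def HM_def S_def rho_def matrix_diff_rdistrib mscale_mult_left)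
  have LH: "LL H p' + ?d *\<^sub>m H p' = (LL HM p' + ?d *\<^sub>m HM p') ** Rt
      - (1/2) *\<^sub>m (T' ** divZbar (\<lambda>q. T' ** S q) p' ** C)"
  proof -
    have sm1: "smooth_mat (\<lambda>q. HM q ** rho q)" "smooth_mat (\<lambda>q. S q
        ** C)" "smooth_mat (\<lambda>q. ZmZbar q ** (S q ** C))"
      "smooth_mat (\<lambda>q. T' ** S q)"
      by (intro smooth_mat_intros smHM smrho smS)+
    have sm2: "smooth_mat (\<lambda>q. (1/2) *\<^sub>m (ZmZbar q ** (S q ** C)))"
      by (intro smooth_mat_intros smooth_const smS)
    have "LL H p' = LL (\<lambda>q. HM q ** rho q - (1/2) *\<^sub>m (ZmZbar q ** (S q ** C))) p'"
      by (rule LL_cong[OF H p'])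
    also have "\<dots> = LL (\<lambda>q. HM q ** rho q) p' - (1/2) *\<^sub>m LL (\<lambda>q. ZmZbar q ** (S q ** C)) p'"
      by (simp only: LL_diff[OF sm1(1) sm2 p'] LL_mscale[OF sm1(3) p'])
    also have "LL (\<lambda>q. HM q ** rho q) p' = LL HM p' ** Rt"
      using LL_mult_affine[OF smHM p', of A C] rho[OF p] by (simp add: rho_def Rt_def p'_def)
    also have "LL (\<lambda>q. ZmZbar q ** (S q ** C)) p' = T' ** divZbar (\<lambda>q. T' ** S q) p' ** C
        - ?d *\<^sub>m (T' ** (S p' ** C))"
    proof -
      have "divZbar (\<lambda>q. T' ** (S q ** C)) p' = divZbar (\<lambda>q. T' ** S q) p' ** C"
        using divZbar_mult_const[OF sm1(4) p', of C] by (simp add: matrix_mul_assoc)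
      then show ?thesis
        using LL_ZmZbar_mult[OF sm1(2) p'] by (simp add: T'_def[symmetric] matrix_mul_assoc
            eq_diff_eq)
    qed
    finally show ?thesis
      using H[OF p'] rho[OF p]
      by (simp add: T'_def[symmetric] Rt_def[symmetric] p'_def[symmetric] mscale_diff mscale_add
          mscale_mscale matrix_add_rdistrib
          mscale_mult_left mult.commute)
  qed
  have LHM: "LL HM p' = LL (KK M) p' - ?d *\<^sub>m LL M p'"
    unfolding HM_def
    by (simp only: LL_diff[OF smooth_mat_KK[OF M] smooth_mat_mscale[OF smooth_const M] p']
        LL_mscale[OF M p'])
  define G where "G = divZbar (\<lambda>q. mat (trace (M q))) p'"
  define E where "E = divZbar (\<lambda>q. T' ** transpose (M q)) p'"
  have TS: "divZbar (\<lambda>q. T' ** S q) p' = E + G ** T'"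
  proof -
    have sm3: "smooth_mat (\<lambda>q. T' ** transpose (M q))" "smooth_mat (\<lambda>q. mat (trace (M q)) ** T')"
      by (intro smooth_mat_intros M smtr)+
    have "(\<lambda>q. T' ** S q) = (\<lambda>q. T' ** transpose (M q) + mat (trace (M q)) ** T')"
      by (simp add: S_def matrix_add_ldistrib mat_scalar_commute)
    then show ?thesis
      by (simp only: divZbar_add[OF sm3 p'] divZbar_mult_const[OF smtr p'] E_def G_def)
  qed
  \<comment> \<open>The two compensating summands of the recursion.\<close>
  have Rb: "transpose (conj_mat (R p)) = Rt + T' ** C"
    using conj_transpose_R_eq[OF p] by (simp add: Rt_def T'_def p'_def)
  have TR: "T ** conj_mat (R p) = Jt ** T'"
    using ZmZbar_conj_R[OF p] by (simp add: T_def Jt_def T'_def p'_def)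
  have tr: "LL (\<lambda>q. mat (trace (f q))) p = Jt ** T' ** G ** (Rt + T' ** C)"
  proof -
    have "trace (f q) = trace (M (act q))" if "q \<in> siegel_jacobi" for q
    proof -
      have "trace (f q) = trace (transpose (R q) ** (transpose (J q) ** M (act q)))"
        unfolding fM[OF that] by (rule trace_mul_sym)
      then show ?thesis by (simp add: matrix_mul_assoc transpose_R_J that)
    qed
    then have "divZbar (\<lambda>q. mat (trace (f q))) p = divZbar (\<lambda>q. mat 1 ** mat (trace (M (act q)))) p"
      by (intro divZbar_cong p) simp
    also have "\<dots> = conj_mat (R p) ** divZbar (\<lambda>q. mat (trace (M q))
        ** transpose (conj_mat (R p))) p'"
      unfolding p'_def by (subst divZbar_compose_act[OF smtr p]) (simp add: mat_scalar_commute)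
    also have "\<dots> = conj_mat (R p) ** G ** (Rt + T' ** C)"
      by (simp only: divZbar_mult_const[OF smtr p'] G_def Rb matrix_mul_assoc)
    finally show ?thesis
      using TR by (simp add: LL_def T_def[symmetric] matrix_mul_assoc)
  qed
  have Tinv: "T' ** ZmZbar_inv p' = mat 1" "ZmZbar_inv p' ** T' = mat 1" "T ** ZmZbar_inv p = mat 1"
    using matrix_inv_left[OF invertible_ZmZbar[OF p']] matrix_inv_right[OF invertible_ZmZbar[OF p']]
      matrix_inv_right[OF invertible_ZmZbar[OF p]]
    by (simp_all add: T_def T'_def ZmZbar_inv_def)
  have JT: "J p ** ZmZbar_inv p = ZmZbar_inv p' ** Rt + C"
  proof -
    have "ZmZbar_inv p' ** transpose (conj_mat (R p)) ** T = ZmZbar_inv p'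
        ** (transpose (conj_mat (R p)) ** transpose (conj_mat (J p))) ** T' ** J p"
      unfolding T_def ZmZbar_act[OF p] by (simp add: matrix_mul_assoc T'_def p'_def)
    also have "\<dots> = J p"
      by (simp add: conj_transpose_R_J[OF p] Tinv)
    finally have "J p ** ZmZbar_inv p = ZmZbar_inv p' ** transpose (conj_mat (R p)) ** (T
        ** ZmZbar_inv p)"
      by (simp add: matrix_mul_assoc)
    then show ?thesis
      by (simp add: Tinv Rb matrix_add_ldistrib matrix_mul_assoc)
  qed
  have S3: "T ** divZbar (\<lambda>q. T ** transpose (f q)) p ** ZmZbar_inv p
      = Jt ** T' ** E ** (ZmZbar_inv p' ** Rt + C)"
  proof -
    have smT: "smooth_mat (\<lambda>q. T ** R q)" "smooth_mat (\<lambda>q. T ** R q ** transpose (M (act q)))"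
      "smooth_mat (\<lambda>q. transpose (M (act q)))" "smooth_mat (\<lambda>q. transpose (M q))"
      "smooth_mat (\<lambda>q :: ('n, 'm) point. transpose A - transpose C ** fst q)"
      by (intro smooth_mat_intros smooth_mat_compose_act M)+
    have "divZbar (\<lambda>q. T ** transpose (f q)) p = divZbar (\<lambda>q. (T ** R q ** transpose (M (act q)))
        ** J q) p"
      by (rule divZbar_cong[OF _ p]) (simp add: fM matrix_transpose_mul matrix_mul_assoc)
    also have "\<dots> = divZbar (\<lambda>q. T ** R q ** transpose (M (act q))) p ** J p"
    proof -
      have "divZbar (\<lambda>q. c ** J q) p = 0" for c :: "complex^'n^'n"
        using divZbar_add[OF smooth_mat_mult[OF smooth_mat_const smooth_mat_fst] smooth_mat_const
            p, of "c ** C" "c ** D"]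
        by (simp add: J_def matrix_add_ldistrib matrix_mul_assoc divZbar_fst divZbar_const p)
      then show ?thesis by (simp add: divZbar_mult[OF smT(2) smooth_mat_J p])
    qed
    also have "divZbar (\<lambda>q. T ** R q ** transpose (M (act q))) p
       = divZbar (\<lambda>q. T ** R p ** transpose (M (act q))) p"
    proof -
      have "divZbar (\<lambda>q. T ** R q) p = divZbar (\<lambda>q. T ** (transpose A
          - transpose C ** fst (act q))) p"
        by (rule divZbar_cong[OF _ p]) (simp add: R_eq)
      also have "\<dots> = conj_mat (R p) ** divZbar (\<lambda>q. (transpose (conj_mat (R p)) ** T)
          ** (transpose A - transpose C ** fst q)) p'"
        unfolding p'_def by (rule divZbar_compose_act[OF smT(5) p])
      also have "divZbar (\<lambda>q. c ** (transpose A - transpose C ** fst q)) p'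
          = 0" for c :: "complex^'n^'n"
        using divZbar_diff[OF smooth_mat_const smooth_mat_mult[OF smooth_mat_const smooth_mat_fst]
            p', of "c ** transpose A" "c ** transpose C"]
        by (simp add: matrix_diff_ldistrib matrix_mul_assoc divZbar_fst divZbar_const p')
      finally show ?thesis
        by (simp add: divZbar_mult[OF smT(1,3) p])
    qed
    also have "T ** R p = Jb ** T'"
      using ZmZbar_R[OF p] by (simp add: T_def Jb_def T'_def p'_def)
    also have "divZbar (\<lambda>q. Jb ** T' ** transpose (M (act q))) p = conj_mat (R p) ** E"
      unfolding E_def p'_def
      by (subst divZbar_compose_act[OF smT(4) p]) (simp add: Jb_def matrix_mul_assoc
          conj_transpose_R_J[OF p])
    finally have "T ** divZbar (\<lambda>q. T ** transpose (f q)) p ** ZmZbar_inv p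
        = (T ** conj_mat (R p)) ** E ** (J p ** ZmZbar_inv p)"
      by (simp add: matrix_mul_assoc)
    then show ?thesis by (simp only: TR JT)
  qed
  have G': "LL (\<lambda>q. mat (trace (M q))) p' = T' ** G"
    by (simp add: LL_def T'_def G_def)
  have fp: "f p = Jt ** M p' ** Rt" using fM[OF p] by (simp add: Jt_def Rt_def p'_def)
  have L: "maass_step f p = Jt ** ((LL (KK M) p' - ?d *\<^sub>m LL M p'
      + ?d *\<^sub>m (KK M p' - ?d *\<^sub>m M p')) ** Rt
        - (1/2) *\<^sub>m (T' ** (E + G ** T') ** C)) + (?d * ?d) *\<^sub>m (Jt ** M p' ** Rt)
      + (1/2) *\<^sub>m (Jt ** T' ** G ** (Rt + T' ** C))
      + (1/2) *\<^sub>m (Jt ** T' ** E ** (ZmZbar_inv p' ** Rt + C))"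
    unfolding maass_step_def LKf LH LHM TS tr T_def[symmetric] S3 fp by (simp add: HM_def)
  have "maass_step M p' = LL (KK M) p' + ?d *\<^sub>m KK M p' - ?d *\<^sub>m LL M p' + (1/2) *\<^sub>m (T' ** G)
      + (1/2) *\<^sub>m (T' ** E ** ZmZbar_inv p')"
    unfolding maass_step_def G' by (simp only: T'_def E_def)
  then show ?thesis
    unfolding L p'_def[symmetric] Jt_def[symmetric] Rt_def[symmetric]
    by (simp add: matrix_add_ldistrib matrix_add_rdistrib matrix_diff_ldistrib matrix_diff_rdistrib
        mscale_add mscale_diff mscale_mult_left mscale_mult_right mscale_mscale matrix_mul_assoc)
qed

end

section \<open>Derivatives along the fibres and invariance\<close>

text \<open>
  The matrix of fibre derivatives of a function, and the products of the transposed matrices of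
  holomorphic and antiholomorphic fibre derivatives with a matrix of functions.
\<close>

definition gradW :: "(('n::finite, 'm::finite) point \<Rightarrow> complex) \<Rightarrow> ('n, 'm) point \<Rightarrow> complex^'n^'m"
    where
  "gradW F p = (\<chi> l j. DW l j F p)"

definition divW :: "(('n::finite, 'm::finite) point \<Rightarrow> complex^'b^'n) \<Rightarrow> ('n, 'm) point \<Rightarrow>
    complex^'b^'m" where
  "divW f p = (\<chi> l b. \<Sum>j\<in>UNIV. DW l j (\<lambda>q. f q $ j $ b) p)"

definition divWbar :: "(('n::finite, 'm::finite) point \<Rightarrow> complex^'b^'n) \<Rightarrow> ('n, 'm) point \<Rightarrow>
    complex^'b^'m" where
  "divWbar f p = conj_mat (divW (\<lambda>q. conj_mat (f q)) p)"

lemma divW_cong: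
  assumes "\<And>q. q \<in> siegel_jacobi \<Longrightarrow> f q = g q" "p \<in> siegel_jacobi"
  shows "divW f p = divW g p"
  unfolding divW_def DW_def
  by (simp add: vec_eq_iff) (intro allI sum.cong refl cder_cong, use assms in \<open>auto simp:
      wdir_tangent\<close>)

lemma divWbar_cong:
  assumes "\<And>q. q \<in> siegel_jacobi \<Longrightarrow> f q = g q" "p \<in> siegel_jacobi"
  shows "divWbar f p = divWbar g p"
  unfolding divWbar_def by (subst divW_cong[of _ "\<lambda>q. conj_mat (g q)"]) (use assms in auto)

lemma smooth_DW:
  assumes "smooth F"
  shows "smooth (DW l j F)"
proof (rule smooth_cong)
  show "smooth ((dW $ j $ l) F)"
    by (rule smooth_diff_operator[OF diff_opmat_nth[OF diff_opmat_wirtinger(3)] assms])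
  show "(dW $ j $ l) F q = DW l j F q" if "q \<in> siegel_jacobi" for q
    using arg_cong[OF op_eval_dW[of F q], of "\<lambda>M. M $ j $ l"] by simp
qed

lemma smooth_mat_divW [smooth_mat_intros]:
  assumes "smooth_mat f" shows "smooth_mat (divW f)"
  unfolding smooth_mat_def divW_def vec_lambda_beta
  by (intro allI smooth_sum smooth_DW smooth_mat_nth assms)

lemma smooth_mat_divWbar [smooth_mat_intros]:
  assumes "smooth_mat f" shows "smooth_mat (divWbar f)"
  unfolding divWbar_def[abs_def] by (intro smooth_mat_intros assms)

lemma smooth_mat_gradW: "smooth F \<Longrightarrow> smooth_mat (gradW F)"
  by (simp add: smooth_mat_def gradW_def smooth_DW)

text \<open>
  A function of \<open>Z\<close> alone is annihilated by the fibre derivatives.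
\<close>

lemma DW_base_function:
  assumes "\<And>q r. fst q = fst r \<Longrightarrow> u q = u r"
  shows "DW l j u p = 0"
proof -
  have "dir_deriv (wdir l j c) u p = 0" for c
  proof -
    have "(\<lambda>t. u (p + t *\<^sub>R wdir l j c)) = (\<lambda>t::real. u p)"
      by (intro ext assms) (simp add: wdir_def)
    then show ?thesis by (simp add: dir_deriv_def)
  qed
  then show ?thesis by (simp add: DW_def cder_def cpoint_wdir)
qed

lemma DW_sum_mult_base:
  assumes u: "\<And>i. smooth (u i)" "\<And>i q r. fst q = fst r \<Longrightarrow> u i q = u i r"
    and F: "\<And>i. smooth (F i)" and p: "p \<in> siegel_jacobi"
  shows "DW l j (\<lambda>q. \<Sum>i\<in>(UNIV :: 'i::finite set). u i q * F i q) p
      = (\<Sum>i\<in>UNIV. u i p * DW l j (F i) p)"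
proof -
  have "DW l j (u i) p = 0" for i by (rule DW_base_function[OF u(2)])
  then show ?thesis
    using u(1) F p by (simp add: DW_def cder_sum cder_mult smooth_mult wdir_tangent)
qed

lemma divW_mult_base:
  assumes f: "smooth_mat f" and h: "smooth_mat h" and base: "\<And>q r. fst q = fst r \<Longrightarrow> h q = h r"
    and p: "p \<in> siegel_jacobi"
  shows "divW (\<lambda>q. f q ** h q) p = divW f p ** h p"
proof -
  have D: "DW l j (\<lambda>q. (f q ** h q) $ j $ b) p = (\<Sum>e\<in>UNIV. DW l j (\<lambda>q. f q $ j $ e) p
      * h p $ e $ b)" for l j b
  proof -
    have "DW l j (\<lambda>q. \<Sum>e\<in>UNIV. h q $ e $ b * f q $ j $ e) p = (\<Sum>e\<in>UNIV. h p $ e $ b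
        * DW l j (\<lambda>q. f q $ j $ e) p)"
    proof (rule DW_sum_mult_base[OF smooth_mat_nth[OF h] _ smooth_mat_nth[OF f] p])
      show "h q $ e $ b = h r $ e $ b" if "fst q = fst r" for e q r
        using base[OF that] by simp
    qed
    then show ?thesis by (simp only: matrix_mul_componentwise mult.commute)
  qed
  have "divW (\<lambda>q. f q ** h q) p $ l $ b = (divW f p ** h p) $ l $ b" for l b
    unfolding matrix_mul_componentwise[of "divW f p"]
    by (simp add: divW_def D sum_distrib_right) (rule sum.swap)
  then show ?thesis by (simp add: vec_eq_iff)
qed

lemma divWbar_mult_base:
  assumes "smooth_mat f" "smooth_mat h" "\<And>q r. fst q = fst r \<Longrightarrow> h q = h r" "p \<in> siegel_jacobi"
  shows "divWbar (\<lambda>q. f q ** h q) p = divWbar f p ** h p"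
proof -
  have "divW (\<lambda>q. conj_mat (f q) ** conj_mat (h q)) p = divW (\<lambda>q. conj_mat (f q)) p
      ** conj_mat (h p)"
    by (rule divW_mult_base[OF smooth_mat_conj[OF assms(1)] smooth_mat_conj[OF assms(2)] _
        assms(4)])
      (rule arg_cong[of _ _ conj_mat], rule assms(3))
  then show ?thesis by (simp add: divWbar_def conj_mat_mult)
qed

context jacobi_element
begin

lemma J_base: "fst q = fst r \<Longrightarrow> J q = J r"
  by (simp add: J_def)

lemma R_base: "fst q = fst r \<Longrightarrow> R q = R r"
  by (simp add: R_def J_def)

lemma DW_compose_act:
  assumes F: "smooth F" and p: "p \<in> siegel_jacobi"
  shows "DW l' j (\<lambda>q. F (act q)) p = (\<Sum>b\<in>UNIV. R p $ j $ b * DW l' b F (act p))"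
proof -
  have d: "(transpose (R p) ** fst (wdir l' j c) ** R p,
      (snd (wdir l' j c) + (l - snd (act p) ** C) ** fst (wdir l' j c)) ** R p)
     = (\<Sum>b\<in>UNIV. cpoint (c * R p $ j $ b) (wdir l' b 1))" for c
  proof -
    have "(axis l' (axis j c) ** R p) $ a $ b = (\<Sum>i\<in>UNIV. axis l' (axis i (c
        * R p $ j $ i))) $ a $ b" for a b
    proof (cases "a = l'")
      case True
      have "(axis l' (axis j c) ** R p) $ a $ b = (\<Sum>k\<in>UNIV. (if k = j then c * R p $ k $ b else 0))"
        using True by (simp add: matrix_mul_componentwise axis_def if_distrib if_distribR cong:
            if_cong)
      moreover have "(\<Sum>i\<in>UNIV. axis l' (axis i (c * R p $ j $ i))) $ a $ b
         = (\<Sum>i\<in>UNIV. if b = i then c * R p $ j $ i else 0)"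
        unfolding sum_component using True by (simp add: axis_def)
      ultimately show ?thesis by simp
    qed (simp add: matrix_mul_componentwise axis_def)
    then show ?thesis
      by (simp add: cpoint_wdir prod_eq_iff fst_sum snd_sum vec_eq_iff) (simp add: wdir_def
          vec_eq_iff)
  qed
  have i: "cpoint \<i> (\<Sum>b\<in>UNIV. cpoint (R p $ j $ b) (wdir l' b 1))
      = (\<Sum>b\<in>UNIV. cpoint (\<i> * R p $ j $ b) (wdir l' b 1))"
    by (simp add: cpoint_def prod_eq_iff fst_sum snd_sum vec_eq_iff sum_distrib_left mult.assoc)
  have "DW l' j (\<lambda>q. F (act q)) p = (dir_deriv (wdir l' j 1) (\<lambda>q. F (act q)) p
      - \<i> * dir_deriv (wdir l' j \<i>) (\<lambda>q. F (act q)) p) / 2"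
    by (simp only: DW_def cder_def cpoint_wdir)
  also have "\<dots> = cder (\<Sum>b\<in>UNIV. cpoint (R p $ j $ b) (wdir l' b 1)) F (act p)"
    by (simp only: dir_deriv_compose_act[OF F p wdir_tangent] d mult_1 cder_def i)
  also have "\<dots> = (\<Sum>b\<in>UNIV. R p $ j $ b * DW l' b F (act p))"
    unfolding DW_def by (rule cder_direction_sum[OF F act_siegel_jacobi[OF p] wdir_tangent])
  finally show ?thesis .
qed

lemma gradW_compose_act:
  assumes F: "smooth F" and p: "p \<in> siegel_jacobi"
  shows "gradW (\<lambda>q. F (act q)) p = gradW F (act p) ** transpose (R p)"
  by (simp add: vec_eq_iff gradW_def matrix_mul_componentwise DW_compose_act[OF F p] mult.commute)

lemma divW_J_act:
  assumes h: "smooth_mat h" and p: "p \<in> siegel_jacobi"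
  shows "divW (\<lambda>q. transpose (J q) ** h (act q)) p = divW h (act p)"
proof -
  have D: "DW l' j (\<lambda>q. (transpose (J q) ** h (act q)) $ j $ b) p
      = (\<Sum>c\<in>UNIV. \<Sum>e\<in>UNIV. J p $ c $ j * R p $ j $ e * DW l' e (\<lambda>q. h q $ c $ b) (act p))"
          for l' j b
  proof -
    have "DW l' j (\<lambda>q. \<Sum>c\<in>UNIV. J q $ c $ j * h (act q) $ c $ b) p
        = (\<Sum>c\<in>UNIV. J p $ c $ j * DW l' j (\<lambda>q. h (act q) $ c $ b) p)"
    proof (rule DW_sum_mult_base[OF smooth_mat_nth[OF smooth_mat_J] _ smooth_mat_nth[OF
        smooth_mat_compose_act[OF h]] p])
      show "J q $ c $ j = J r $ c $ j" if "fst q = fst r" for c q r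
        using J_base[OF that] by simp
    qed
    then show ?thesis
      by (simp add: matrix_mul_componentwise DW_compose_act[OF smooth_mat_nth[OF h] p]
          sum_distrib_left mult.assoc)
  qed
  have "divW (\<lambda>q. transpose (J q) ** h (act q)) p $ l' $ b = divW h (act p) $ l' $ b" for l' b
  proof -
    have "divW (\<lambda>q. transpose (J q) ** h (act q)) p $ l' $ b
        = (\<Sum>j\<in>UNIV. \<Sum>c\<in>UNIV. \<Sum>e\<in>UNIV. J p $ c $ j * R p $ j $ e
            * DW l' e (\<lambda>q. h q $ c $ b) (act p))"
      by (simp add: divW_def D)
    also have "\<dots> = (\<Sum>c\<in>UNIV. \<Sum>j\<in>UNIV. \<Sum>e\<in>UNIV. J p $ c $ j * R p $ j $ e
        * DW l' e (\<lambda>q. h q $ c $ b) (act p))"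
      by (rule sum.swap)
    also have "\<dots> = (\<Sum>c\<in>UNIV. \<Sum>e\<in>UNIV. \<Sum>j\<in>UNIV. J p $ c $ j * R p $ j $ e
        * DW l' e (\<lambda>q. h q $ c $ b) (act p))"
      by (intro sum.cong refl sum.swap)
    also have "\<dots> = (\<Sum>c\<in>UNIV. \<Sum>e\<in>UNIV. (J p ** R p) $ c $ e * DW l' e (\<lambda>q. h q $ c $ b) (act p))"
      by (simp add: matrix_mul_componentwise sum_distrib_right)
    also have "\<dots> = divW h (act p) $ l' $ b"
    proof -
      have "(mat 1 :: complex^'n^'n) $ c $ e * x = (if e = c then x else 0)" for c e x
        by (simp add: mat_def)
      then show ?thesis by (simp add: J_R[OF p] divW_def)
    qed
    finally show ?thesis .
  qed
  then show ?thesis by (simp add: vec_eq_iff)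
qed

lemma divWbar_J_act:
  assumes h: "smooth_mat h" and p: "p \<in> siegel_jacobi"
  shows "divWbar (\<lambda>q. transpose (conj_mat (J q)) ** h (act q)) p = divWbar h (act p)"
  using divW_J_act[OF smooth_mat_conj[OF h] p]
  by (simp add: divWbar_def conj_mat_mult conj_mat_transpose)

lemma Ymat_R:
  assumes p: "p \<in> siegel_jacobi"
  shows "Ymat p ** R p = transpose (conj_mat (J p)) ** Ymat (act p)"
  using ZmZbar_R[OF p] by (simp add: ZmZbar_eq mscale_mult_left mscale_mult_right vec_eq_iff)

lemma Ymat_conj_R:
  assumes p: "p \<in> siegel_jacobi"
  shows "Ymat p ** conj_mat (R p) = transpose (J p) ** Ymat (act p)"
  using ZmZbar_conj_R[OF p] by (simp add: ZmZbar_eq mscale_mult_left mscale_mult_right vec_eq_iff)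

text \<open>
  The final step common to \<open>Yminus \<otimes> Yplus\<close>, \<open>Top\<close> and \<open>Uop\<close>: there \<open>g\<close> is the matrix of the
  first operators applied to the composition of a function with the action.
\<close>

lemma divWbar_Ymat_act:
  assumes f: "smooth_mat f" and g: "\<And>q. q \<in> siegel_jacobi \<Longrightarrow> g q = f (act q) ** transpose (R q)"
    and p: "p \<in> siegel_jacobi"
  shows "divWbar (\<lambda>q. Ymat q ** transpose (g q)) p = divWbar (\<lambda>q. Ymat q
      ** transpose (f q)) (act p)"
proof -
  have "Ymat q ** transpose (g q) = transpose (conj_mat (J q)) ** (Ymat (act q)
      ** transpose (f (act q)))"
    if "q \<in> siegel_jacobi" for q
    by (simp add: g that matrix_transpose_mul matrix_mul_assoc Ymat_R)
  then have "divWbar (\<lambda>q. Ymat q ** transpose (g q)) p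
      = divWbar (\<lambda>q. transpose (conj_mat (J q)) ** (Ymat (act q) ** transpose (f (act q)))) p"
    by (rule divWbar_cong[OF _ p])
  also have "\<dots> = divWbar (\<lambda>q. Ymat q ** transpose (f q)) (act p)"
    by (rule divWbar_J_act[OF _ p]) (intro smooth_mat_intros f)
  finally show ?thesis .
qed

lemma op_eval_Xplus_act:
  assumes F: "smooth F" and p: "p \<in> siegel_jacobi"
  shows "op_eval Xplus (\<lambda>q. F (act q)) p = R p ** op_eval Xplus F (act p) ** transpose (R p)"
  by (simp add: op_eval_Xplus smooth_compose_act F p act_siegel_jacobi grad_compose_act
      mscale_mult_left mscale_mult_right)

lemma op_eval_Xminus_act:
  assumes F: "smooth F" and p: "p \<in> siegel_jacobi"
  shows "op_eval Xminus (\<lambda>q. F (act q)) p = transpose (J p) ** op_eval Xminus F (act p) ** J p"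
proof -
  have 1: "gradbar (\<lambda>q. F (act q)) p = conj_mat (R p) ** gradbar F (act p)
      ** transpose (conj_mat (R p))"
    using grad_compose_act[OF smooth_cnj[OF F] p] by (simp add: gradbar_def conj_mat_mult
        conj_mat_transpose)
  have 2: "transpose (conj_mat (R p)) ** Ymat p = Ymat (act p) ** J p"
    using arg_cong[OF Ymat_conj_R[OF p], of transpose]
    by (simp add: matrix_transpose_mul transpose_Ymat p act_siegel_jacobi)
  have "Ymat p ** gradbar (\<lambda>q. F (act q)) p ** Ymat p
      = (Ymat p ** conj_mat (R p)) ** gradbar F (act p) ** (transpose (conj_mat (R p)) ** Ymat p)"
    by (simp add: 1 matrix_mul_assoc)
  also have "\<dots> = transpose (J p) ** (Ymat (act p) ** gradbar F (act p) ** Ymat (act p)) ** J p"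
    unfolding Ymat_conj_R[OF p] 2 by (simp add: matrix_mul_assoc)
  finally show ?thesis
    by (simp add: op_eval_Xminus smooth_compose_act F p act_siegel_jacobi mscale_mult_left
        mscale_mult_right)
qed

lemma op_eval_A_one_act:
  assumes F: "smooth F" and p: "p \<in> siegel_jacobi"
  shows "op_eval A_one (\<lambda>q. F (act q)) p = transpose (J p) ** op_eval A_one F (act p)
      ** transpose (R p)"
proof -
  let ?d = "maass_const TYPE('n)"
  define M where "M = (\<lambda>q. mat (F q) :: complex^'n^'n)"
  define h where "h = (\<lambda>q. KK M q ** (A - fst q ** C))"
  have smM: "smooth_mat M" unfolding M_def by (intro smooth_mat_intros F)
  have smh: "smooth_mat h" unfolding h_def by (intro smooth_mat_intros smM)
  have K: "KK (\<lambda>q. mat (F (act q))) q = transpose (conj_mat (J q)) ** h (act q)"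
      if q: "q \<in> siegel_jacobi" for q
    by (simp add: KK_def divZ_mat q grad_compose_act[OF F q] h_def M_def act_siegel_jacobi
        matrix_mul_assoc
        ZmZbar_R transpose_R_eq[OF q, symmetric])
  have "op_eval A_one (\<lambda>q. F (act q)) p = LL (KK (\<lambda>q. mat (F (act q)))) p
      + ?d *\<^sub>m KK (\<lambda>q. mat (F (act q))) p"
    by (rule op_eval_A_one[OF smooth_compose_act[OF F] p])
  also have "LL (KK (\<lambda>q. mat (F (act q)))) p = LL (\<lambda>q. transpose (conj_mat (J q)) ** h (act q)) p"
    by (rule LL_cong[OF K p])
  also have "\<dots> + ?d *\<^sub>m KK (\<lambda>q. mat (F (act q))) p = transpose (J p) ** (LL h (act p)
      + ?d *\<^sub>m h (act p))"
    unfolding K[OF p] by (rule LL_J[OF smh p])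
  also have "LL h (act p) = LL (KK M) (act p) ** transpose (R p)"
    unfolding h_def transpose_R_eq[OF p] by (rule LL_mult_affine[OF smooth_mat_KK[OF smM]
        act_siegel_jacobi[OF p]])
  also have "h (act p) = KK M (act p) ** transpose (R p)"
    by (simp add: h_def transpose_R_eq[OF p])
  finally show ?thesis
    by (simp add: op_eval_A_one[OF F act_siegel_jacobi[OF p]] M_def matrix_add_rdistrib
        mscale_mult_left matrix_mul_assoc[symmetric])
qed

lemma op_eval_Aop_act:
  assumes F: "smooth F" and p: "p \<in> siegel_jacobi"
  shows "op_eval (Aop (Suc j)) (\<lambda>q. F (act q)) p
      = transpose (J p) ** op_eval (Aop (Suc j)) F (act p) ** transpose (R p)"
  using p
proof (induction j arbitrary: p)
  case 0
  then show ?case by (simp add: op_eval_A_one_act[OF F])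
next
  case (Suc j)
  show ?case
    unfolding Aop.simps op_eval_A_step[OF diff_opmat_Aop smooth_compose_act[OF F] Suc.prems]
      op_eval_A_step[OF diff_opmat_Aop F act_siegel_jacobi[OF Suc.prems]]
    by (rule maass_step_act[OF _ _ Suc.IH Suc.prems])
      (intro smooth_mat_op_eval diff_opmat_Aop F smooth_compose_act)+
qed

end

lemma Yminus_sum:
  assumes G: "\<And>i. smooth (G i)" and p: "p \<in> siegel_jacobi"
  shows "(\<Sum>i\<in>UNIV. (Yminus $ k $ i) (G i) p) = (\<Sum>a\<in>UNIV. cnj (DW k a (\<lambda>q. cnj (\<Sum>i\<in>UNIV. Ymat q $ a
      $ i * G i q)) p))"
proof -
  have sm: "smooth (\<lambda>q. Ymat q $ a $ i * G i q)" for a i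
    by (intro smooth_mult smooth_mat_nth[OF smooth_mat_Ymat] G)
  have bar: "(dWbar $ a $ k) H p = cnj (DW k a (\<lambda>q. cnj (H q)) p)" if "smooth H" for a
      and H :: "('a, 'b) point \<Rightarrow> complex"
    using arg_cong[OF op_eval_dWbar[OF that p], of "\<lambda>M. M $ a $ k"] by (simp add: op_eval_dW)
  have "(\<Sum>i\<in>UNIV. (Yminus $ k $ i) (G i) p) = (\<Sum>i\<in>UNIV. \<Sum>a\<in>UNIV. (dWbar $ a $ k) (\<lambda>q. Ymat q $ a $
      i * G i q) p)"
    by (simp add: Yminus_def op_mult_def op_fun_def)
  also have "\<dots> = (\<Sum>a\<in>UNIV. \<Sum>i\<in>UNIV. (dWbar $ a $ k) (\<lambda>q. Ymat q $ a $ i * G i q) p)"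
    by (rule sum.swap)
  also have "\<dots> = (\<Sum>a\<in>UNIV. (dWbar $ a $ k) (\<lambda>q. \<Sum>i\<in>UNIV. Ymat q $ a $ i * G i q) p)"
    by (intro sum.cong refl, rule diff_operator_apply_sum[symmetric])
      (use sm p in \<open>auto intro: diff_opmat_nth[OF diff_opmat_wirtinger(4)]\<close>)
  also have "\<dots> = (\<Sum>a\<in>UNIV. cnj (DW k a (\<lambda>q. cnj (\<Sum>i\<in>UNIV. Ymat q $ a $ i * G i q)) p))"
    by (intro sum.cong refl bar smooth_sum sm)
  finally show ?thesis .
qed

lemma Yminus_divWbar:
  assumes "smooth_mat u" and p: "p \<in> siegel_jacobi"
  shows "(\<Sum>i\<in>UNIV. (Yminus $ k $ i) (\<lambda>q. u q $ i $ b) p) = divWbar (\<lambda>q. Ymat q ** u q) p $ k $ b"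
  using Yminus_sum[OF smooth_mat_nth[OF assms(1)] p, of k "\<lambda>i. i" "\<lambda>_. b"]
  by (simp add: divWbar_def divW_def matrix_mul_componentwise)

lemma dW_divW: "(\<Sum>j\<in>UNIV. (dW $ j $ l) (\<lambda>q. u q $ j $ b) p) = divW u p $ l $ b"
proof -
  have "(dW $ j $ l) H p = DW l j H p" for j H
    using arg_cong[OF op_eval_dW[of H p], of "\<lambda>M. M $ j $ l"] by simp
  then show ?thesis by (simp add: divW_def)
qed

lemma Yminus_row_eq: "Yminus_row k $ i = Yminus $ k" for i :: 1
  by (simp add: vec_eq_iff Yminus_row_def Yminus_def op_mult_def op_col_def)

lemma sum_1: "(\<Sum>i\<in>(UNIV :: 1 set). f i) = f 1"
  by (simp add: UNIV_1)

lemma Yminus_Yplus_eq: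
  assumes F: "smooth F" and p: "p \<in> siegel_jacobi"
  shows "((Yminus \<otimes> Yplus) $ k $ l) F p = divWbar (\<lambda>q. Ymat q ** transpose (gradW F q)) p $ k $ l"
proof -
  have "(dW $ i $ l) F = (\<lambda>q. transpose (gradW F q) $ i $ l)" for i
    using op_eval_dW[of F] by (auto simp: fun_eq_iff gradW_def vec_eq_iff)
  then have "((Yminus \<otimes> Yplus) $ k $ l) F p = (\<Sum>i\<in>UNIV. (Yminus $ k $ i) (\<lambda>q. transpose (gradW F
      q) $ i $ l) p)"
    by (simp add: op_mult_def Yplus_def)
  also have "\<dots> = divWbar (\<lambda>q. Ymat q ** transpose (gradW F q)) p $ k $ l"
    by (rule Yminus_divWbar[OF smooth_mat_transpose[OF smooth_mat_gradW[OF F]] p])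
  finally show ?thesis .
qed

text \<open>
  In the traces one sums over the two inner indices; each sum is a fibre divergence.
\<close>

lemma Top_eq:
  assumes F: "smooth F" and p: "p \<in> siegel_jacobi"
  shows "Top j k l F p = divWbar (\<lambda>q. Ymat q ** transpose (divW (op_eval (Aop j) F) q)) p $ k $ l"
proof -
  define f where "f = op_eval (Aop j) F"
  have f: "smooth_mat f" unfolding f_def by (rule smooth_mat_op_eval[OF diff_opmat_Aop F])
  have Af: "(Aop j $ a $ b) F = (\<lambda>q. f q $ a $ b)" for a b by (simp add: f_def)
  have "Top j k l F p = (\<Sum>i\<in>UNIV. \<Sum>a\<in>UNIV. (Yminus $ k $ i) ((dW $ a $ l) (\<lambda>q. f q $ a $ i)) p)"
    by (simp add: Top_def op_trace_def op_mult_def sum_1 Yminus_row_eq Yplus_col_def op_col_def Af)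
  also have "\<dots> = (\<Sum>i\<in>UNIV. (Yminus $ k $ i) (\<lambda>q. \<Sum>a\<in>UNIV. (dW $ a $ l) (\<lambda>q. f q $ a $ i) q) p)"
    by (intro sum.cong refl, rule diff_operator_apply_sum[symmetric])
      (auto simp: p intro!: diff_opmat_nth diff_opmat_intros smooth_diff_operator[OF
          diff_opmat_nth] smooth_mat_nth[OF f])
  also have "\<dots> = (\<Sum>i\<in>UNIV. (Yminus $ k $ i) (\<lambda>q. transpose (divW f q) $ i $ l) p)"
    unfolding dW_divW by simp
  also have "\<dots> = divWbar (\<lambda>q. Ymat q ** transpose (divW f q)) p $ k $ l"
    by (rule Yminus_divWbar[OF smooth_mat_transpose[OF smooth_mat_divW[OF f]] p])
  finally show ?thesis by (simp add: f_def)
qed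

lemma Uop_eq:
  assumes F: "smooth F" and p: "p \<in> siegel_jacobi"
  shows "Uop k l F p = divWbar (\<lambda>q. Ymat q ** transpose (divWbar (\<lambda>q. Ymat q
      ** op_eval Xplus F q) q)) p $ k $ l"
proof -
  define f where "f = op_eval Xplus F"
  have f: "smooth_mat f" unfolding f_def by (rule smooth_mat_op_eval[OF diff_opmat_Xplus F])
  define u where "u = divWbar (\<lambda>q. Ymat q ** f q)"
  have u: "smooth_mat u" unfolding u_def by (intro smooth_mat_intros f)
  have Af: "(Xplus $ a $ b) F = (\<lambda>q. f q $ a $ b)" for a b by (simp add: f_def)
  have dY: "diff_operator (Yminus $ k $ i)" for k i by (intro diff_opmat_nth diff_opmat_intros)
  have "Uop k l F p = (\<Sum>i\<in>UNIV. \<Sum>a\<in>UNIV. (Yminus $ k $ i) ((Yminus $ l $ a) (\<lambda>q. f q $ a $ i)) p)"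
    by (simp add: Uop_def op_trace_def op_mult_def sum_1 Yminus_row_eq Af)
  also have "\<dots> = (\<Sum>i\<in>UNIV. (Yminus $ k $ i) (\<lambda>q. \<Sum>a\<in>UNIV. (Yminus $ l $ a) (\<lambda>q. f q $ a $ i) q) p)"
    by (intro sum.cong refl, rule diff_operator_apply_sum[symmetric, OF dY])
      (auto simp: p intro!: smooth_diff_operator[OF dY] smooth_mat_nth[OF f])
  also have "\<dots> = (\<Sum>i\<in>UNIV. (Yminus $ k $ i) (\<lambda>q. transpose (u q) $ i $ l) p)"
    by (intro sum.cong refl, rule diff_operator_apply_cong[OF dY])
      (auto simp: p u_def Yminus_divWbar[OF f] intro!: smooth_sum smooth_diff_operator[OF dY]
          smooth_mat_nth[OF f])
  also have "\<dots> = divWbar (\<lambda>q. Ymat q ** transpose (u q)) p $ k $ l"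
    by (rule Yminus_divWbar[OF smooth_mat_transpose[OF u] p])
  finally show ?thesis by (simp add: u_def f_def)
qed

lemma Vop_eq:
  assumes F: "smooth F" and p: "p \<in> siegel_jacobi"
  shows "Vop k l F p = divW (\<lambda>q. transpose (divW (op_eval Xminus F) q)) p $ k $ l"
proof -
  define f where "f = op_eval Xminus F"
  have f: "smooth_mat f" unfolding f_def by (rule smooth_mat_op_eval[OF diff_opmat_Xminus F])
  have Af: "(Xminus $ a $ b) F = (\<lambda>q. f q $ a $ b)" for a b by (simp add: f_def)
  have "Vop k l F p = (\<Sum>i\<in>UNIV. \<Sum>a\<in>UNIV. (dW $ i $ k) ((dW $ a $ l) (\<lambda>q. f q $ a $ i)) p)"
    by (simp add: Vop_def op_trace_def op_mult_def sum_1 Yplus_col_def op_col_def Af)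
  also have "\<dots> = (\<Sum>i\<in>UNIV. (dW $ i $ k) (\<lambda>q. \<Sum>a\<in>UNIV. (dW $ a $ l) (\<lambda>q. f q $ a $ i) q) p)"
    by (intro sum.cong refl, rule diff_operator_apply_sum[symmetric])
      (auto simp: p intro!: diff_opmat_nth diff_opmat_intros smooth_diff_operator[OF
          diff_opmat_nth] smooth_mat_nth[OF f])
  also have "\<dots> = (\<Sum>i\<in>UNIV. (dW $ i $ k) (\<lambda>q. transpose (divW f q) $ i $ l) p)"
    by (intro sum.cong refl) (simp only: dW_divW transpose_componentwise)
  also have "\<dots> = divW (\<lambda>q. transpose (divW f q)) p $ k $ l"
    by (rule dW_divW)
  finally show ?thesis by (simp add: f_def)
qed

text \<open>Invariance may be checked for the complexified action.\<close>

lemma invariant_diff_operatorI: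
  fixes P :: "('n::finite, 'm::finite) operator"
  assumes P: "diff_operator P"
    and inv: "\<And>(A :: complex^'n^'n) B C D (l :: complex^'n^'m) u F p. jacobi_element A B C D l u \<Longrightarrow>
        smooth F \<Longrightarrow>
      p \<in> siegel_jacobi \<Longrightarrow> P (\<lambda>q. F (jacobi_element.act A B C D l u q)) p
          = P F (jacobi_element.act A B C D l u p)"
  shows "invariant_diff_operator P"
  unfolding invariant_diff_operator_def
proof (intro conjI P allI impI ballI)
  fix F :: "('n, 'm) point \<Rightarrow> complex" and g :: "('n, 'm) jacobi_elt" and p :: "('n, 'm) point"
  assume F: "smooth F" and g: "g \<in> jacobi_group" and p: "p \<in> siegel_jacobi"
  obtain M l u k where "g = (M, l, u, k)" by (metis prod_cases4)
  with g inv[OF jacobi_act_element(1) F p, of M l u k] show "P (F \<circ> jacobi_act g) p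
      = (P F \<circ> jacobi_act g) p"
    by (simp add: jacobi_act_element(2) o_def)
qed

lemma invariant_Yminus_Yplus:
  "invariant_diff_operator ((Yminus \<otimes> Yplus :: ('n::finite, 'm::finite) operator^'m^'m) $ k $ l)"
proof (rule invariant_diff_operatorI)
  show "diff_operator ((Yminus \<otimes> Yplus :: ('n, 'm) operator^'m^'m) $ k $ l)"
      by (intro diff_opmat_nth diff_opmat_intros)
  fix A B C D :: "complex^'n^'n" and l' u :: "complex^'n^'m" and F :: "('n, 'm) point \<Rightarrow> complex"
      and p :: "('n, 'm) point"
  assume "jacobi_element A B C D l' u" and F: "smooth F" and p: "p \<in> siegel_jacobi"
  then interpret jacobi_element A B C D l' u by simp
  show "((Yminus \<otimes> Yplus) $ k $ l) (\<lambda>q. F (act q)) p = ((Yminus \<otimes> Yplus) $ k $ l) F (act p)"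
    by (simp add: Yminus_Yplus_eq smooth_compose_act F p act_siegel_jacobi
        divWbar_Ymat_act[OF smooth_mat_gradW[OF F] gradW_compose_act[OF F] p])
qed

lemma invariant_Hop:
  assumes "j \<ge> 1"
  shows "invariant_diff_operator (Hop j :: ('n::finite, 'm::finite) operator)"
proof (rule invariant_diff_operatorI)
  show "diff_operator (Hop j :: ('n, 'm) operator)" unfolding Hop_def by (intro diff_opmat_intros)
  obtain i where j: "j = Suc i" using assms by (cases j) auto
  fix A B C D :: "complex^'n^'n" and l' u :: "complex^'n^'m" and F :: "('n, 'm) point \<Rightarrow> complex"
      and p :: "('n, 'm) point"
  assume "jacobi_element A B C D l' u" and F: "smooth F" and p: "p \<in> siegel_jacobi"
  then interpret jacobi_element A B C D l' u by simp
  have H: "Hop j G q = trace (op_eval (Aop j) G q)" for G and q :: "('n, 'm) point"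
    by (simp add: Hop_def op_trace_def trace_def)
  have "Hop j (\<lambda>q. F (act q)) p = trace (transpose (R p) ** (transpose (J p)
      ** op_eval (Aop j) F (act p)))"
    unfolding H unfolding j op_eval_Aop_act[OF F p] by (rule trace_mul_sym)
  then show "Hop j (\<lambda>q. F (act q)) p = Hop j F (act p)"
    by (simp add: matrix_mul_assoc transpose_R_J p H)
qed

lemma invariant_Top:
  assumes "j \<ge> 1"
  shows "invariant_diff_operator (Top j k l :: ('n::finite, 'm::finite) operator)"
proof (rule invariant_diff_operatorI)
  show "diff_operator (Top j k l :: ('n, 'm) operator)" unfolding Top_def
      by (intro diff_opmat_intros)
  obtain i where j: "j = Suc i" using assms by (cases j) auto
  fix A B C D :: "complex^'n^'n" and l' u :: "complex^'n^'m" and F :: "('n, 'm) point \<Rightarrow> complex"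
      and p :: "('n, 'm) point"
  assume "jacobi_element A B C D l' u" and F: "smooth F" and p: "p \<in> siegel_jacobi"
  then interpret jacobi_element A B C D l' u by simp
  define f where "f = op_eval (Aop j) F"
  have f: "smooth_mat f" unfolding f_def by (rule smooth_mat_op_eval[OF diff_opmat_Aop F])
  have "divW (op_eval (Aop j) (\<lambda>q. F (act q))) q = divW f (act q) ** transpose (R q)"
      if q: "q \<in> siegel_jacobi" for q
  proof -
    have "divW (op_eval (Aop j) (\<lambda>q. F (act q))) q = divW (\<lambda>q. (transpose (J q) ** f (act q))
        ** transpose (R q)) q"
      by (rule divW_cong[OF _ q]) (simp add: j op_eval_Aop_act[OF F] f_def)
    also have "\<dots> = divW (\<lambda>q. transpose (J q) ** f (act q)) q ** transpose (R q)"
    proof (rule divW_mult_base[OF _ _ _ q])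
      show "transpose (R r) = transpose (R s)" if "fst r = fst s" for r s
        using R_base[OF that] by simp
    qed (intro smooth_mat_intros smooth_mat_compose_act f)+
    finally show ?thesis by (simp add: divW_J_act[OF f q])
  qed
  then have "divWbar (\<lambda>q. Ymat q ** transpose (divW (op_eval (Aop j) (\<lambda>q. F (act q))) q)) p
      = divWbar (\<lambda>q. Ymat q ** transpose (divW f q)) (act p)"
    by (rule divWbar_Ymat_act[OF smooth_mat_divW[OF f] _ p])
  then show "Top j k l (\<lambda>q. F (act q)) p = Top j k l F (act p)"
    by (simp add: Top_eq smooth_compose_act F p act_siegel_jacobi f_def)
qed

lemma invariant_Uop: "invariant_diff_operator (Uop k l :: ('n::finite, 'm::finite) operator)"
proof (rule invariant_diff_operatorI)
  show "diff_operator (Uop k l :: ('n, 'm) operator)" unfolding Uop_def by (intro diff_opmat_intros)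
  fix A B C D :: "complex^'n^'n" and l' u :: "complex^'n^'m" and F :: "('n, 'm) point \<Rightarrow> complex"
      and p :: "('n, 'm) point"
  assume "jacobi_element A B C D l' u" and F: "smooth F" and p: "p \<in> siegel_jacobi"
  then interpret jacobi_element A B C D l' u by simp
  define f where "f = (\<lambda>q. Ymat q ** op_eval Xplus F q)"
  have f: "smooth_mat f" unfolding f_def by (intro smooth_mat_intros smooth_mat_op_eval
      diff_opmat_intros F)
  have "divWbar (\<lambda>q. Ymat q ** op_eval Xplus (\<lambda>q. F (act q)) q) q
      = divWbar f (act q) ** transpose (R q)"
    if q: "q \<in> siegel_jacobi" for q
  proof -
    have "divWbar (\<lambda>q. Ymat q ** op_eval Xplus (\<lambda>q. F (act q)) q) q
       = divWbar (\<lambda>q. (transpose (conj_mat (J q)) ** f (act q)) ** transpose (R q)) q"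
      by (rule divWbar_cong[OF _ q]) (simp add: op_eval_Xplus_act[OF F] f_def matrix_mul_assoc
          Ymat_R)
    also have "\<dots> = divWbar (\<lambda>q. transpose (conj_mat (J q)) ** f (act q)) q ** transpose (R q)"
    proof (rule divWbar_mult_base[OF _ _ _ q])
      show "transpose (R r) = transpose (R s)" if "fst r = fst s" for r s
        using R_base[OF that] by simp
    qed (intro smooth_mat_intros smooth_mat_compose_act f)+
    finally show ?thesis by (simp add: divWbar_J_act[OF f q])
  qed
  then have "divWbar (\<lambda>q. Ymat q ** transpose (divWbar (\<lambda>q. Ymat q
      ** op_eval Xplus (\<lambda>q. F (act q)) q) q)) p
      = divWbar (\<lambda>q. Ymat q ** transpose (divWbar f q)) (act p)"
    by (rule divWbar_Ymat_act[OF smooth_mat_divWbar[OF f] _ p])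
  then show "Uop k l (\<lambda>q. F (act q)) p = Uop k l F (act p)"
    by (simp add: Uop_eq smooth_compose_act F p act_siegel_jacobi f_def)
qed

lemma invariant_Vop: "invariant_diff_operator (Vop k l :: ('n::finite, 'm::finite) operator)"
proof (rule invariant_diff_operatorI)
  show "diff_operator (Vop k l :: ('n, 'm) operator)" unfolding Vop_def by (intro diff_opmat_intros)
  fix A B C D :: "complex^'n^'n" and l' u :: "complex^'n^'m" and F :: "('n, 'm) point \<Rightarrow> complex"
      and p :: "('n, 'm) point"
  assume "jacobi_element A B C D l' u" and F: "smooth F" and p: "p \<in> siegel_jacobi"
  then interpret jacobi_element A B C D l' u by simp
  define f where "f = op_eval Xminus F"
  have f: "smooth_mat f" unfolding f_def by (rule smooth_mat_op_eval[OF diff_opmat_Xminus F])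
  have "transpose (divW (op_eval Xminus (\<lambda>q. F (act q))) q) = transpose (J q)
      ** transpose (divW f (act q))"
    if q: "q \<in> siegel_jacobi" for q
  proof -
    have "divW (op_eval Xminus (\<lambda>q. F (act q))) q = divW (\<lambda>q. (transpose (J q) ** f (act q))
        ** J q) q"
      by (rule divW_cong[OF _ q]) (simp add: op_eval_Xminus_act[OF F] f_def)
    also have "\<dots> = divW (\<lambda>q. transpose (J q) ** f (act q)) q ** J q"
      by (rule divW_mult_base[OF _ _ J_base q]) (intro smooth_mat_intros smooth_mat_compose_act f)+
    finally show ?thesis by (simp add: divW_J_act[OF f q] matrix_transpose_mul)
  qed
  then have "divW (\<lambda>q. transpose (divW (op_eval Xminus (\<lambda>q. F (act q))) q)) p
     = divW (\<lambda>q. transpose (J q) ** transpose (divW f (act q))) p"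
    by (rule divW_cong[OF _ p])
  also have "\<dots> = divW (\<lambda>q. transpose (divW f q)) (act p)"
    by (rule divW_J_act[OF _ p]) (intro smooth_mat_intros f)
  finally show "Vop k l (\<lambda>q. F (act q)) p = Vop k l F (act p)"
    by (simp add: Vop_eq smooth_compose_act F p act_siegel_jacobi f_def)
qed

theorem theorem1p4:
  shows "invariant_opmat (Yminus \<otimes> Yplus :: ('n::finite, 'm::finite) operator^'m^'m)
    \<and> (\<forall>k l. invariant_diff_operator ((Yminus \<otimes> Yplus :: ('n, 'm) operator^'m^'m) $ k $ l))
    \<and> (\<forall>j\<ge>1. \<forall>k l :: 'm.
          invariant_diff_operator (Hop j :: ('n, 'm) operator)
        \<and> invariant_diff_operator (Top j k l :: ('n, 'm) operator)
        \<and> invariant_diff_operator (Uop k l :: ('n, 'm) operator)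
        \<and> invariant_diff_operator (Vop k l :: ('n, 'm) operator))"
  unfolding invariant_opmat_def
  by (simp add: invariant_Yminus_Yplus invariant_Hop invariant_Top invariant_Uop invariant_Vop)

end
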